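(* Assume (C1), (GC), (C2), $(\mathcal L_V)$, (U), (S) hold (see context). Let $\beta\in(0,1]$, let $\varphi\in\mathcal C^{3,\beta}(\mathbb R^d,\mathbb R)$ be Lipschitz continuous with $|\varphi(x)|\le C_{V,\varphi}(1+\sqrt{V(x)})$ for all $x$ and some $C_{V,\varphi}>0$, let $\theta\in(\frac1{2+\beta},1]$ and $\gamma_k\asymp k^{-\theta}$. (a) Suppose that there is a solution $\vartheta$ to the Poisson equation $\mathcal A\vartheta=\|\sigma\|^2-\nu(\|\sigma\|^2)$ (where $\|\sigma\|^2$ is the function $x\mapsto\|\sigma(x)\|^2$, $\|\cdot\|$ the operator norm) satisfying the same smoothness and growth conditions as $\varphi$, i.e. $\vartheta\in\mathcal C^{3,\beta}(\mathbb R^d,\mathbb R)$ is Lipschitz continuous and $|\vartheta(x)|\le C_{V,\vartheta}(1+\sqrt{V(x)})$ for all $x$ and some $C_{V,\vartheta}>0$. Then there exist two (explicit) monotonic sequences $\tilde c_n\le1\le\tilde C_n$, $n\ge1$, with $\lim_n\tilde C_n=\lim_n\tilde c_n=1$, such that for all $n\ge1$ and all $0<a\le\chi_n\frac{\sqrt{\Gamma_n}}{\Gamma_n^{(2)}}$, for a positive sequence $\chi_n\to0$ which can be taken to converge to $0$ arbitrarily slowly, so that $\chi_n\frac{\sqrt{\Gamma_n}}{\Gamma_n^{(2)}}\to+\infty$: $$\mathbb P\big[|\sqrt{\Gamma_n}\,\nu_n(\mathcal A\varphi)|\ge a\big]\le2\,\tilde C_n\exp\Big(-\tilde c_n\frac{a^2}{2\nu(\|\sigma\|^2)\|\nabla\varphi\|_\infty^2}\Big).$$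 (b) Let $|||\cdot|||$ be a matrix norm dominating the operator norm (so $|||\sigma(x)|||\ge\|\sigma(x)\|$). If instead $\vartheta$, with the same smoothness and growth conditions, solves $\mathcal A\vartheta=|||\sigma|||^2-\nu(|||\sigma|||^2)$, then the conclusion of (a) holds with $\nu(|||\sigma|||^2)$ in place of $\nu(\|\sigma\|^2)$.
   Context: Setting. $b:\mathbb R^d\to\mathbb R^d$ and $\sigma:\mathbb R^d\to\mathbb R^d\otimes\mathbb R^r$ ($d\times r$ matrices) are Lipschitz continuous; $dY_t=b(Y_t)dt+\sigma(Y_t)dW_t$, $W$ an $r$-dimensional Wiener process. $\Sigma:=\sigma\sigma^*$, and the generator is $\mathcal A\varphi(x)=\langle b(x),\nabla\varphi(x)\rangle+\frac12\mathrm{Tr}(\Sigma(x)D^2\varphi(x))$. Scheme: $X_{n+1}=X_n+\gamma_{n+1}b(X_n)+\sqrt{\gamma_{n+1}}\,\sigma(X_n)U_{n+1}$, $n\ge0$, with $X_0\in L^2$, $(U_n)_{n\ge1}$ i.i.d. $\mathbb R^r$-valued, positive steps $\gamma_k\downarrow0$ with $\sum_k\gamma_k=+\infty$. $\Gamma_n:=\sum_{k=1}^n\gamma_k$, $\Gamma_n^{(\ell)}:=\sum_{k=1}^n\gamma_k^\ell$. Empirical measure: $\nu_n(f):=\frac1{\Gamma_n}\sum_{k=1}^n\gamma_kf(X_{k-1})$. $u_n\asymp v_n$ means: there are $n_0$, $C\ge1$ with $C^{-1}v_n\le u_n\le Cv_n$ for $n\ge n_0$. Norms: $|\cdot|$ Euclidean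 norm; $\|\cdot\|$ operator norm of matrices; $\|\nabla\varphi\|_\infty:=\sup_x|\nabla\varphi(x)|$. $\mathcal C^{k,\beta}$ is the set of $\mathcal C^k$ functions whose partial derivatives of orders $1,\dots,k$ are bounded and whose order-$k$ partial derivatives are $\beta$-Hölder continuous (the function itself need not be bounded). Assumptions. (C1): there is $\lambda_0>0$ with $\mathbb E[\exp(\lambda|X_0|^2)]<\infty$ for all $\lambda<\lambda_0$. (GC): $\mathbb E[U_1]=0$, $\mathbb E[U_1^iU_1^j]=\delta_{ij}$, $\mathbb E[U_1^iU_1^jU_1^k]=0$ for all $i,j,k$; $(U_n)$ and $X_0$ are independent; and for every $1$-Lipschitz $g:\mathbb R^r\to\mathbb R$ and every $\lambda>0$, $\mathbb E[\exp(\lambda g(U_1))]\le\exp(\lambda\mathbb E[g(U_1)]+\lambda^2/2)$. (C2): $\sup_x\|\sigma(x)\|^2\le\kappa<\infty$. $(\mathcal L_V)$: there is $V:\mathbb R^d\to[v^*,+\infty)$, $v^*>0$, with (i) $V\in\mathcal C^2$, $\|D^2V\|_\infty<\infty$, $V(x)\to+\infty$ as $|x|\to\infty$; (ii) $|\nabla V(x)|^2+|b(x)|^2\le C_VV(x)$ for all $x$, some $C_V\in(0,\infty)$; (iii) $\mathcal AV(x)\le-\alpha_VV(x)+\beta_V$ for all $x$, some $\alpha_V>0$, $\beta_V\ge0$. (By (i) there are $K,\bar c$ with $|V(x)|\le\bar c|x|^2$ for $|x|\ge K$.) (U): the diffusion has a unique invariant distribution $\nu$. (S): $\gamma_k\le\frac12\min\big(\frac1{\sqrt{C_V\bar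 c}},\frac{\alpha_V}{C_V\|D^2V\|_\infty}\big)$ for all $k\ge1$. *)

theory Defs
  imports "HOL-Probability.Probability"
begin

section \<open>Smooth functions and the generator\<close>

definition pdiff :: "'n \<Rightarrow> (real^'n \<Rightarrow> real) \<Rightarrow> real^'n \<Rightarrow> real" where
  "pdiff i f x = frechet_derivative f (at x) (axis i 1)"

definition pdiffs :: "'n list \<Rightarrow> (real^'n \<Rightarrow> real) \<Rightarrow> real^'n \<Rightarrow> real" where
  "pdiffs is f = foldr pdiff is f"

definition C_k :: "nat \<Rightarrow> (real^'n \<Rightarrow> real) \<Rightarrow> bool" where
  "C_k k f \<longleftrightarrow>
     (\<forall>is. length is < k \<longrightarrow> (\<forall>x. pdiffs is f differentiable (at x))) \<and>
     (\<forall>is. length is \<le> k \<longrightarrow> continuous_on UNIV (pdiffs is f))"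

definition holder :: "real \<Rightarrow> (real^'n \<Rightarrow> real) \<Rightarrow> bool" where
  "holder \<beta> g \<longleftrightarrow> (\<exists>C. \<forall>x y. \<bar>g x - g y\<bar> \<le> C * norm (x - y) powr \<beta>)"

text \<open>The function itself (the case of an empty list of indices) need not be bounded.\<close>

definition C_k_holder :: "nat \<Rightarrow> real \<Rightarrow> (real^'n \<Rightarrow> real) \<Rightarrow> bool" where
  "C_k_holder k \<beta> f \<longleftrightarrow> C_k k f \<and>
     (\<forall>is. 1 \<le> length is \<and> length is \<le> k \<longrightarrow> bounded (range (pdiffs is f))) \<and>
     (\<forall>is. length is = k \<longrightarrow> holder \<beta> (pdiffs is f))"

definition grad :: "(real^'n \<Rightarrow> real) \<Rightarrow> real^'n \<Rightarrow> real^'n" where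
  "grad f x = (\<chi> i. pdiff i f x)"

definition hess :: "(real^'n \<Rightarrow> real) \<Rightarrow> real^'n \<Rightarrow> real^'n^'n" where
  "hess f x = (\<chi> i j. pdiffs [i, j] f x)"

abbreviation op_norm :: "real^'m^'n \<Rightarrow> real" where
  "op_norm A \<equiv> onorm ((*v) A)"

definition grad_sup :: "(real^'n \<Rightarrow> real) \<Rightarrow> real" where
  "grad_sup f = (SUP x. norm (grad f x))"

definition hess_sup :: "(real^'n \<Rightarrow> real) \<Rightarrow> real" where
  "hess_sup f = (SUP x. op_norm (hess f x))"

definition generator ::
  "(real^'d \<Rightarrow> real^'d) \<Rightarrow> (real^'d \<Rightarrow> real^'r^'d) \<Rightarrow> (real^'d \<Rightarrow> real) \<Rightarrow> real^'d \<Rightarrow> real" where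
  "generator b \<sigma> f x =
     b x \<bullet> grad f x + 1/2 * trace ((\<sigma> x ** transpose (\<sigma> x)) ** hess f x)"

definition matrix_norm :: "(real^'m^'n \<Rightarrow> real) \<Rightarrow> bool" where
  "matrix_norm N \<longleftrightarrow>
     (\<forall>A. 0 \<le> N A) \<and> (\<forall>A. N A = 0 \<longleftrightarrow> A = 0) \<and>
     (\<forall>c A. N (c *\<^sub>R A) = \<bar>c\<bar> * N A) \<and> (\<forall>A B. N (A + B) \<le> N A + N B)"


section \<open>The diffusion and its invariant distributions\<close>

definition tendsto_in_prob :: "'w measure \<Rightarrow> (nat \<Rightarrow> 'w \<Rightarrow> ennreal) \<Rightarrow> bool" where
  \<comment> \<open>convergence to 0\<close>
  "tendsto_in_prob N Z \<longleftrightarrow>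
     (\<forall>\<epsilon>>0. (\<lambda>n. measure N {\<omega> \<in> space N. ennreal \<epsilon> < Z n \<omega>}) \<longlonglongrightarrow> 0)"

definition stochastic_basis :: "'w measure \<Rightarrow> (real \<Rightarrow> 'w measure) \<Rightarrow> bool" where
  "stochastic_basis N F \<longleftrightarrow>
     prob_space N \<and> filtration (space N) F \<and> (\<forall>t. subalgebra N (F t))"

definition wiener ::
  "'w measure \<Rightarrow> (real \<Rightarrow> 'w measure) \<Rightarrow> (real \<Rightarrow> 'w \<Rightarrow> real^'r) \<Rightarrow> bool" where
  "wiener N F W \<longleftrightarrow>
     (\<forall>t\<ge>0. W t \<in> borel_measurable (F t)) \<and>
     (\<forall>\<omega>\<in>space N. continuous_on {0..} (\<lambda>t. W t \<omega>)) \<and>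
     (AE \<omega> in N. W 0 \<omega> = 0) \<and>
     (\<forall>s t. 0 \<le> s \<and> s < t \<longrightarrow>
        distributed N lborel (\<lambda>\<omega>. W t \<omega> - W s \<omega>)
          (\<lambda>z. ennreal (\<Prod>i\<in>UNIV. normal_density 0 (sqrt (t - s)) (z $ i))) \<and>
        prob_space.indep_set N (sets (F s))
          (sets (vimage_algebra (space N) (\<lambda>\<omega>. W t \<omega> - W s \<omega>) borel)))"

text \<open>
  The Ito integral is the limit in probability of the elementary integrals of step processes
  (bounded and adapted, constant on left-open intervals) that approximate the integrand in
  \<open>L\<^sup>2([0,t])\<close>, in probability.  A step process is given by the number \<open>m\<close> of its intervals,
  their end points \<open>s 0 \<le> \<dots> \<le> s m\<close>, and its values \<open>\<xi> i\<close>.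
\<close>

definition step_process ::
  "'w measure \<Rightarrow> (real \<Rightarrow> 'w measure) \<Rightarrow> nat \<Rightarrow> (nat \<Rightarrow> real) \<Rightarrow> (nat \<Rightarrow> 'w \<Rightarrow> real^'r^'d) \<Rightarrow> bool" where
  "step_process N F m s \<xi> \<longleftrightarrow>
     0 \<le> s 0 \<and> (\<forall>i<m. s i \<le> s (Suc i)) \<and>
     (\<forall>i<m. \<xi> i \<in> borel_measurable (F (s i)) \<and> bounded (\<xi> i ` space N))"

definition step_value ::
  "nat \<Rightarrow> (nat \<Rightarrow> real) \<Rightarrow> (nat \<Rightarrow> 'w \<Rightarrow> real^'r^'d) \<Rightarrow> real \<Rightarrow> 'w \<Rightarrow> real^'r^'d" where
  "step_value m s \<xi> u \<omega> = (\<Sum>i<m. indicator {s i<..s (Suc i)} u *\<^sub>R \<xi> i \<omega>)"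

definition step_integral ::
  "(real \<Rightarrow> 'w \<Rightarrow> real^'r) \<Rightarrow> nat \<Rightarrow> (nat \<Rightarrow> real) \<Rightarrow> (nat \<Rightarrow> 'w \<Rightarrow> real^'r^'d) \<Rightarrow> real \<Rightarrow> 'w \<Rightarrow> real^'d" where
  "step_integral W m s \<xi> t \<omega> =
     (\<Sum>i<m. \<xi> i \<omega> *v (W (min t (s (Suc i))) \<omega> - W (min t (s i)) \<omega>))"

definition has_ito_integral ::
  "'w measure \<Rightarrow> (real \<Rightarrow> 'w measure) \<Rightarrow> (real \<Rightarrow> 'w \<Rightarrow> real^'r) \<Rightarrow>
   (real \<Rightarrow> 'w \<Rightarrow> real^'r^'d) \<Rightarrow> real \<Rightarrow> ('w \<Rightarrow> real^'d) \<Rightarrow> bool" where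
  "has_ito_integral N F W H t I \<longleftrightarrow>
     (\<exists>m s \<xi>. (\<forall>n. step_process N F (m n) (s n) (\<xi> n)) \<and>
        tendsto_in_prob N
          (\<lambda>n \<omega>. \<integral>\<^sup>+u\<in>{0..t}. ennreal ((norm (H u \<omega> - step_value (m n) (s n) (\<xi> n) u \<omega>))\<^sup>2) \<partial>lborel) \<and>
        tendsto_in_prob N
          (\<lambda>n \<omega>. ennreal (norm (I \<omega> - step_integral W (m n) (s n) (\<xi> n) t \<omega>))))"

definition sde_solution ::
  "'w measure \<Rightarrow> (real \<Rightarrow> 'w measure) \<Rightarrow> (real \<Rightarrow> 'w \<Rightarrow> real^'r) \<Rightarrow>
   (real^'d \<Rightarrow> real^'d) \<Rightarrow> (real^'d \<Rightarrow> real^'r^'d) \<Rightarrow> real^'d \<Rightarrow> (real \<Rightarrow> 'w \<Rightarrow> real^'d) \<Rightarrow> bool" where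
  "sde_solution N F W b \<sigma> x Y \<longleftrightarrow>
     (\<forall>t\<ge>0. Y t \<in> borel_measurable (F t)) \<and>
     (\<forall>\<omega>\<in>space N. continuous_on {0..} (\<lambda>t. Y t \<omega>)) \<and>
     (AE \<omega> in N. Y 0 \<omega> = x) \<and>
     (\<forall>t\<ge>0. has_ito_integral N F W (\<lambda>u \<omega>. \<sigma> (Y u \<omega>)) t
        (\<lambda>\<omega>. Y t \<omega> - x - (LINT u:{0..t}|lborel. b (Y u \<omega>))))"

text \<open>\<open>Y x\<close> is the solution started at \<open>x\<close>.\<close>

definition diffusion ::
  "'w measure \<Rightarrow> (real \<Rightarrow> 'w measure) \<Rightarrow> (real \<Rightarrow> 'w \<Rightarrow> real^'r) \<Rightarrow>
   (real^'d \<Rightarrow> real^'d) \<Rightarrow> (real^'d \<Rightarrow> real^'r^'d) \<Rightarrow> (real^'d \<Rightarrow> real \<Rightarrow> 'w \<Rightarrow> real^'d) \<Rightarrow> bool" where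
  "diffusion N F W b \<sigma> Y \<longleftrightarrow>
     stochastic_basis N F \<and> wiener N F W \<and> (\<forall>x. sde_solution N F W b \<sigma> x (Y x))"

text \<open>Invariance under the transition kernels \<open>(x, A) \<mapsto> N (Y x t \<in> A)\<close> for all \<open>t \<ge> 0\<close>.\<close>

definition invariant_distribution ::
  "'w measure \<Rightarrow> (real^'d \<Rightarrow> real \<Rightarrow> 'w \<Rightarrow> real^'d) \<Rightarrow> (real^'d) measure \<Rightarrow> bool" where
  "invariant_distribution N Y \<mu> \<longleftrightarrow>
     prob_space \<mu> \<and> sets \<mu> = sets borel \<and>
     (\<forall>t\<ge>0. \<forall>A\<in>sets borel.
        (\<integral>\<^sup>+x. emeasure N {\<omega> \<in> space N. Y x t \<omega> \<in> A} \<partial>\<mu>) = emeasure \<mu> A)"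

definition unique_invariant_distribution ::
  "'w measure \<Rightarrow> (real^'d \<Rightarrow> real \<Rightarrow> 'w \<Rightarrow> real^'d) \<Rightarrow> (real^'d) measure \<Rightarrow> bool" where
  "unique_invariant_distribution N Y \<nu> \<longleftrightarrow>
     invariant_distribution N Y \<nu> \<and> (\<forall>\<mu>. invariant_distribution N Y \<mu> \<longrightarrow> \<mu> = \<nu>)"


section \<open>The scheme and its empirical measure\<close>

text \<open>Steps \<open>\<gamma>\<close> and innovations \<open>U\<close> are indexed from 1; their values at 0 are never used.\<close>

primrec scheme ::
  "(real^'d \<Rightarrow> real^'d) \<Rightarrow> (real^'d \<Rightarrow> real^'r^'d) \<Rightarrow> (nat \<Rightarrow> real) \<Rightarrow>
   ('s \<Rightarrow> real^'d) \<Rightarrow> (nat \<Rightarrow> 's \<Rightarrow> real^'r) \<Rightarrow> nat \<Rightarrow> 's \<Rightarrow> real^'d" where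
  "scheme b \<sigma> \<gamma> X0 U 0 \<omega> = X0 \<omega>"
| "scheme b \<sigma> \<gamma> X0 U (Suc n) \<omega> =
     scheme b \<sigma> \<gamma> X0 U n \<omega> + \<gamma> (Suc n) *\<^sub>R b (scheme b \<sigma> \<gamma> X0 U n \<omega>)
     + sqrt (\<gamma> (Suc n)) *\<^sub>R (\<sigma> (scheme b \<sigma> \<gamma> X0 U n \<omega>) *v U (Suc n) \<omega>)"

definition step_sum :: "(nat \<Rightarrow> real) \<Rightarrow> nat \<Rightarrow> nat \<Rightarrow> real" where
  "step_sum \<gamma> l n = (\<Sum>k=1..n. \<gamma> k ^ l)"

abbreviation Gam :: "(nat \<Rightarrow> real) \<Rightarrow> nat \<Rightarrow> real" where
  "Gam \<gamma> n \<equiv> step_sum \<gamma> 1 n"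

definition empirical ::
  "(nat \<Rightarrow> real) \<Rightarrow> (nat \<Rightarrow> 's \<Rightarrow> real^'d) \<Rightarrow> nat \<Rightarrow> (real^'d \<Rightarrow> real) \<Rightarrow> 's \<Rightarrow> real" where
  "empirical \<gamma> X n f \<omega> = 1 / Gam \<gamma> n * (\<Sum>k=1..n. \<gamma> k * f (X (k - 1) \<omega>))"

definition step_sequence :: "(nat \<Rightarrow> real) \<Rightarrow> bool" where
  "step_sequence \<gamma> \<longleftrightarrow>
     (\<forall>k\<ge>1. 0 < \<gamma> k) \<and> (\<forall>k\<ge>1. \<gamma> (Suc k) \<le> \<gamma> k) \<and> \<gamma> \<longlonglongrightarrow> 0 \<and>
     filterlim (Gam \<gamma>) at_top sequentially"


section \<open>Assumptions\<close>

definition assm_C1 :: "'s measure \<Rightarrow> ('s \<Rightarrow> real^'d) \<Rightarrow> bool" where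
  "assm_C1 M X0 \<longleftrightarrow>
     (\<exists>l0>0. \<forall>l<l0. integrable M (\<lambda>\<omega>. exp (l * (norm (X0 \<omega>))\<^sup>2)))"

text \<open>
  The exponential moments below are required to be finite explicitly. Applied to \<open>g\<close> and \<open>- g\<close> this
  makes \<open>g (U 1)\<close>, hence every polynomial in \<open>U 1\<close>, integrable, so that all expectations are genuine.
\<close>

definition assm_GC :: "'s measure \<Rightarrow> ('s \<Rightarrow> real^'d) \<Rightarrow> (nat \<Rightarrow> 's \<Rightarrow> real^'r) \<Rightarrow> bool" where
  "assm_GC M X0 U \<longleftrightarrow>
     prob_space.indep_vars M (\<lambda>_. borel) U {1..} \<and>
     (\<forall>n\<ge>1. distr M borel (U n) = distr M borel (U 1)) \<and>
     prob_space.indep_set M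
       (sets (vimage_algebra (space M) X0 borel))
       (sets (vimage_algebra (space M) (\<lambda>\<omega>. \<lambda>n\<in>{1..}. U n \<omega>) (\<Pi>\<^sub>M n\<in>{1..}. borel))) \<and>
     (\<forall>i. (\<integral>\<omega>. U 1 \<omega> $ i \<partial>M) = 0) \<and>
     (\<forall>i j. (\<integral>\<omega>. U 1 \<omega> $ i * U 1 \<omega> $ j \<partial>M) = (if i = j then 1 else 0)) \<and>
     (\<forall>i j k. (\<integral>\<omega>. U 1 \<omega> $ i * U 1 \<omega> $ j * U 1 \<omega> $ k \<partial>M) = 0) \<and>
     (\<forall>(g :: real^'r \<Rightarrow> real) l. 1-lipschitz_on UNIV g \<and> 0 < l \<longrightarrow>
        integrable M (\<lambda>\<omega>. exp (l * g (U 1 \<omega>))) \<and>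
        (\<integral>\<omega>. exp (l * g (U 1 \<omega>)) \<partial>M) \<le> exp (l * (\<integral>\<omega>. g (U 1 \<omega>) \<partial>M) + l\<^sup>2 / 2))"

definition assm_C2 :: "(real^'d \<Rightarrow> real^'r^'d) \<Rightarrow> bool" where
  "assm_C2 \<sigma> \<longleftrightarrow> (\<exists>\<kappa>. \<forall>x. (op_norm (\<sigma> x))\<^sup>2 \<le> \<kappa>)"

definition assm_LV ::
  "(real^'d \<Rightarrow> real^'d) \<Rightarrow> (real^'d \<Rightarrow> real^'r^'d) \<Rightarrow> (real^'d \<Rightarrow> real) \<Rightarrow>
   real \<Rightarrow> real \<Rightarrow> real \<Rightarrow> real \<Rightarrow> bool" where
  "assm_LV b \<sigma> V vs CV \<alpha>V \<beta>V \<longleftrightarrow>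
     0 < vs \<and> 0 < CV \<and> 0 < \<alpha>V \<and> 0 \<le> \<beta>V \<and>
     (\<forall>x. vs \<le> V x) \<and>
     C_k 2 V \<and> bdd_above (range (\<lambda>x. op_norm (hess V x))) \<and>
     filterlim V at_top at_infinity \<and>
     (\<forall>x. (norm (grad V x))\<^sup>2 + (norm (b x))\<^sup>2 \<le> CV * V x) \<and>
     (\<forall>x. generator b \<sigma> V x \<le> - \<alpha>V * V x + \<beta>V)"

definition assm_S ::
  "(nat \<Rightarrow> real) \<Rightarrow> (real^'d \<Rightarrow> real) \<Rightarrow> real \<Rightarrow> real \<Rightarrow> real \<Rightarrow> bool" where
  "assm_S \<gamma> V CV \<alpha>V cbar \<longleftrightarrow>
     (\<forall>k\<ge>1. \<gamma> k \<le> 1/2 * min (1 / sqrt (CV * cbar)) (\<alpha>V / (CV * hess_sup V)))"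

definition test_function :: "real \<Rightarrow> (real^'d \<Rightarrow> real) \<Rightarrow> (real^'d \<Rightarrow> real) \<Rightarrow> bool" where
  "test_function \<beta> V f \<longleftrightarrow>
     C_k_holder 3 \<beta> f \<and> (\<exists>L. L-lipschitz_on UNIV f) \<and>
     (\<exists>C>0. \<forall>x. \<bar>f x\<bar> \<le> C * (1 + sqrt (V x)))"


section \<open>The deviation bound\<close>

text \<open>
  \<open>\<rho>\<close> tends to 0 arbitrarily slowly: it can be chosen above any prescribed null sequence \<open>\<delta>\<close>.
  The sequences \<open>c\<close> and \<open>C\<close> may depend on \<open>\<rho>\<close>.
  The variance \<open>v\<close> and \<open>L\<close> stand for \<open>\<nu>(\<parallel>\<sigma>\<parallel>\<^sup>2)\<close> and \<open>\<parallel>\<nabla>\<phi>\<parallel>\<^sub>\<infinity>\<close>. If \<open>v * L\<^sup>2 = 0\<close>, then division by zero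
  makes the right-hand side \<open>2 * C n\<close>: the bound says nothing for degenerate variance.
\<close>

definition deviation_bound ::
  "'s measure \<Rightarrow> (nat \<Rightarrow> real) \<Rightarrow> (nat \<Rightarrow> 's \<Rightarrow> real) \<Rightarrow> real \<Rightarrow> real \<Rightarrow> bool" where
  "deviation_bound M \<gamma> Z v L \<longleftrightarrow>
     (\<forall>\<delta>. \<delta> \<longlonglongrightarrow> 0 \<longrightarrow>
       (\<exists>\<rho>. (\<forall>n. 0 < \<rho> n) \<and> (\<forall>n. \<delta> n \<le> \<rho> n) \<and> \<rho> \<longlonglongrightarrow> 0 \<and>
          filterlim (\<lambda>n. \<rho> n * (sqrt (Gam \<gamma> n) / step_sum \<gamma> 2 n)) at_top sequentially \<and>
          (\<exists>c C. incseq c \<and> decseq C \<and>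
             (\<forall>n. 0 < c n \<and> c n \<le> 1 \<and> 1 \<le> C n) \<and> c \<longlonglongrightarrow> 1 \<and> C \<longlonglongrightarrow> 1 \<and>
             (\<forall>n\<ge>1. \<forall>a. 0 < a \<and> a \<le> \<rho> n * (sqrt (Gam \<gamma> n) / step_sum \<gamma> 2 n) \<longrightarrow>
                measure M {\<omega> \<in> space M. a \<le> \<bar>sqrt (Gam \<gamma> n) * Z n \<omega>\<bar>}
                  \<le> 2 * C n * exp (- c n * (a\<^sup>2 / (2 * v * L\<^sup>2)))))))"

end

theory Submission
  imports Defs
begin

text \<open>
  A Taylor expansion along one step of the scheme writes
  \<open>\<Sum> \<gamma>\<^sub>k \<A>\<phi>(X\<^sub>k\<^sub>-\<^sub>1)\<close> as a boundary term \<open>\<phi>(X\<^sub>n) - \<phi>(X\<^sub>0)\<close>, minus a remainder of order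
  \<open>\<Sum> (\<gamma>\<^sub>k\<^sup>2 V(X\<^sub>k\<^sub>-\<^sub>1) + \<gamma>\<^sub>k\<^sup>(\<^sup>3\<^sup>+\<^sup>\<beta>\<^sup>)\<^sup>/\<^sup>2)\<close>, minus a martingale whose increments are Lipschitz functions of the
  innovations. By concentration the bracket of that martingale is dominated by
  \<open>\<parallel>\<nabla>\<phi>\<parallel>\<^sub>\<infinity>\<^sup>2 \<Sum> \<gamma>\<^sub>k S(X\<^sub>k\<^sub>-\<^sub>1)\<close> with \<open>S = \<A>\<psi> + v\<close>, which in turn equals \<open>v \<Gamma>\<^sub>n\<close> up to a sum of the same kind for
  \<open>\<psi>\<close>, which carries an additional small factor \<open>\<lambda>\<close> in the exponent. Hoelder's inequality separates these
  contributions, the exponential moments of \<open>V(X\<^sub>n)\<close> are uniformly bounded, and Markov's inequality at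
  \<open>\<lambda> = a / (\<surd>\<Gamma>\<^sub>n v \<parallel>\<nabla>\<phi>\<parallel>\<^sub>\<infinity>\<^sup>2)\<close> gives the bound. The range of \<open>a\<close> keeps \<open>\<lambda> \<Gamma>\<^sub>n\<^sup>(\<^sup>2\<^sup>)\<close> small, and
  \<open>\<Sum> \<gamma>\<^sub>k\<^sup>(\<^sup>3\<^sup>+\<^sup>\<beta>\<^sup>)\<^sup>/\<^sup>2 = o(\<surd>\<Gamma>\<^sub>n)\<close> because \<open>\<Sum> \<gamma>\<^sub>k\<^sup>2\<^sup>+\<^sup>\<beta> < \<infinity>\<close>.
\<close>

section \<open>Directional Taylor expansions\<close>

text \<open>The obstacle: the bracket is random, while the rate must show its mean and not the crude
  bound \<open>\<kappa>\<^sup>2\<close>. Re-expanding the excess of the bracket over its mean yields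
  a second martingale, and there the crude bound is good enough: its coefficient is of order
  \<lambda>^2, so its bracket costs \<lambda>^4 times the total step, against a leading term of
  \<lambda>^2 times the total step. The exact constant survives Hoelder because the weight w of the
  first martingale is close to 1, and the price, fixed powers of 1 / (1 - w), multiplies quantities
  that vanish as n grows. The prefactor tends to 1 because a moment bounded by exp B, raised to a
  small power, is bounded by a number close to 1. Two conditions keep the rest negligible: the sum
  of \<open>\<gamma>\<^sup>2 * V\<close> is controlled only with a small coefficient, which limits
  a; and vanishing third moments improve the error of a step from order 3/2 to (3 + \<beta>) / 2 in
  its size, which the lower bound on \<theta> then absorbs. All of this is first proved for a fixed
  accuracy \<epsilon> and all large n.\<close>

lemma has_derivative_pdiff:
  fixes f :: "real^'n \<Rightarrow> real"
  assumes "f differentiable (at x)"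
  shows "(f has_derivative (\<lambda>h. \<Sum>i\<in>UNIV. h $ i * pdiff i f x)) (at x)"
proof -
  let ?D = "frechet_derivative f (at x)"
  have d: "(f has_derivative ?D) (at x)"
    using assms frechet_derivative_works by blast
  then have lin: "linear ?D"
    using has_derivative_linear by blast
  have "?D h = (\<Sum>i\<in>UNIV. h $ i * pdiff i f x)" for h
  proof -
    have "?D h = ?D (\<Sum>i\<in>UNIV. h $ i *s axis i 1)"
      by (simp add: basis_expansion)
    also have "\<dots> = (\<Sum>i\<in>UNIV. h $ i * pdiff i f x)"
      by (simp add: linear_sum[OF lin] scalar_mult_eq_scaleR linear_scale[OF lin] pdiff_def)
    finally show ?thesis .
  qed
  then have "?D = (\<lambda>h. \<Sum>i\<in>UNIV. h $ i * pdiff i f x)" by blast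
  with d show ?thesis by simp
qed

lemma DERIV_line_pdiff:
  fixes f :: "real^'n \<Rightarrow> real"
  assumes "\<And>x. f differentiable (at x)"
  shows "((\<lambda>t. f (x + t *\<^sub>R h)) has_real_derivative (\<Sum>i\<in>UNIV. h $ i * pdiff i f (x + t *\<^sub>R h))) (at t)"
proof -
  have "((\<lambda>t. f (x + t *\<^sub>R h)) has_derivative
      (\<lambda>s. \<Sum>i\<in>UNIV. (s *\<^sub>R h) $ i * pdiff i f (x + t *\<^sub>R h))) (at t)"
    by (rule has_derivative_compose[of "\<lambda>t. x + t *\<^sub>R h" "\<lambda>s. s *\<^sub>R h" _ UNIV f, OF _ has_derivative_pdiff[OF assms]])
      (auto intro!: derivative_eq_intros)
  moreover have "(\<lambda>s. \<Sum>i\<in>UNIV. (s *\<^sub>R h) $ i * pdiff i f (x + t *\<^sub>R h))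
      = (*) (\<Sum>i\<in>UNIV. h $ i * pdiff i f (x + t *\<^sub>R h))"
    unfolding fun_eq_iff by (simp add: sum_distrib_left mult_ac)
  ultimately show ?thesis
    by (simp only: has_field_derivative_def)
qed

text \<open>The m-fold derivative of \<open>pdiffs is f\<close> along h. New indices go to the
  front, where \<open>pdiffs\<close> keeps the outermost derivative, so differentiating along a line
  raises m by one and no symmetry of mixed partials is involved.\<close>

primrec dir_deriv :: "real^'n \<Rightarrow> nat \<Rightarrow> 'n list \<Rightarrow> (real^'n \<Rightarrow> real) \<Rightarrow> real^'n \<Rightarrow> real" where
  "dir_deriv h 0 is f x = pdiffs is f x"
| "dir_deriv h (Suc m) is f x = (\<Sum>i\<in>UNIV. h $ i * dir_deriv h m (i # is) f x)"

lemma DERIV_dir_deriv: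
  assumes "C_k k f" "length is + m < k"
  shows "((\<lambda>t. dir_deriv h m is f (x + t *\<^sub>R h)) has_real_derivative dir_deriv h (Suc m) is f (x + t *\<^sub>R h)) (at t)"
  using assms(2)
proof (induction m arbitrary: "is")
  case 0
  then have "\<And>x. pdiffs is f differentiable (at x)"
    using assms(1) by (auto simp: C_k_def)
  from DERIV_line_pdiff[OF this] show ?case
    by (simp add: pdiffs_def)
next
  case (Suc m)
  have "((\<lambda>t. \<Sum>i\<in>UNIV. h $ i * dir_deriv h m (i # is) f (x + t *\<^sub>R h)) has_real_derivative
      (\<Sum>i\<in>UNIV. h $ i * dir_deriv h (Suc m) (i # is) f (x + t *\<^sub>R h))) (at t)"
    by (intro DERIV_sum DERIV_cmult Suc.IH) (use Suc.prems in auto)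
  then show ?case by simp
qed

text \<open>Maclaurin on [0, 1] for the restriction of f to a line. The Lagrange point depends on h
  in an unspecified way, so remainders are later bounded pointwise before any integration.\<close>

lemma taylor_dir_deriv:
  assumes "C_k k f" "0 < k"
  obtains t where "0 < t" "t < 1"
    "f (x + h) = (\<Sum>m<k. dir_deriv h m [] f x / fact m) + dir_deriv h k [] f (x + t *\<^sub>R h) / fact k"
proof -
  have "\<exists>t::real. 0 < t \<and> t < 1 \<and> f (x + 1 *\<^sub>R h) =
      (\<Sum>m<k. dir_deriv h m [] f (x + 0 *\<^sub>R h) / fact m * 1 ^ m) + dir_deriv h k [] f (x + t *\<^sub>R h) / fact k * 1 ^ k"
    by (rule Maclaurin[where diff = "\<lambda>m t. dir_deriv h m [] f (x + t *\<^sub>R h)"])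
      (use assms DERIV_dir_deriv[OF assms(1), of "[]"] in \<open>auto simp: pdiffs_def\<close>)
  then show ?thesis using that by auto
qed

lemma abs_sum_nth_le:
  fixes h :: "real^'n" and B :: real
  assumes "\<And>i. \<bar>g i\<bar> \<le> B"
  shows "\<bar>\<Sum>i\<in>UNIV. h $ i * g i\<bar> \<le> CARD('n) * B * norm h"
proof -
  have "\<bar>\<Sum>i\<in>UNIV. h $ i * g i\<bar> \<le> (\<Sum>i\<in>UNIV. \<bar>h $ i * g i\<bar>)" by (rule sum_abs)
  also have "\<dots> \<le> (\<Sum>i\<in>(UNIV::'n set). norm h * B)"
    by (intro sum_mono) (auto simp: abs_mult intro!: mult_mono assms component_le_norm_cart)
  finally show ?thesis by (simp add: mult_ac)
qed

lemma dir_deriv_bound: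
  fixes f :: "real^'n \<Rightarrow> real"
  assumes "\<And>is. length is = l + m \<Longrightarrow> \<bar>pdiffs is f x\<bar> \<le> B" "length is = l"
  shows "\<bar>dir_deriv h m is f x\<bar> \<le> (CARD('n) * norm h) ^ m * B"
  using assms
proof (induction m arbitrary: "is" l)
  case (Suc m)
  have "\<bar>dir_deriv h m (i # is) f x\<bar> \<le> (CARD('n) * norm h) ^ m * B" for i
    by (rule Suc.IH[where l = "Suc l"]) (use Suc.prems in auto)
  from abs_sum_nth_le[of "\<lambda>i. dir_deriv h m (i # is) f x", OF this, of h] show ?case
    by (simp add: mult_ac)
qed auto

lemma dir_deriv_diff_bound:
  fixes f :: "real^'n \<Rightarrow> real"
  assumes "\<And>is. length is = l + m \<Longrightarrow> \<bar>pdiffs is f x - pdiffs is f y\<bar> \<le> B" "length is = l"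
  shows "\<bar>dir_deriv h m is f x - dir_deriv h m is f y\<bar> \<le> (CARD('n) * norm h) ^ m * B"
  using assms
proof (induction m arbitrary: "is" l)
  case (Suc m)
  have "\<bar>dir_deriv h m (i # is) f x - dir_deriv h m (i # is) f y\<bar> \<le> (CARD('n) * norm h) ^ m * B" for i
    by (rule Suc.IH[where l = "Suc l"]) (use Suc.prems in auto)
  from abs_sum_nth_le[of "\<lambda>i. dir_deriv h m (i # is) f x - dir_deriv h m (i # is) f y", OF this, of h] show ?case
    by (simp add: mult_ac sum_subtractf right_diff_distrib)
qed auto

lemma grad_eq_sum: "h \<bullet> grad f x = dir_deriv h 1 [] f x"
  by (simp add: inner_vec_def grad_def pdiffs_def)

lemma hess_eq_sum: "h \<bullet> (hess f x *v h) = dir_deriv h 2 [] f x"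
  \<comment> \<open>\<open>dir_deriv\<close> nests the two indices in the opposite order to
    \<open>hess\<close>; swapping the sums makes up for it without symmetry of the Hessian.\<close>
  by (simp add: inner_vec_def hess_def matrix_vector_mult_def sum_distrib_left numeral_2_eq_2)
    (subst sum.swap, simp add: mult_ac)

text \<open>Only finitely many index lists have a given length, so their separate bounds merge into
  one.\<close>

lemma pdiffs_bounded:
  fixes f :: "real^'n \<Rightarrow> real"
  assumes "C_k_holder k \<beta> f" "1 \<le> l" "l \<le> k"
  obtains B where "0 \<le> B" "\<And>is x. length is = l \<Longrightarrow> \<bar>pdiffs is f x\<bar> \<le> B"
proof -
  have fin: "finite {is::'n list. length is = l}"
    using finite_lists_length_eq[of "UNIV :: 'n set" l] by simp
  have "bounded (\<Union>is\<in>{is. length is = l}. range (pdiffs is f))"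
    using fin assms by (intro bounded_UN) (auto simp: C_k_holder_def)
  then obtain B where "\<forall>y\<in>(\<Union>is\<in>{is. length is = l}. range (pdiffs is f)). norm y \<le> B"
    unfolding bounded_iff by blast
  then have "\<And>is x. length is = l \<Longrightarrow> \<bar>pdiffs is f x\<bar> \<le> max 0 B"
    by (fastforce simp: le_max_iff_disj)
  with that[of "max 0 B"] show ?thesis by simp
qed

lemma pdiffs_holder:
  fixes f :: "real^'n \<Rightarrow> real"
  assumes "C_k_holder k \<beta> f"
  obtains B where "0 \<le> B"
    "\<And>is x y. length is = k \<Longrightarrow> \<bar>pdiffs is f x - pdiffs is f y\<bar> \<le> B * norm (x - y) powr \<beta>"
proof -
  have fin: "finite {is::'n list. length is = k}"
    using finite_lists_length_eq[of "UNIV :: 'n set" k] by simp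
  have "\<forall>is\<in>{is. length is = k}. \<exists>C. \<forall>x y. \<bar>pdiffs is f x - pdiffs is f y\<bar> \<le> C * norm (x - y) powr \<beta>"
    using assms by (auto simp: C_k_holder_def holder_def)
  then obtain C where C: "\<And>is x y. length is = k \<Longrightarrow> \<bar>pdiffs is f x - pdiffs is f y\<bar> \<le> C is * norm (x - y) powr \<beta>"
    unfolding bchoice_iff by blast
  let ?B = "\<Sum>is | length is = k. \<bar>C is\<bar>"
  have "\<bar>pdiffs is f x - pdiffs is f y\<bar> \<le> ?B * norm (x - y) powr \<beta>" if "length is = k" for "is" x y
  proof -
    have "C is \<le> \<bar>C is\<bar>" by simp
    also have "\<dots> \<le> ?B"
      using that fin by (intro member_le_sum[of "is" _ "\<lambda>is. \<bar>C is\<bar>"]) auto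
    finally show ?thesis
      by (meson C[OF that] mult_right_mono order_trans powr_ge_zero)
  qed
  moreover have "0 \<le> ?B" by (rule sum_nonneg) simp
  ultimately show ?thesis using that by blast
qed

text \<open>Mean value theorem along a segment, with the bound on the partials of the next
  order.\<close>

lemma pdiffs_lipschitz:
  fixes f :: "real^'n \<Rightarrow> real"
  assumes "C_k_holder k \<beta> f" "l < k"
  obtains B where "0 \<le> B"
    "\<And>is x h. length is = l \<Longrightarrow> \<bar>pdiffs is f (x + h) - pdiffs is f x\<bar> \<le> B * norm h"
proof -
  obtain B where B: "0 \<le> B" "\<And>is x. length is = Suc l \<Longrightarrow> \<bar>pdiffs is f x\<bar> \<le> B"
    using pdiffs_bounded[OF assms(1), of "Suc l"] assms(2) by auto
  have C: "C_k k f" using assms(1) by (simp add: C_k_holder_def)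
  have "\<bar>pdiffs is f (x + h) - pdiffs is f x\<bar> \<le> (CARD('n) * B) * norm h" if "length is = l" for "is" x h
  proof -
    have "\<exists>z>0. z < 1 \<and> dir_deriv h 0 is f (x + 1 *\<^sub>R h) - dir_deriv h 0 is f (x + 0 *\<^sub>R h)
        = (1 - 0) * dir_deriv h (Suc 0) is f (x + z *\<^sub>R h)"
      by (rule MVT2[of 0 "1::real" "\<lambda>t. dir_deriv h 0 is f (x + t *\<^sub>R h)"])
        (use DERIV_dir_deriv[OF C, of "is" 0] that assms(2) in auto)
    then obtain z where "pdiffs is f (x + h) - pdiffs is f x = dir_deriv h 1 is f (x + z *\<^sub>R h)"
      by auto
    with dir_deriv_bound[of l 1 f "x + z *\<^sub>R h" B "is" h] B that show ?thesis by (simp add: mult_ac)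
  qed
  with that[of "CARD('n) * B"] B show ?thesis by simp
qed

lemma grad_bounded:
  fixes f :: "real^'n \<Rightarrow> real"
  assumes "C_k_holder k \<beta> f" "1 \<le> k"
  shows "bdd_above (range (\<lambda>x. norm (grad f x)))"
proof -
  obtain B where B: "0 \<le> B" "\<And>is x. length is = 1 \<Longrightarrow> \<bar>pdiffs is f x\<bar> \<le> B"
    using pdiffs_bounded[OF assms(1), of 1] assms(2) by auto
  have "norm (grad f x) \<le> (\<Sum>i\<in>(UNIV::'n set). B)" for x
    by (rule order_trans[OF norm_le_l1_cart])
      (intro sum_mono, simp add: grad_def, use B(2)[of "[_]"] in \<open>simp add: pdiffs_def\<close>)
  then show ?thesis by (auto simp: bdd_above_def)
qed

lemma grad_sup_nonneg:
  assumes "C_k_holder k \<beta> f" "1 \<le> k"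
  shows "0 \<le> grad_sup f"
  using cSUP_upper[OF UNIV_I grad_bounded[OF assms], of 0] norm_ge_zero[of "grad f 0"]
  unfolding grad_sup_def by linarith

text \<open>The constant has to be exactly the supremum of the gradient, since it ends up in the
  rate; hence Cauchy-Schwarz with the whole gradient instead of a bound per coordinate.\<close>

lemma grad_sup_lipschitz:
  assumes "C_k_holder k \<beta> f" "1 \<le> k"
  shows "\<bar>f x - f y\<bar> \<le> grad_sup f * norm (x - y)"
proof -
  have C: "C_k k f" using assms(1) by (simp add: C_k_holder_def)
  let ?h = "x - y"
  have "\<exists>z>0. z < 1 \<and> dir_deriv ?h 0 [] f (y + 1 *\<^sub>R ?h) - dir_deriv ?h 0 [] f (y + 0 *\<^sub>R ?h)
        = (1 - 0) * dir_deriv ?h (Suc 0) [] f (y + z *\<^sub>R ?h)"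
    by (rule MVT2[of 0 "1::real" "\<lambda>t. dir_deriv ?h 0 [] f (y + t *\<^sub>R ?h)"])
      (use DERIV_dir_deriv[OF C, of "[]" 0 ?h] assms(2) in \<open>auto simp del: dir_deriv.simps\<close>)
  then obtain z where "f x - f y = ?h \<bullet> grad f (y + z *\<^sub>R ?h)"
    unfolding grad_eq_sum by (auto simp: pdiffs_def)
  then have "\<bar>f x - f y\<bar> \<le> norm ?h * norm (grad f (y + z *\<^sub>R ?h))"
    using Cauchy_Schwarz_ineq2 by metis
  also have "\<dots> \<le> norm ?h * grad_sup f"
    unfolding grad_sup_def by (intro mult_left_mono cSUP_upper grad_bounded[OF assms]) auto
  finally show ?thesis by (simp add: mult_ac)
qed

lemma continuous_on_pdiffs:
  "C_k k f \<Longrightarrow> length is \<le> k \<Longrightarrow> continuous_on UNIV (pdiffs is f)"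
  by (simp add: C_k_def)

lemma C_k_continuous: "C_k k f \<Longrightarrow> continuous_on UNIV f"
  using continuous_on_pdiffs[of k f "[]"] by (simp add: pdiffs_def)

text \<open>The index order \<open>[j, i]\<close> that the trace of the product produces is also the
  one of \<open>dir_deriv\<close>, so the two second-order terms match literally.\<close>

lemma generator_eq_sum:
  "generator b \<sigma> f x = (\<Sum>i\<in>UNIV. b x $ i * pdiffs [i] f x)
     + 1/2 * (\<Sum>i\<in>UNIV. \<Sum>j\<in>UNIV. (\<sigma> x ** transpose (\<sigma> x)) $ i $ j * pdiffs [j, i] f x)"
  by (simp add: generator_def inner_vec_def grad_def hess_def trace_def matrix_matrix_mult_def pdiffs_def)

lemma continuous_on_generator:
  assumes "C_k k f" "2 \<le> k" "continuous_on UNIV b" "continuous_on UNIV \<sigma>"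
  shows "continuous_on UNIV (generator b \<sigma> f)"
  unfolding generator_eq_sum[abs_def] matrix_matrix_mult_def transpose_def vec_lambda_beta
  by (intro continuous_intros assms continuous_on_pdiffs[OF assms(1)]) (use assms(2) in auto)

section \<open>Concentrated innovations\<close>

lemma norm_matrix_vector_le:
  fixes A :: "real^'m^'n"
  shows "norm (A *v u) \<le> op_norm A * norm u"
  by (rule onorm) (rule matrix_vector_mul_bounded_linear)

lemma op_norm_nonneg: "0 \<le> op_norm (A :: real^'m^'n)"
  by (rule onorm_pos_le) (rule matrix_vector_mul_bounded_linear)

lemma abs_mult_transpose_nth_le:
  fixes A :: "real^'r^'d"
  assumes "op_norm A \<le> \<kappa>"
  shows "\<bar>(A ** transpose A) $ i $ j\<bar> \<le> real CARD('r) * \<kappa>\<^sup>2"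
proof -
  have \<kappa>0: "0 \<le> \<kappa>" using assms op_norm_nonneg[of A] by linarith
  have "\<bar>(A ** transpose A) $ i $ j\<bar> \<le> (\<Sum>k\<in>(UNIV::'r set). \<bar>A $ i $ k * A $ j $ k\<bar>)"
    by (simp add: matrix_matrix_mult_def transpose_def sum_abs)
  also have "\<dots> \<le> (\<Sum>k\<in>(UNIV::'r set). \<kappa> * \<kappa>)"
    unfolding abs_mult
    by (intro sum_mono mult_mono order_trans[OF matrix_component_le_onorm assms]) (use \<kappa>0 in auto)
  finally show ?thesis by (simp add: power2_eq_square)
qed

lemma continuous_on_matrix_vector_mult:
  fixes f :: "'a::topological_space \<Rightarrow> real^'m^'n"
  assumes "continuous_on S f" "continuous_on S g"
  shows "continuous_on S (\<lambda>x. f x *v g x)"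
  unfolding matrix_vector_mult_def
  by (intro continuous_intros assms)

lemma lipschitz_onI_real:
  fixes h :: "'a::real_normed_vector \<Rightarrow> real"
  assumes "\<And>u v. \<bar>h u - h v\<bar> \<le> K * norm (u - v)" "0 \<le> K"
  shows "K-lipschitz_on UNIV h"
  by (rule lipschitz_onI) (use assms in \<open>auto simp: dist_norm\<close>)

text \<open>The law of a single innovation with the properties from (GC), detached from the
  underlying probability space. It need not be Gaussian: only its exponential moments are of
  Gaussian size.\<close>

locale gaussian_concentration = prob_space \<mu> for \<mu> :: "(real^'r) measure" +
  assumes sets_mu: "sets \<mu> = sets borel"
    and mean: "(\<integral>u. u $ i \<partial>\<mu>) = 0"
    and covariance: "(\<integral>u. u $ i * u $ j \<partial>\<mu>) = (if i = j then 1 else 0)"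
    and third_moment: "(\<integral>u. u $ i * u $ j * u $ k \<partial>\<mu>) = 0"
    and concentration: "\<And>(g :: real^'r \<Rightarrow> real) (l :: real). 1-lipschitz_on UNIV g \<Longrightarrow> 0 < l \<Longrightarrow>
      integrable \<mu> (\<lambda>u. exp (l * g u)) \<and> (\<integral>u. exp (l * g u) \<partial>\<mu>) \<le> exp (l * (\<integral>u. g u \<partial>\<mu>) + l\<^sup>2 / 2)"
begin

section \<open>Exponential moments of Lipschitz functions and of the squared norm\<close>

lemma measurable_mu: "f \<in> borel_measurable borel \<Longrightarrow> f \<in> borel_measurable \<mu>"
  using measurable_cong_sets[OF sets_mu refl] by blast

lemma lipschitz_measurable:
  fixes h :: "real^'r \<Rightarrow> real"
  assumes "K-lipschitz_on UNIV h"
  shows "h \<in> borel_measurable \<mu>"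
  by (intro measurable_mu borel_measurable_continuous_onI lipschitz_on_continuous_on[OF assms])

lemma lipschitz_divide:
  fixes h :: "real^'r \<Rightarrow> real"
  assumes "K-lipschitz_on UNIV h" "0 < K'" "K \<le> K'"
  shows "1-lipschitz_on UNIV (\<lambda>u. h u / K')"
proof (rule lipschitz_onI_real)
  fix u v
  have "\<bar>h u - h v\<bar> \<le> K * norm (u - v)"
    using lipschitz_onD[OF assms(1), of u v] by (simp add: dist_norm)
  also have "\<dots> \<le> K' * norm (u - v)"
    using assms(3) by (rule mult_right_mono) simp
  finally show "\<bar>h u / K' - h v / K'\<bar> \<le> 1 * norm (u - v)"
    using assms(2) by (simp add: diff_divide_distrib[symmetric] pos_divide_le_eq mult.commute)
qed simp

text \<open>Exponential moments of g and - g control the absolute value through |y| <= exp y + exp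
  (- y). Dividing by K + 1 instead of K keeps the divisor positive for constant h.\<close>

lemma lipschitz_integrable:
  fixes h :: "real^'r \<Rightarrow> real"
  assumes "K-lipschitz_on UNIV h"
  shows "integrable \<mu> h"
proof -
  have K: "0 \<le> K" using lipschitz_on_nonneg[OF assms] .
  let ?g = "\<lambda>u. h u / (K + 1)"
  have g: "1-lipschitz_on UNIV ?g"
    using lipschitz_divide[OF assms, of "K + 1"] K by simp
  have g': "1-lipschitz_on UNIV (\<lambda>u. - ?g u)"
    using lipschitz_on_minus[OF g] by simp
  have int: "integrable \<mu> (\<lambda>u. exp (?g u) + exp (- ?g u))"
    using concentration[OF g, of 1] concentration[OF g', of 1] by simp
  have "integrable \<mu> ?g"
  proof (rule Bochner_Integration.integrable_bound[OF int])
    show "?g \<in> borel_measurable \<mu>" using lipschitz_measurable[OF g] .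
    have "\<bar>y\<bar> \<le> exp y + exp (- y)" for y :: real
      using exp_ge_add_one_self[of "y"] exp_ge_add_one_self[of "- y"] exp_gt_zero[of y] exp_gt_zero[of "- y"]
      by linarith
    then show "AE u in \<mu>. norm (?g u) \<le> norm (exp (?g u) + exp (- ?g u))"
      by (simp only: real_norm_def abs_of_pos add_pos_pos exp_gt_zero) simp
  qed
  then have "integrable \<mu> (\<lambda>u. (K + 1) * ?g u)" by (rule integrable_mult_right)
  then show ?thesis using K by simp
qed

text \<open>Concentration for h / K at the parameter K. A constant h (K = 0) is treated apart, as
  that parameter must be positive. Nonnegative integrals spare all later integrability
  conditions.\<close>

lemma nn_integral_exp_lipschitz:
  fixes h :: "real^'r \<Rightarrow> real"
  assumes "K-lipschitz_on UNIV h"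
  shows "(\<integral>\<^sup>+u. ennreal (exp (h u - (\<integral>w. h w \<partial>\<mu>))) \<partial>\<mu>) \<le> ennreal (exp (K\<^sup>2 / 2))"
proof (cases "K = 0")
  case True
  then have "h u = h 0" for u
    using lipschitz_onD[OF assms, of u 0] by simp
  then have h: "h = (\<lambda>_. h 0)" by blast
  have "(\<integral>w. h w \<partial>\<mu>) = h 0"
    by (subst h) (simp add: prob_space)
  then show ?thesis using True by (subst h) (simp add: emeasure_space_1)
next
  case False
  then have K: "0 < K" using lipschitz_on_nonneg[OF assms] by simp
  let ?g = "\<lambda>u. h u / K"
  have c: "integrable \<mu> (\<lambda>u. exp (h u))" "(\<integral>u. exp (h u) \<partial>\<mu>) \<le> exp ((\<integral>u. h u \<partial>\<mu>) + K\<^sup>2 / 2)"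
    using concentration[OF lipschitz_divide[OF assms K order_refl] K] K by auto
  have "(\<integral>\<^sup>+u. ennreal (exp (h u - (\<integral>w. h w \<partial>\<mu>))) \<partial>\<mu>)
      = ennreal (\<integral>u. exp (h u) / exp (\<integral>w. h w \<partial>\<mu>) \<partial>\<mu>)"
    unfolding exp_diff by (intro nn_integral_eq_integral) (use c in auto)
  also have "\<dots> \<le> ennreal (exp (K\<^sup>2 / 2))"
    using c(2) by (intro ennreal_leI) (simp add: exp_add pos_divide_le_eq mult.commute)
  finally show ?thesis .
qed

text \<open>Concentration speaks of Lipschitz functions only, so the parabola is replaced by its
  tangents. The tangent of slope k / 2 has intercept of order - k^2 / 4 and costs k^2 / 8 by
  concentration; the surplus - k^2 / 8 makes the series converge.\<close>

lemma nn_integral_exp_square_finite: "(\<integral>\<^sup>+u. ennreal (exp ((norm u)\<^sup>2 / 4)) \<partial>\<mu>) < \<infinity>"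
proof -
  let ?m = "\<integral>u. norm u \<partial>\<mu>"
  let ?e = "\<lambda>k::nat. exp (1/4 + k * ?m / 2 - (real k)\<^sup>2 / 8)"
  have lip: "(k/2)-lipschitz_on UNIV (\<lambda>u::real^'r. k / 2 * norm u)" if "0 \<le> k" for k :: real
  proof (rule lipschitz_onI_real)
    fix u v :: "real^'r"
    have "\<bar>k / 2 * norm u - k / 2 * norm v\<bar> = k / 2 * \<bar>norm u - norm v\<bar>"
      unfolding right_diff_distrib[symmetric] abs_mult using that by simp
    also have "\<dots> \<le> k / 2 * norm (u - v)"
      using that norm_triangle_ineq3 by (intro mult_left_mono) auto
    finally show "\<bar>k / 2 * norm u - k / 2 * norm v\<bar> \<le> k / 2 * norm (u - v)" .
  qed (use that in simp)
  have meas: "(\<lambda>u::real^'r. ennreal (exp (1/4 + k / 2 * norm u - k\<^sup>2 / 4))) \<in> borel_measurable \<mu>" for k :: real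
    by (intro measurable_mu) simp
  \<comment> \<open>\<open>1/4 + k r / 2 - k\<^sup>2 / 4 = r\<^sup>2 / 4 + (1 - (r - k)\<^sup>2) / 4\<close>: the tangents at integers approximate the parabola.\<close>
  have tangent: "ennreal (exp (r\<^sup>2 / 4)) \<le> (\<Sum>k::nat. ennreal (exp (1/4 + k / 2 * r - (real k)\<^sup>2 / 4)))" if "0 \<le> r" for r :: real
  proof -
    let ?k = "nat \<lfloor>r\<rfloor>"
    have "real ?k \<le> r" "r \<le> real ?k + 1" using that by linarith+
    then have "0 \<le> r - ?k" "r - ?k \<le> 1" by linarith+
    then have "(r - ?k)\<^sup>2 \<le> 1" by (rule power_le_one)
    then have "r\<^sup>2 / 4 \<le> 1/4 + ?k / 2 * r - (real ?k)\<^sup>2 / 4"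
      by (simp add: power2_diff field_simps)
    then have "ennreal (exp (r\<^sup>2 / 4)) \<le> ennreal (exp (1/4 + ?k / 2 * r - (real ?k)\<^sup>2 / 4))"
      by (intro ennreal_leI) simp
    also have "\<dots> = (\<Sum>k\<in>{?k}. ennreal (exp (1/4 + k / 2 * r - (real k)\<^sup>2 / 4)))" by simp
    also have "\<dots> \<le> (\<Sum>k::nat. ennreal (exp (1/4 + k / 2 * r - (real k)\<^sup>2 / 4)))"
      by (intro sum_le_suminf) auto
    finally show ?thesis .
  qed
  have each: "(\<integral>\<^sup>+u. ennreal (exp (1/4 + k / 2 * norm u - (real k)\<^sup>2 / 4)) \<partial>\<mu>) \<le> ennreal (?e k)" for k :: nat
  proof -
    have "(\<integral>\<^sup>+u. ennreal (exp (1/4 + k / 2 * norm u - (real k)\<^sup>2 / 4)) \<partial>\<mu>)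
        = (\<integral>\<^sup>+u. ennreal (exp (1/4 + k * ?m / 2 - (real k)\<^sup>2 / 4)) * ennreal (exp (k / 2 * norm u - (\<integral>w. k / 2 * norm w \<partial>\<mu>))) \<partial>\<mu>)"
      by (intro nn_integral_cong) (simp add: ennreal_mult[symmetric] exp_add[symmetric])
    also have "\<dots> = ennreal (exp (1/4 + k * ?m / 2 - (real k)\<^sup>2 / 4)) * (\<integral>\<^sup>+u. ennreal (exp (k / 2 * norm u - (\<integral>w. k / 2 * norm w \<partial>\<mu>))) \<partial>\<mu>)"
      by (intro nn_integral_cmult measurable_mu) simp
    also have "\<dots> \<le> ennreal (exp (1/4 + k * ?m / 2 - (real k)\<^sup>2 / 4)) * ennreal (exp ((k / 2)\<^sup>2 / 2))"
      by (intro mult_left_mono nn_integral_exp_lipschitz lip) auto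
    also have "\<dots> = ennreal (?e k)"
      by (simp add: ennreal_mult[symmetric] exp_add[symmetric] power_divide)
    finally show ?thesis .
  qed
  have sm: "summable ?e"
  proof (rule summable_comparison_test_ev)
    \<comment> \<open>Past \<open>k0\<close> the quadratic term beats the linear one by at least k,
      which leaves a geometric series.\<close>
    obtain k0 :: nat where k0: "4 * ?m + 8 \<le> k0" using real_arch_simple by blast
    have "norm (?e k) \<le> exp (1/4) * exp (- 1) ^ k" if "k0 \<le> k" for k
    proof -
      have "real k0 \<le> real k" using that by simp
      then have "real k * (4 * ?m + 8) \<le> real k * real k" using k0 by (intro mult_left_mono) auto
      then have "1/4 + k * ?m / 2 - (real k)\<^sup>2 / 8 \<le> 1/4 + real k * (- 1)"
        by (simp add: power2_eq_square algebra_simps)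
      then have "?e k \<le> exp (1/4 + real k * (- 1))" by simp
      also have "\<dots> = exp (1/4) * exp (- 1) ^ k" by (simp only: exp_add exp_of_nat_mult)
      finally show ?thesis by simp
    qed
    then show "eventually (\<lambda>k. norm (?e k) \<le> exp (1/4) * exp (- 1) ^ k) sequentially"
      unfolding eventually_sequentially by blast
    show "summable (\<lambda>k. exp (1/4::real) * exp (- 1) ^ k)"
      by (intro summable_mult summable_geometric) simp
  qed
  have "(\<integral>\<^sup>+u. ennreal (exp ((norm u)\<^sup>2 / 4)) \<partial>\<mu>)
      \<le> (\<integral>\<^sup>+u. (\<Sum>k::nat. ennreal (exp (1/4 + k / 2 * norm u - (real k)\<^sup>2 / 4))) \<partial>\<mu>)"
    by (intro nn_integral_mono tangent) simp
  also have "\<dots> = (\<Sum>k::nat. \<integral>\<^sup>+u. ennreal (exp (1/4 + k / 2 * norm u - (real k)\<^sup>2 / 4)) \<partial>\<mu>)"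
    by (intro nn_integral_suminf meas)
  also have "\<dots> \<le> (\<Sum>k. ennreal (?e k))"
    by (intro suminf_le each) auto
  also have "\<dots> = ennreal (suminf ?e)"
    by (intro suminf_ennreal2 sm) simp
  finally show ?thesis by (auto simp: top.not_eq_extremum intro: le_less_trans)
qed

text \<open>With y the quarter of the squared norm, exp y >= y^2 / 2 gives the factor 32. The fourth
  moment is enough for the Taylor remainder, which grows with exponent 3 + \<beta> <= 4.\<close>

lemma integrable_norm_power4: "integrable \<mu> (\<lambda>u. norm u ^ 4)"
proof (rule Bochner_Integration.integrable_bound)
  show "integrable \<mu> (\<lambda>u. 32 * exp ((norm u)\<^sup>2 / 4))"
    by (intro integrable_mult_right integrableI_nonneg measurable_mu nn_integral_exp_square_finite) auto
  show "(\<lambda>u. norm u ^ 4) \<in> borel_measurable \<mu>"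
    by (intro measurable_mu) simp
  have "norm u ^ 4 \<le> 32 * exp ((norm u)\<^sup>2 / 4)" for u :: "real^'r"
  proof -
    have "1 + (norm u)\<^sup>2 / 4 + ((norm u)\<^sup>2 / 4)\<^sup>2 / 2 \<le> exp ((norm u)\<^sup>2 / 4)"
      by (rule exp_lower_Taylor_quadratic) simp
    moreover have "((norm u)\<^sup>2 / 4)\<^sup>2 = norm u ^ 4 / 16"
      by (simp add: power_divide power_mult[symmetric])
    ultimately show ?thesis
      using zero_le_power2[of "norm u"] by linarith
  qed
  then show "AE u in \<mu>. norm (norm u ^ 4) \<le> norm (32 * exp ((norm u)\<^sup>2 / 4))" by simp
qed

section \<open>Polynomial moments and the one-step Taylor expansion\<close>

lemma integrable_if_norm_power4_bound:
  assumes "f \<in> borel_measurable borel" "\<And>u. \<bar>f u\<bar> \<le> B * (1 + norm u ^ 4)"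
  shows "integrable \<mu> f"
proof (rule Bochner_Integration.integrable_bound)
  show "integrable \<mu> (\<lambda>u. B * (1 + norm u ^ 4))"
    by (intro integrable_mult_right Bochner_Integration.integrable_add integrable_norm_power4) simp
  show "f \<in> borel_measurable \<mu>" using assms(1) by (rule measurable_mu)
  show "AE u in \<mu>. norm (f u) \<le> norm (B * (1 + norm u ^ 4))"
    using assms(2) by (simp add: order_trans[OF _ abs_ge_self])
qed

lemma power_le_1_plus_power4:
  assumes "0 \<le> (r::real)" "n \<le> 4"
  shows "r ^ n \<le> 1 + r ^ 4"
proof (cases "r \<le> 1")
  case True
  then have "r ^ n \<le> 1" using assms by (simp add: power_le_one)
  then show ?thesis using assms by (simp add: add_increasing2)
next
  case False
  then have "r ^ n \<le> r ^ 4" using assms by (intro power_increasing) auto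
  then show ?thesis by simp
qed

lemma integrable_nth: "integrable \<mu> (\<lambda>u. u $ i)"
  using component_le_norm_cart power_le_1_plus_power4[of "norm _" 1]
  by (intro integrable_if_norm_power4_bound[of _ 1]) (auto intro: order_trans)

lemma integrable_nth2: "integrable \<mu> (\<lambda>u. u $ i * u $ j)"
proof (rule integrable_if_norm_power4_bound[of _ 1])
  fix u :: "real^'r"
  have "\<bar>u $ i * u $ j\<bar> \<le> norm u ^ 2"
    unfolding abs_mult power2_eq_square by (intro mult_mono component_le_norm_cart) auto
  then show "\<bar>u $ i * u $ j\<bar> \<le> 1 * (1 + norm u ^ 4)"
    using power_le_1_plus_power4[of "norm u" 2] by simp
qed simp

lemma integrable_nth3: "integrable \<mu> (\<lambda>u. u $ i * u $ j * u $ k)"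
proof (rule integrable_if_norm_power4_bound[of _ 1])
  fix u :: "real^'r"
  have "\<bar>u $ i * u $ j * u $ k\<bar> \<le> norm u ^ 3"
    unfolding abs_mult power3_eq_cube by (intro mult_mono component_le_norm_cart) auto
  then show "\<bar>u $ i * u $ j * u $ k\<bar> \<le> 1 * (1 + norm u ^ 4)"
    using power_le_1_plus_power4[of "norm u" 3] by simp
qed simp

lemma integral_linear1: "has_bochner_integral \<mu> (\<lambda>u. (A *v u) $ i) 0"
  unfolding has_bochner_integral_iff matrix_vector_mult_def
  by (simp add: integrable_nth Bochner_Integration.integral_sum mean)

lemma integral_linear2:
  "has_bochner_integral \<mu> (\<lambda>u. (A *v u) $ i * (A *v u) $ j) ((A ** transpose A) $ i $ j)"
proof -
  have eq: "(A *v u) $ i * (A *v u) $ j = (\<Sum>k\<in>UNIV. \<Sum>l\<in>UNIV. (A $ i $ k * A $ j $ l) * (u $ k * u $ l))" for u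
    unfolding matrix_vector_mult_def vec_lambda_beta sum_product
    by (intro sum.cong refl) (simp only: mult_ac)
  show ?thesis
    unfolding has_bochner_integral_iff eq
    by (simp add: integrable_nth2 Bochner_Integration.integral_sum covariance matrix_matrix_mult_def transpose_def
        if_distrib cong: if_cong)
qed

lemma integral_linear3:
  "has_bochner_integral \<mu> (\<lambda>u. (A *v u) $ i * (A *v u) $ j * (A *v u) $ k) 0"
proof -
  have eq: "(A *v u) $ i * (A *v u) $ j * (A *v u) $ k
      = (\<Sum>l\<in>UNIV. \<Sum>m\<in>UNIV. \<Sum>n\<in>UNIV. (A $ i $ l * A $ j $ m * A $ k $ n) * (u $ l * u $ m * u $ n))" for u
  proof -
    have "(A *v u) $ i * (A *v u) $ j * (A *v u) $ k
      = (\<Sum>l\<in>UNIV. \<Sum>m\<in>UNIV. \<Sum>n\<in>UNIV. (A $ i $ l * u $ l) * (A $ j $ m * u $ m) * (A $ k $ n * u $ n))"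
      unfolding matrix_vector_mult_def vec_lambda_beta
      by (subst sum_product, subst sum_distrib_right, rule sum.cong[OF refl],
          subst sum_distrib_right, rule sum.cong[OF refl], rule sum_distrib_left)
    then show ?thesis by (simp only: mult_ac)
  qed
  show ?thesis
    unfolding has_bochner_integral_iff eq
    by (simp add: integrable_nth3 Bochner_Integration.integral_sum third_moment)
qed

lemma integral_dir_deriv1: "has_bochner_integral \<mu> (\<lambda>u. dir_deriv (A *v u) 1 [] f y) 0"
proof -
  have "has_bochner_integral \<mu> (\<lambda>u. \<Sum>i\<in>UNIV. (A *v u) $ i * pdiffs [i] f y) (\<Sum>i\<in>UNIV. 0 * pdiffs [i] f y)"
    by (intro has_bochner_integral_sum has_bochner_integral_mult_left integral_linear1)
  then show ?thesis by simp
qed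

lemma integral_dir_deriv2:
  "has_bochner_integral \<mu> (\<lambda>u. dir_deriv (A *v u) 2 [] f y)
     (\<Sum>i\<in>UNIV. \<Sum>j\<in>UNIV. (A ** transpose A) $ i $ j * pdiffs [j, i] f y)"
proof -
  have "has_bochner_integral \<mu> (\<lambda>u. \<Sum>i\<in>UNIV. \<Sum>j\<in>UNIV. ((A *v u) $ i * (A *v u) $ j) * pdiffs [j, i] f y)
     (\<Sum>i\<in>UNIV. \<Sum>j\<in>UNIV. (A ** transpose A) $ i $ j * pdiffs [j, i] f y)"
    by (intro has_bochner_integral_sum has_bochner_integral_mult_left integral_linear2)
  then show ?thesis by (simp add: numeral_2_eq_2 sum_distrib_left mult.assoc)
qed

text \<open>The place where the vanishing third moments act: the cubic Taylor term, of order 3/2 in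
  the step size, disappears on average.\<close>

lemma integral_dir_deriv3: "has_bochner_integral \<mu> (\<lambda>u. dir_deriv (A *v u) 3 [] f y) 0"
proof -
  have "has_bochner_integral \<mu>
     (\<lambda>u. \<Sum>i\<in>UNIV. \<Sum>j\<in>UNIV. \<Sum>k\<in>UNIV. ((A *v u) $ i * (A *v u) $ j * (A *v u) $ k) * pdiffs [k, j, i] f y)
     (\<Sum>i\<in>UNIV. \<Sum>j\<in>UNIV. \<Sum>k\<in>UNIV. 0 * pdiffs [k, j, i] f y)"
    by (intro has_bochner_integral_sum has_bochner_integral_mult_left integral_linear3)
  then show ?thesis by (simp add: numeral_3_eq_3 sum_distrib_left mult.assoc)
qed

text \<open>Taylor to third order around y: the linear and the cubic term integrate to zero, the
  quadratic one gives the trace by the covariance, and Hoelder continuity of the third partials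
  leaves a remainder with exponent 3 + \<beta>.\<close>

lemma second_order_expansion:
  fixes f :: "real^'d \<Rightarrow> real"
  assumes f: "C_k_holder 3 \<beta> f" and \<beta>: "0 < \<beta>" "\<beta> \<le> 1"
  obtains C where "0 \<le> C"
    "\<And>y (A :: real^'r^'d). \<bar>(\<integral>u. f (y + A *v u) \<partial>\<mu>) - f y
       - 1/2 * (\<Sum>i\<in>UNIV. \<Sum>j\<in>UNIV. (A ** transpose A) $ i $ j * pdiffs [j, i] f y)\<bar>
     \<le> C * op_norm A powr (3 + \<beta>)"
proof -
  have C3: "C_k 3 f" using f by (simp add: C_k_holder_def)
  obtain B where B: "0 \<le> B" "\<And>is x y. length is = 3 \<Longrightarrow> \<bar>pdiffs is f x - pdiffs is f y\<bar> \<le> B * norm (x - y) powr \<beta>"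
    using pdiffs_holder[OF f] by metis
  let ?d = "real CARD('d)"
  let ?m = "\<integral>u. 1 + norm u ^ 4 \<partial>\<mu>"
  have bound: "\<bar>f (y + h) - (f y + dir_deriv h 1 [] f y + dir_deriv h 2 [] f y / 2 + dir_deriv h 3 [] f y / 6)\<bar>
      \<le> ?d ^ 3 * B * norm h powr (3 + \<beta>)" for y h
  proof -
    obtain t where t: "0 < t" "t < 1"
      "f (y + h) = (\<Sum>m<3. dir_deriv h m [] f y / fact m) + dir_deriv h 3 [] f (y + t *\<^sub>R h) / fact 3"
      using taylor_dir_deriv[OF C3, of y h] by auto
    have f3: "fact 3 = (6::real)" by (simp add: fact_numeral)
    \<comment> \<open>The Lagrange form evaluates the cubic term at an intermediate point. Moving it
      back to y gains the extra power \<beta> of the increment.\<close>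
    have "\<bar>pdiffs is f (y + t *\<^sub>R h) - pdiffs is f y\<bar> \<le> B * norm h powr \<beta>" if "length is = 3" for "is"
    proof -
      have "norm (t *\<^sub>R h) powr \<beta> \<le> norm h powr \<beta>"
        using t \<beta> by (intro powr_mono2) (auto simp: mult_left_le_one_le)
      then show ?thesis
        using B(2)[OF that, of "y + t *\<^sub>R h" y] mult_left_mono[OF _ B(1), of "norm (t *\<^sub>R h) powr \<beta>" "norm h powr \<beta>"]
        by simp
    qed
    then have "\<bar>dir_deriv h 3 [] f (y + t *\<^sub>R h) - dir_deriv h 3 [] f y\<bar> \<le> (?d * norm h) ^ 3 * (B * norm h powr \<beta>)"
      by (intro dir_deriv_diff_bound[where l = 0]) auto
    also have "(?d * norm h) ^ 3 * (B * norm h powr \<beta>) = ?d ^ 3 * B * norm h powr (3 + \<beta>)"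
      by (simp add: power_mult_distrib powr_add mult_ac)
    finally have D: "\<bar>dir_deriv h 3 [] f (y + t *\<^sub>R h) - dir_deriv h 3 [] f y\<bar> \<le> ?d ^ 3 * B * norm h powr (3 + \<beta>)" .
    have "f (y + h) - (f y + dir_deriv h 1 [] f y + dir_deriv h 2 [] f y / 2 + dir_deriv h 3 [] f y / 6)
        = (dir_deriv h 3 [] f (y + t *\<^sub>R h) - dir_deriv h 3 [] f y) / 6"
      unfolding t(3) f3 by (simp del: dir_deriv.simps add: eval_nat_numeral diff_divide_distrib)
        (simp add: pdiffs_def)
    then show ?thesis using D by (simp only: abs_divide) simp
  qed
  have lip: "integrable \<mu> (\<lambda>u. f (y + A *v u))" for y and A :: "real^'r^'d"
  proof (rule lipschitz_integrable[OF lipschitz_onI_real])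
    fix u v
    have "\<bar>f (y + A *v u) - f (y + A *v v)\<bar> \<le> grad_sup f * norm (A *v (u - v))"
      using grad_sup_lipschitz[OF f, of "y + A *v u" "y + A *v v"] by (simp add: matrix_vector_mult_diff_distrib)
    also have "\<dots> \<le> grad_sup f * (op_norm A * norm (u - v))"
      by (intro mult_left_mono norm_matrix_vector_le grad_sup_nonneg[OF f]) simp
    finally show "\<bar>f (y + A *v u) - f (y + A *v v)\<bar> \<le> (grad_sup f * op_norm A) * norm (u - v)"
      by (simp add: mult.assoc)
  qed (use grad_sup_nonneg[OF f] op_norm_nonneg[of A] in simp)
  have "\<bar>(\<integral>u. f (y + A *v u) \<partial>\<mu>) - f y
       - 1/2 * (\<Sum>i\<in>UNIV. \<Sum>j\<in>UNIV. (A ** transpose A) $ i $ j * pdiffs [j, i] f y)\<bar>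
     \<le> ?d ^ 3 * B * ?m * op_norm A powr (3 + \<beta>)" for y and A :: "real^'r^'d"
  proof -
    let ?R = "\<lambda>u. f (y + A *v u) - (f y + dir_deriv (A *v u) 1 [] f y + dir_deriv (A *v u) 2 [] f y / 2 + dir_deriv (A *v u) 3 [] f y / 6)"
    note ints = integral_dir_deriv1[of A f y] integral_dir_deriv2[of A f y] integral_dir_deriv3[of A f y]
    have R: "integrable \<mu> ?R"
      "(\<integral>u. ?R u \<partial>\<mu>) = (\<integral>u. f (y + A *v u) \<partial>\<mu>) - f y
       - 1/2 * (\<Sum>i\<in>UNIV. \<Sum>j\<in>UNIV. (A ** transpose A) $ i $ j * pdiffs [j, i] f y)"
      using ints unfolding has_bochner_integral_iff
      by (auto simp: lip prob_space simp del: dir_deriv.simps)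
    have "\<bar>?R u\<bar> \<le> ?d ^ 3 * B * op_norm A powr (3 + \<beta>) * (1 + norm u ^ 4)" for u
    proof -
      have "norm u powr (3 + \<beta>) \<le> 1 + norm u ^ 4"
      proof (cases "norm u \<le> 1")
        case True
        then have "norm u powr (3 + \<beta>) \<le> 1" using \<beta> by (intro powr_le1) auto
        then show ?thesis by (simp add: add_increasing2)
      next
        case False
        then have "norm u powr (3 + \<beta>) \<le> norm u powr (real 4)" using \<beta> by (intro powr_mono) auto
        also have "\<dots> = norm u ^ 4" using False by (intro powr_realpow) auto
        finally show ?thesis by simp
      qed
      moreover have "norm (A *v u) powr (3 + \<beta>) \<le> op_norm A powr (3 + \<beta>) * norm u powr (3 + \<beta>)"
        unfolding powr_mult[symmetric]
        using \<beta> by (intro powr_mono2 norm_matrix_vector_le) auto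
      ultimately have "norm (A *v u) powr (3 + \<beta>) \<le> op_norm A powr (3 + \<beta>) * (1 + norm u ^ 4)"
        by (meson mult_left_mono order_trans powr_ge_zero)
      then have "?d ^ 3 * B * norm (A *v u) powr (3 + \<beta>) \<le> ?d ^ 3 * B * (op_norm A powr (3 + \<beta>) * (1 + norm u ^ 4))"
        using B by (intro mult_left_mono) auto
      with bound[of y "A *v u"] show ?thesis by (simp only: mult.assoc)
    qed
    then have "\<bar>\<integral>u. ?R u \<partial>\<mu>\<bar> \<le> (\<integral>u. ?d ^ 3 * B * op_norm A powr (3 + \<beta>) * (1 + norm u ^ 4) \<partial>\<mu>)"
      by (intro order_trans[OF integral_abs_bound] integral_mono integrable_abs R integrable_mult_right
          Bochner_Integration.integrable_add integrable_norm_power4) auto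
    then show ?thesis unfolding R(2) integral_mult_right_zero by (simp only: mult_ac)
  qed
  moreover have "0 \<le> ?d ^ 3 * B * ?m"
    using B by (intro mult_nonneg_nonneg integral_nonneg_AE) auto
  ultimately show ?thesis using that by blast
qed

text \<open>The noise is expanded around the drifted point x + g b(x), the drift around x, and the
  second partials are then moved from the drifted point back to x. These three errors are
  \<open>one\<close>, \<open>two\<close> and \<open>S\<close>, with constants \<open>?F\<close>,
  \<open>?D\<close> and \<open>?E\<close>.\<close>

lemma one_step_remainder:
  fixes f :: "real^'d \<Rightarrow> real" and \<sigma> :: "real^'d \<Rightarrow> real^'r^'d"
  assumes f: "C_k_holder 3 \<beta> f" and \<beta>: "0 < \<beta>" "\<beta> \<le> 1"
    and \<kappa>: "\<And>x. op_norm (\<sigma> x) \<le> \<kappa>"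
  obtains C where "0 \<le> C"
    "\<And>x g. 0 \<le> g \<Longrightarrow> \<bar>(\<integral>u. f (x + g *\<^sub>R b x + sqrt g *\<^sub>R (\<sigma> x *v u)) \<partial>\<mu>) - f x - g * generator b \<sigma> f x\<bar>
     \<le> C * (g\<^sup>2 * ((norm (b x))\<^sup>2 + norm (b x)) + g powr ((3 + \<beta>) / 2))"
proof -
  have C2: "C_k 2 f" using f by (auto simp: C_k_holder_def C_k_def)
  have \<kappa>0: "0 \<le> \<kappa>" using \<kappa>[of 0] op_norm_nonneg[of "\<sigma> 0"] by linarith
  obtain C1 where C1: "0 \<le> C1"
    "\<And>y (A :: real^'r^'d). \<bar>(\<integral>u. f (y + A *v u) \<partial>\<mu>) - f y
       - 1/2 * (\<Sum>i\<in>UNIV. \<Sum>j\<in>UNIV. (A ** transpose A) $ i $ j * pdiffs [j, i] f y)\<bar>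
     \<le> C1 * op_norm A powr (3 + \<beta>)"
    by (rule second_order_expansion[OF f \<beta>]) (rule that)
  obtain B2 where B2: "0 \<le> B2" "\<And>is x. length is = 2 \<Longrightarrow> \<bar>pdiffs is f x\<bar> \<le> B2"
    using pdiffs_bounded[OF f, of 2] by auto
  obtain B3 where B3: "0 \<le> B3" "\<And>is x h. length is = 2 \<Longrightarrow> \<bar>pdiffs is f (x + h) - pdiffs is f x\<bar> \<le> B3 * norm h"
    using pdiffs_lipschitz[OF f, of 2] by auto
  let ?d = "real CARD('d)" and ?r = "real CARD('r)"
  let ?D = "?d\<^sup>2 * B2" and ?E = "?d\<^sup>2 * ?r * \<kappa>\<^sup>2 * B3" and ?F = "C1 * \<kappa> powr (3 + \<beta>)"
  define C where "C = ?D + ?E + ?F"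
  have nn: "0 \<le> ?D" "0 \<le> ?E" "0 \<le> ?F" using B2(1) B3(1) C1(1) by auto
  have "\<bar>(\<integral>u. f (x + g *\<^sub>R b x + sqrt g *\<^sub>R (\<sigma> x *v u)) \<partial>\<mu>) - f x - g * generator b \<sigma> f x\<bar>
     \<le> C * (g\<^sup>2 * ((norm (b x))\<^sup>2 + norm (b x)) + g powr ((3 + \<beta>) / 2))" if g: "0 \<le> g" for x g
  proof -
    let ?y = "x + g *\<^sub>R b x" and ?A = "sqrt g *\<^sub>R \<sigma> x"
    let ?S = "\<lambda>y. \<Sum>i\<in>UNIV. \<Sum>j\<in>UNIV. (\<sigma> x ** transpose (\<sigma> x)) $ i $ j * pdiffs [j, i] f y"
    have AA: "(?A ** transpose ?A) $ i $ j = g * (\<sigma> x ** transpose (\<sigma> x)) $ i $ j" for i j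
      using g by (simp add: matrix_matrix_mult_def transpose_def sum_distrib_left mult_ac)
        (simp add: mult.assoc[symmetric])
    have opA: "op_norm ?A powr (3 + \<beta>) \<le> \<kappa> powr (3 + \<beta>) * g powr ((3 + \<beta>) / 2)"
    proof -
      have "op_norm ?A = sqrt g * op_norm (\<sigma> x)"
        using onorm_scaleR[OF matrix_vector_mul_bounded_linear[of "\<sigma> x"], of "sqrt g"] g
        by (simp add: scaleR_matrix_vector_assoc)
      also have "\<dots> \<le> sqrt g * \<kappa>" using g \<kappa> by (intro mult_left_mono) auto
      finally have "op_norm ?A powr (3 + \<beta>) \<le> (sqrt g * \<kappa>) powr (3 + \<beta>)"
        using \<beta> by (intro powr_mono2) (auto simp: op_norm_nonneg)
      also have "\<dots> = g powr ((3 + \<beta>) / 2) * \<kappa> powr (3 + \<beta>)"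
        using g \<kappa>0 by (cases "g = 0") (auto simp: powr_mult powr_half_sqrt[symmetric] powr_powr)
      finally show ?thesis by (simp add: mult.commute)
    qed
    have one: "\<bar>(\<integral>u. f (x + g *\<^sub>R b x + sqrt g *\<^sub>R (\<sigma> x *v u)) \<partial>\<mu>) - f ?y - g / 2 * ?S ?y\<bar>
        \<le> ?F * g powr ((3 + \<beta>) / 2)"
    proof -
      have eq1: "g / 2 * ?S ?y = 1/2 * (\<Sum>i\<in>UNIV. \<Sum>j\<in>UNIV. (?A ** transpose ?A) $ i $ j * pdiffs [j, i] f ?y)"
        unfolding AA by (simp add: sum_distrib_left mult.assoc)
      have eq2: "sqrt g *\<^sub>R (\<sigma> x *v u) = ?A *v u" for u
        by (simp add: scaleR_matrix_vector_assoc)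
      show ?thesis
        unfolding eq1 eq2
        using order_trans[OF C1(2)[of ?y ?A] mult_left_mono[OF opA C1(1)]] by (simp only: mult.assoc)
    qed
    have two: "\<bar>f ?y - f x - g * (b x \<bullet> grad f x)\<bar> \<le> ?D * (g\<^sup>2 * (norm (b x))\<^sup>2)"
    proof -
      obtain t where t: "0 < t" "t < 1"
        "f ?y = (\<Sum>m<2. dir_deriv (g *\<^sub>R b x) m [] f x / fact m) + dir_deriv (g *\<^sub>R b x) 2 [] f (x + t *\<^sub>R (g *\<^sub>R b x)) / fact 2"
        using taylor_dir_deriv[OF C2, of x "g *\<^sub>R b x"] by auto
      have "f ?y - f x - g * (b x \<bullet> grad f x) = dir_deriv (g *\<^sub>R b x) 2 [] f (x + t *\<^sub>R (g *\<^sub>R b x)) / 2"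
      proof -
        have "g * (b x \<bullet> grad f x) = dir_deriv (g *\<^sub>R b x) 1 [] f x"
          unfolding grad_eq_sum[symmetric] by simp
        then show ?thesis
          unfolding t(3) by (simp del: dir_deriv.simps add: eval_nat_numeral) (simp add: pdiffs_def)
      qed
      moreover have "\<bar>dir_deriv (g *\<^sub>R b x) 2 [] f (x + t *\<^sub>R (g *\<^sub>R b x))\<bar> \<le> (?d * norm (g *\<^sub>R b x))\<^sup>2 * B2"
        by (intro dir_deriv_bound[where l = 0]) (use B2 in auto)
      ultimately show ?thesis
        using g by (simp add: power_mult_distrib mult_ac)
    qed
    have S: "\<bar>?S ?y - ?S x\<bar> \<le> ?E * (g * norm (b x))"
    proof -
      note ent = abs_mult_transpose_nth_le[OF \<kappa>]
      have "\<bar>?S ?y - ?S x\<bar> = \<bar>\<Sum>i\<in>UNIV. \<Sum>j\<in>UNIV. (\<sigma> x ** transpose (\<sigma> x)) $ i $ j * (pdiffs [j, i] f ?y - pdiffs [j, i] f x)\<bar>"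
        by (simp add: sum_subtractf right_diff_distrib)
      also have "\<dots> \<le> (\<Sum>i\<in>UNIV. \<Sum>j\<in>UNIV. \<bar>(\<sigma> x ** transpose (\<sigma> x)) $ i $ j * (pdiffs [j, i] f ?y - pdiffs [j, i] f x)\<bar>)"
        by (intro order_trans[OF sum_abs] sum_mono sum_abs)
      also have "\<dots> \<le> (\<Sum>i\<in>(UNIV::'d set). \<Sum>j\<in>(UNIV::'d set). (?r * \<kappa>\<^sup>2) * (B3 * norm (g *\<^sub>R b x)))"
        unfolding abs_mult by (intro sum_mono mult_mono ent B3(2)) auto
      also have "\<dots> = ?E * (g * norm (b x))"
        using g by (simp add: power2_eq_square)
      finally show ?thesis .
    qed
    have gen: "g * generator b \<sigma> f x = g * (b x \<bullet> grad f x) + g / 2 * ?S x"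
    proof -
      have "generator b \<sigma> f x = b x \<bullet> grad f x + 1/2 * ?S x"
        by (simp add: generator_eq_sum inner_vec_def grad_def pdiffs_def)
      then show ?thesis by (simp add: distrib_left)
    qed
    have "\<bar>g / 2 * ?S ?y - g / 2 * ?S x\<bar> \<le> ?E * (g\<^sup>2 * norm (b x))"
    proof -
      have "\<bar>g / 2 * ?S ?y - g / 2 * ?S x\<bar> = g / 2 * \<bar>?S ?y - ?S x\<bar>"
        unfolding right_diff_distrib[symmetric] abs_mult using g by simp
      also have "\<dots> \<le> g * \<bar>?S ?y - ?S x\<bar>"
        using g by (intro mult_right_mono) auto
      also have "\<dots> \<le> g * (?E * (g * norm (b x)))"
        using g S by (intro mult_left_mono) auto
      finally show ?thesis by (simp only: power2_eq_square mult_ac)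
    qed
    with one two gen
    have "\<bar>(\<integral>u. f (x + g *\<^sub>R b x + sqrt g *\<^sub>R (\<sigma> x *v u)) \<partial>\<mu>) - f x - g * generator b \<sigma> f x\<bar>
      \<le> ?F * g powr ((3 + \<beta>) / 2) + ?D * (g\<^sup>2 * (norm (b x))\<^sup>2) + ?E * (g\<^sup>2 * norm (b x))"
      by linarith
    also have "\<dots> \<le> C * (g powr ((3 + \<beta>) / 2)) + C * (g\<^sup>2 * (norm (b x))\<^sup>2) + C * (g\<^sup>2 * norm (b x))"
      using nn unfolding C_def by (intro add_mono mult_right_mono) auto
    also have "\<dots> = C * (g\<^sup>2 * ((norm (b x))\<^sup>2 + norm (b x)) + g powr ((3 + \<beta>) / 2))"
      by (simp add: algebra_simps)
    finally show ?thesis .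
  qed
  moreover have "0 \<le> C" using nn by (simp add: C_def)
  ultimately show ?thesis using that by blast
qed

end

section \<open>Exponential moments along the scheme\<close>

lemma exp_convex_combination:
  fixes x y w :: real
  assumes "0 \<le> w" "w \<le> 1"
  shows "exp (w * x + (1 - w) * y) \<le> w * exp x + (1 - w) * exp y"
  using convex_onD[OF exp_convex, of "1 - w" x y] assms by simp

context prob_space
begin

lemma nn_integral_exp_add_const:
  assumes "f \<in> borel_measurable M"
  shows "(\<integral>\<^sup>+\<omega>. ennreal (exp (f \<omega> + c)) \<partial>M) = ennreal (exp c) * (\<integral>\<^sup>+\<omega>. ennreal (exp (f \<omega>)) \<partial>M)"
proof -
  have "(\<integral>\<^sup>+\<omega>. ennreal (exp (f \<omega> + c)) \<partial>M) = (\<integral>\<^sup>+\<omega>. ennreal (exp c) * ennreal (exp (f \<omega>)) \<partial>M)"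
    by (simp add: exp_add mult.commute ennreal_mult[symmetric])
  then show ?thesis using assms by (simp add: nn_integral_cmult)
qed

lemma nn_integral_exp_diff_le_1:
  assumes "f \<in> borel_measurable M" "(\<integral>\<^sup>+\<omega>. ennreal (exp (f \<omega>)) \<partial>M) \<le> ennreal (exp a)"
  shows "(\<integral>\<^sup>+\<omega>. ennreal (exp (f \<omega> - a)) \<partial>M) \<le> 1"
proof -
  have "(\<integral>\<^sup>+\<omega>. ennreal (exp (f \<omega> + - a)) \<partial>M) \<le> ennreal (exp (- a)) * ennreal (exp a)"
    unfolding nn_integral_exp_add_const[OF assms(1)] by (intro mult_left_mono assms) simp
  also have "\<dots> = 1" by (simp add: ennreal_mult[symmetric] exp_add[symmetric])
  finally show ?thesis by simp
qed

lemma nn_integral_exp_diffD: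
  assumes "f \<in> borel_measurable M" "(\<integral>\<^sup>+\<omega>. ennreal (exp (f \<omega> - a)) \<partial>M) \<le> 1"
  shows "(\<integral>\<^sup>+\<omega>. ennreal (exp (f \<omega>)) \<partial>M) \<le> ennreal (exp a)"
proof -
  have "(\<integral>\<^sup>+\<omega>. ennreal (exp ((f \<omega> - a) + a)) \<partial>M) \<le> ennreal (exp a) * 1"
    by (subst nn_integral_exp_add_const) (use assms in \<open>auto intro!: mult_left_mono simp del: mult_1_right\<close>)
  then show ?thesis by simp
qed

text \<open>Hoelder with exponents 1 / w and 1 / (1 - w), through Young's inequality: once both
  integrals are normalised to at most 1, convexity of exp suffices. The form with convex weights
  also covers w = 0 and w = 1.\<close>

lemma nn_integral_exp_hoelder:
  fixes f g :: "'a \<Rightarrow> real"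
  assumes "f \<in> borel_measurable M" "g \<in> borel_measurable M" "0 \<le> w" "w \<le> 1"
    and f: "(\<integral>\<^sup>+\<omega>. ennreal (exp (f \<omega>)) \<partial>M) \<le> ennreal (exp p)"
    and g: "(\<integral>\<^sup>+\<omega>. ennreal (exp (g \<omega>)) \<partial>M) \<le> ennreal (exp q)"
  shows "(\<integral>\<^sup>+\<omega>. ennreal (exp (w * f \<omega> + (1 - w) * g \<omega>)) \<partial>M) \<le> ennreal (exp (w * p + (1 - w) * q))"
proof (rule nn_integral_exp_diffD)
  have "(\<integral>\<^sup>+\<omega>. ennreal (exp (w * f \<omega> + (1 - w) * g \<omega> - (w * p + (1 - w) * q))) \<partial>M)
      \<le> (\<integral>\<^sup>+\<omega>. ennreal w * ennreal (exp (f \<omega> - p)) + ennreal (1 - w) * ennreal (exp (g \<omega> - q)) \<partial>M)"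
  proof (intro nn_integral_mono)
    fix \<omega>
    have "exp (w * f \<omega> + (1 - w) * g \<omega> - (w * p + (1 - w) * q)) = exp (w * (f \<omega> - p) + (1 - w) * (g \<omega> - q))"
      by (simp add: algebra_simps)
    also have "\<dots> \<le> w * exp (f \<omega> - p) + (1 - w) * exp (g \<omega> - q)"
      using assms by (intro exp_convex_combination) auto
    finally show "ennreal (exp (w * f \<omega> + (1 - w) * g \<omega> - (w * p + (1 - w) * q)))
        \<le> ennreal w * ennreal (exp (f \<omega> - p)) + ennreal (1 - w) * ennreal (exp (g \<omega> - q))"
      using assms by (simp add: ennreal_mult[symmetric] ennreal_plus[symmetric] del: ennreal_plus)
  qed
  also have "\<dots> = ennreal w * (\<integral>\<^sup>+\<omega>. ennreal (exp (f \<omega> - p)) \<partial>M) + ennreal (1 - w) * (\<integral>\<^sup>+\<omega>. ennreal (exp (g \<omega> - q)) \<partial>M)"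
    using assms by (simp add: nn_integral_add nn_integral_cmult)
  also have "\<dots> \<le> ennreal w * 1 + ennreal (1 - w) * 1"
    by (intro add_mono mult_left_mono nn_integral_exp_diff_le_1 assms) auto
  also have "\<dots> = 1" using assms by (simp add: ennreal_plus[symmetric] del: ennreal_plus)
  finally show "(\<integral>\<^sup>+\<omega>. ennreal (exp (w * f \<omega> + (1 - w) * g \<omega> - (w * p + (1 - w) * q))) \<partial>M) \<le> 1" .
qed (use assms in simp)

text \<open>Jensen, pointwise in \<omega>; no independence of the averaged variables is involved. It
  serves for sums over the whole trajectory, with normalised squared steps as weights.\<close>

lemma nn_integral_exp_average:
  fixes f :: "'i \<Rightarrow> 'a \<Rightarrow> real"
  assumes "finite I" "\<And>i. i \<in> I \<Longrightarrow> f i \<in> borel_measurable M" "\<And>i. i \<in> I \<Longrightarrow> 0 \<le> w i" "(\<Sum>i\<in>I. w i) = 1"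
    and f: "\<And>i. i \<in> I \<Longrightarrow> (\<integral>\<^sup>+\<omega>. ennreal (exp (f i \<omega>)) \<partial>M) \<le> ennreal B"
  shows "(\<integral>\<^sup>+\<omega>. ennreal (exp (\<Sum>i\<in>I. w i * f i \<omega>)) \<partial>M) \<le> ennreal B"
proof -
  have "(\<integral>\<^sup>+\<omega>. ennreal (exp (\<Sum>i\<in>I. w i * f i \<omega>)) \<partial>M) \<le> (\<integral>\<^sup>+\<omega>. (\<Sum>i\<in>I. ennreal (w i) * ennreal (exp (f i \<omega>))) \<partial>M)"
  proof (intro nn_integral_mono)
    fix \<omega>
    have "I \<noteq> {}" using assms(4) by auto
    then have "exp (\<Sum>i\<in>I. w i *\<^sub>R f i \<omega>) \<le> (\<Sum>i\<in>I. w i * exp (f i \<omega>))"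
      using assms by (intro convex_on_sum[OF _ _ exp_convex]) auto
    then show "ennreal (exp (\<Sum>i\<in>I. w i * f i \<omega>)) \<le> (\<Sum>i\<in>I. ennreal (w i) * ennreal (exp (f i \<omega>)))"
      using assms by (simp add: ennreal_mult[symmetric] sum_ennreal ennreal_leI)
  qed
  also have "\<dots> = (\<Sum>i\<in>I. ennreal (w i) * (\<integral>\<^sup>+\<omega>. ennreal (exp (f i \<omega>)) \<partial>M))"
    using assms by (simp add: nn_integral_sum nn_integral_cmult)
  also have "\<dots> \<le> (\<Sum>i\<in>I. ennreal (w i) * ennreal B)"
    by (intro sum_mono mult_left_mono f) auto
  also have "\<dots> = ennreal B"
    using assms by (simp add: sum_distrib_right[symmetric] sum_ennreal)
  finally show ?thesis .
qed

text \<open>Hoelder against the constant 1. A small s brings the constant exp B as close to 1 as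
  desired, which is how the prefactor of the deviation bound can tend to 1.\<close>

lemma nn_integral_exp_scale:
  fixes f :: "'a \<Rightarrow> real"
  assumes "f \<in> borel_measurable M" "0 \<le> s" "s \<le> 1" "(\<integral>\<^sup>+\<omega>. ennreal (exp (f \<omega>)) \<partial>M) \<le> ennreal (exp B)"
  shows "(\<integral>\<^sup>+\<omega>. ennreal (exp (s * f \<omega>)) \<partial>M) \<le> ennreal (exp (s * B))"
  using nn_integral_exp_hoelder[OF assms(1) borel_measurable_const assms(2,3,4), of 0 0]
  by (simp add: emeasure_space_1)

lemma chernoff_bound:
  assumes "f \<in> borel_measurable M" "(\<integral>\<^sup>+\<omega>. ennreal (exp (f \<omega>)) \<partial>M) \<le> ennreal (exp p)"
  shows "prob {\<omega> \<in> space M. t \<le> f \<omega>} \<le> exp (p - t)"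
proof -
  have "emeasure M {\<omega> \<in> space M. t \<le> f \<omega>} \<le> emeasure M {\<omega> \<in> space M. 1 \<le> ennreal (exp (- t)) * ennreal (exp (f \<omega>))}"
    using assms(1) by (intro emeasure_mono) (auto simp: ennreal_mult[symmetric] exp_add[symmetric])
  also have "\<dots> \<le> ennreal (exp (- t)) * (\<integral>\<^sup>+\<omega>. ennreal (exp (f \<omega>)) * indicator (space M) \<omega> \<partial>M)"
  proof -
    show ?thesis
      by (rule nn_integral_Markov_inequality) (use assms(1) in auto)
  qed
  also have "\<dots> = ennreal (exp (- t)) * (\<integral>\<^sup>+\<omega>. ennreal (exp (f \<omega>)) \<partial>M)"
    by (intro arg_cong2[where f = "(*)"] nn_integral_cong) auto
  also have "\<dots> \<le> ennreal (exp (- t)) * ennreal (exp p)"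
    by (intro mult_left_mono assms) simp
  also have "\<dots> = ennreal (exp (p - t))"
    by (simp add: ennreal_mult[symmetric] exp_add[symmetric])
  finally show ?thesis by (simp add: emeasure_eq_measure)
qed

end

section \<open>Independence of the next innovation from the past\<close>

lemma Int_stable_vimage: "Int_stable {f -` A \<inter> S |A. A \<in> sets N}"
proof (rule Int_stableI)
  fix a c assume "a \<in> {f -` A \<inter> S |A. A \<in> sets N}" "c \<in> {f -` A \<inter> S |A. A \<in> sets N}"
  then obtain A C where "a = f -` A \<inter> S" "c = f -` C \<inter> S" "A \<in> sets N" "C \<in> sets N" by blast
  then have "a \<inter> c = f -` (A \<inter> C) \<inter> S" "A \<inter> C \<in> sets N" by auto
  then show "a \<inter> c \<in> {f -` A \<inter> S |A. A \<in> sets N}" by blast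
qed

locale euler_scheme = prob_space M for M :: "'s measure" +
  fixes X0 :: "'s \<Rightarrow> real^'d" and U :: "nat \<Rightarrow> 's \<Rightarrow> real^'r"
    and b :: "real^'d \<Rightarrow> real^'d" and \<sigma> :: "real^'d \<Rightarrow> real^'r^'d" and \<gamma> :: "nat \<Rightarrow> real"
  assumes X0_measurable: "X0 \<in> borel_measurable M"
    and GC: "assm_GC M X0 U"
    and b_continuous: "continuous_on UNIV b"
    and \<sigma>_continuous: "continuous_on UNIV \<sigma>"
begin

abbreviation X :: "nat \<Rightarrow> 's \<Rightarrow> real^'d" where
  "X \<equiv> scheme b \<sigma> \<gamma> X0 U"

definition innovation :: "(real^'r) measure" where
  "innovation = distr M borel (U 1)"

lemma indep_U: "indep_vars (\<lambda>_. borel) U {1..}"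
  using GC by (simp add: assm_GC_def)

lemma U_measurable: "1 \<le> n \<Longrightarrow> U n \<in> borel_measurable M"
  using indep_U by (simp add: indep_vars_def2)

lemma distr_U: "1 \<le> n \<Longrightarrow> distr M borel (U n) = innovation"
  using GC unfolding assm_GC_def innovation_def by blast

lemma U_mean: "(\<integral>\<omega>. U 1 \<omega> $ i \<partial>M) = 0"
  and U_covariance: "(\<integral>\<omega>. U 1 \<omega> $ i * U 1 \<omega> $ j \<partial>M) = (if i = j then 1 else 0)"
  and U_third_moment: "(\<integral>\<omega>. U 1 \<omega> $ i * U 1 \<omega> $ j * U 1 \<omega> $ k \<partial>M) = 0"
  using GC unfolding assm_GC_def by blast+

sublocale innovation: gaussian_concentration innovation
proof -
  note m = U_measurable[OF order_refl]
  interpret I: prob_space innovation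
    unfolding innovation_def by (rule prob_space_distr[OF m])
  show "gaussian_concentration innovation"
  proof
    show "sets innovation = sets borel" by (simp add: innovation_def)
    fix i j k
    show "(\<integral>u. u $ i \<partial>innovation) = 0" "(\<integral>u. u $ i * u $ j \<partial>innovation) = (if i = j then 1 else 0)"
      "(\<integral>u. u $ i * u $ j * u $ k \<partial>innovation) = 0"
      using U_mean U_covariance U_third_moment unfolding innovation_def
      by (subst integral_distr[OF m]; simp)+
    fix g :: "real^'r \<Rightarrow> real" and l :: real
    assume g: "1-lipschitz_on UNIV g" and l: "0 < l"
    have gm[measurable]: "g \<in> borel_measurable borel"
      by (intro borel_measurable_continuous_onI lipschitz_on_continuous_on[OF g])
    from GC g l
    have *: "integrable M (\<lambda>\<omega>. exp (l * g (U 1 \<omega>))) \<and>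
        (\<integral>\<omega>. exp (l * g (U 1 \<omega>)) \<partial>M) \<le> exp (l * (\<integral>\<omega>. g (U 1 \<omega>) \<partial>M) + l\<^sup>2 / 2)"
      unfolding assm_GC_def by blast
    show "integrable innovation (\<lambda>u. exp (l * g u)) \<and>
      (\<integral>u. exp (l * g u) \<partial>innovation) \<le> exp (l * (\<integral>u. g u \<partial>innovation) + l\<^sup>2 / 2)"
      using * unfolding innovation_def by (simp add: integrable_distr_eq[OF m] integral_distr[OF m] del: One_nat_def)
  qed
qed

text \<open>Innovations are numbered from 1, so \<open>X0\<close> takes the free slot 0 and a single
  family of pi-systems describes all the randomness.\<close>

definition gen_sets :: "nat \<Rightarrow> 's set set" where
  "gen_sets n = (case n of
      0 \<Rightarrow> {X0 -` A \<inter> space M |A. A \<in> sets borel}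
    | Suc _ \<Rightarrow> {U n -` A \<inter> space M |A. A \<in> sets borel})"

definition past :: "nat \<Rightarrow> 's measure" where
  "past n = sigma (space M) (\<Union>i\<in>{..n}. gen_sets i)"

lemma gen_sets_events: "gen_sets n \<subseteq> events"
  using X0_measurable U_measurable[of n] by (cases n) (auto simp: gen_sets_def intro: measurable_sets)

text \<open>(GC) states independence among the innovations and of \<open>X0\<close> from the
  sequence as a whole. Splitting index 0 off a finite intersection merges both into joint
  independence.\<close>

lemma indep_gen_sets: "indep_sets gen_sets UNIV"
proof (rule indep_setsI)
  show "gen_sets i \<subseteq> events" for i by (rule gen_sets_events)
  fix A and J :: "nat set" assume J: "J \<noteq> {}" "finite J" "\<forall>j\<in>J. A j \<in> gen_sets j"
  have U_sets: "indep_sets (\<lambda>n. {U n -` A \<inter> space M |A. A \<in> sets borel}) {1..}"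
    using indep_U unfolding indep_vars_def2 by blast
  have pos: "prob (\<Inter>j\<in>K. A j) = (\<Prod>j\<in>K. prob (A j))" if K: "K \<subseteq> J" "0 \<notin> K" "K \<noteq> {}" for K
  proof (rule indep_setsD[OF U_sets])
    show "K \<subseteq> {1..}"
    proof
      fix j assume "j \<in> K"
      then show "j \<in> {1..}" using K(2) by (cases j) auto
    qed
    show "finite K" using K(1) J finite_subset by blast
    show "\<forall>j\<in>K. A j \<in> {U j -` A \<inter> space M |A. A \<in> sets borel}"
    proof
      fix j assume j: "j \<in> K"
      then obtain m where "j = Suc m" using K(2) by (cases j) auto
      with J(3) K(1) j show "A j \<in> {U j -` A \<inter> space M |A. A \<in> sets borel}"
        by (auto simp: gen_sets_def dest!: bspec)
    qed
  qed (use K in simp)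
  show "prob (\<Inter>j\<in>J. A j) = (\<Prod>j\<in>J. prob (A j))"
  proof (cases "0 \<in> J")
    case False
    then show ?thesis using pos[of J] J by simp
  next
    case True
    let ?K = "J - {0}"
    show ?thesis
    proof (cases "?K = {}")
      case True
      with \<open>0 \<in> J\<close> have "J = {0}" by blast
      then show ?thesis by simp
    next
      case False
      let ?U = "\<lambda>\<omega>. \<lambda>n\<in>{1..}. U n \<omega>" and ?P = "\<Pi>\<^sub>M n\<in>{1::nat..}. (borel :: (real^'r) measure)"
      have A0: "A 0 \<in> sets (vimage_algebra (space M) X0 borel)"
        using J(3) True by (fastforce simp: gen_sets_def sets_vimage_algebra2)
      \<comment> \<open>Events of finitely many innovations are cylinder sets of the sequence, hence
        covered by its independence from \<open>X0\<close>.\<close>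
      have "(\<Inter>j\<in>?K. A j) \<in> sets (vimage_algebra (space M) ?U ?P)"
      proof (rule sets.finite_INT)
        fix j assume j: "j \<in> ?K"
        then obtain m where m: "j = Suc m" by (cases j) auto
        then obtain B where B: "B \<in> sets borel" "A j = U j -` B \<inter> space M"
          using J(3) j by (fastforce simp: gen_sets_def)
        have "A j = ?U -` ((\<lambda>f. f j) -` B \<inter> space ?P) \<inter> space M"
          using B m by (auto simp: space_PiM)
        moreover have "(\<lambda>f. f j) -` B \<inter> space ?P \<in> sets ?P"
          using B m by (intro measurable_sets[OF measurable_component_singleton]) auto
        ultimately show "A j \<in> sets (vimage_algebra (space M) ?U ?P)"
          by (metis in_vimage_algebra)
      qed (use J False in auto)
      then have "prob (A 0 \<inter> (\<Inter>j\<in>?K. A j)) = prob (A 0) * prob (\<Inter>j\<in>?K. A j)"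
        using GC A0 by (intro indep_setD[of "sets (vimage_algebra (space M) X0 borel)" "sets (vimage_algebra (space M) ?U ?P)"])
          (auto simp: assm_GC_def)
      moreover have "A 0 \<inter> (\<Inter>j\<in>?K. A j) = (\<Inter>j\<in>J. A j)" using True by blast
      moreover have "prob (A 0) * (\<Prod>j\<in>?K. prob (A j)) = (\<Prod>j\<in>J. prob (A j))"
        using J(2) True by (simp add: prod.remove)
      ultimately show ?thesis using pos[of ?K] False by simp
    qed
  qed
qed

lemma Int_stable_gen_sets: "Int_stable (gen_sets n)"
  by (cases n) (simp_all add: gen_sets_def Int_stable_vimage)

lemma space_past [simp]: "space (past n) = space M"
  unfolding past_def by (rule space_measure_of) (use gen_sets_events sets.sets_into_space in blast)

lemma sets_past: "sets (past n) = sigma_sets (space M) (\<Union>i\<in>{..n}. gen_sets i)"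
  unfolding past_def by (rule sets_measure_of) (use gen_sets_events sets.sets_into_space in blast)

lemma sets_past_mono: "m \<le> n \<Longrightarrow> sets (past m) \<subseteq> sets (past n)"
  unfolding sets_past by (intro sigma_sets_mono') (auto intro: order_trans)

lemma sets_past_events: "sets (past n) \<subseteq> events"
  unfolding sets_past using gen_sets_events by (intro sets.sigma_sets_subset) auto

lemma measurable_past_mono: "f \<in> measurable (past m) K \<Longrightarrow> m \<le> n \<Longrightarrow> f \<in> measurable (past n) K"
  using sets_past_mono[of m n] by (auto simp: measurable_def)

lemma measurable_past: "f \<in> measurable (past n) K \<Longrightarrow> f \<in> measurable M K"
  using sets_past_events[of n] by (auto simp: measurable_def)

lemma X0_measurable_past: "X0 \<in> borel_measurable (past n)"
proof (rule measurableI)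
  fix A :: "(real^'d) set" assume "A \<in> sets borel"
  then have "X0 -` A \<inter> space M \<in> gen_sets 0" by (auto simp: gen_sets_def)
  then show "X0 -` A \<inter> space (past n) \<in> sets (past n)" by (auto simp: sets_past)
qed simp

lemma U_measurable_past:
  assumes "1 \<le> m" "m \<le> n"
  shows "U m \<in> borel_measurable (past n)"
proof (rule measurableI)
  fix A :: "(real^'r) set" assume "A \<in> sets borel"
  then have "U m -` A \<inter> space M \<in> gen_sets m"
    using assms(1) by (cases m) (auto simp: gen_sets_def)
  then show "U m -` A \<inter> space (past n) \<in> sets (past n)" using assms(2) by (auto simp: sets_past)
qed simp

lemma indep_past_gen_sets: "indep_set (sets (past n)) (gen_sets (Suc n))"
proof -
  have "indep_sets (\<lambda>j. sigma_sets (space M) (\<Union>i\<in>case_bool {..n} {Suc n} j. gen_sets i)) UNIV"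
  proof (rule indep_sets_collect_sigma)
    show "indep_sets gen_sets (\<Union>j\<in>UNIV. case_bool {..n} {Suc n} j)"
      by (rule indep_sets_mono_index[OF _ indep_gen_sets]) simp
    show "Int_stable (gen_sets i)" for i by (rule Int_stable_gen_sets)
    show "disjoint_family_on (case_bool {..n} {Suc n}) UNIV"
      by (auto simp: disjoint_family_on_def split: bool.split)
  qed
  then show ?thesis
    unfolding indep_set_def
  proof (rule indep_sets_mono_sets)
    fix i :: bool
    show "case_bool (sets (past n)) (gen_sets (Suc n)) i
        \<subseteq> sigma_sets (space M) (\<Union>i\<in>case_bool {..n} {Suc n} i. gen_sets i)"
      by (cases i) (simp_all add: sets_past subsetI)
  qed
qed

lemma distr_past_U:
  assumes Z: "Z \<in> measurable (past n) K"
  shows "distr M K Z \<Otimes>\<^sub>M innovation = distr M (K \<Otimes>\<^sub>M borel) (\<lambda>\<omega>. (Z \<omega>, U (Suc n) \<omega>))"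
proof (rule pair_measure_eqI)
  have meas[measurable]: "Z \<in> measurable M K" "U (Suc n) \<in> borel_measurable M"
    using measurable_past[OF Z] U_measurable[of "Suc n"] by auto
  show "sigma_finite_measure (distr M K Z)"
    using prob_space_distr[OF meas(1)] prob_space_imp_sigma_finite by blast
  show "sigma_finite_measure innovation"
    by (rule innovation.sigma_finite_measure_axioms)
  show "sets (distr M K Z \<Otimes>\<^sub>M innovation) = sets (distr M (K \<Otimes>\<^sub>M borel) (\<lambda>\<omega>. (Z \<omega>, U (Suc n) \<omega>)))"
    by (simp only: sets_distr sets_pair_measure_cong[OF sets_distr innovation.sets_mu])
  fix A B assume "A \<in> sets (distr M K Z)" "B \<in> sets innovation"
  then have A: "A \<in> sets K" and B: "B \<in> sets borel" by (auto simp: innovation.sets_mu)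
  have "prob ((Z -` A \<inter> space M) \<inter> (U (Suc n) -` B \<inter> space M)) = prob (Z -` A \<inter> space M) * prob (U (Suc n) -` B \<inter> space M)"
  proof (rule indep_setD[OF indep_past_gen_sets[of n]])
    show "Z -` A \<inter> space M \<in> sets (past n)" using measurable_sets[OF Z A] by simp
    show "U (Suc n) -` B \<inter> space M \<in> gen_sets (Suc n)" using B by (auto simp: gen_sets_def)
  qed
  moreover have "(\<lambda>\<omega>. (Z \<omega>, U (Suc n) \<omega>)) -` (A \<times> B) \<inter> space M = (Z -` A \<inter> space M) \<inter> (U (Suc n) -` B \<inter> space M)"
    by auto
  ultimately show "emeasure (distr M K Z) A * emeasure innovation B
      = emeasure (distr M (K \<Otimes>\<^sub>M borel) (\<lambda>\<omega>. (Z \<omega>, U (Suc n) \<omega>))) (A \<times> B)"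
    using A B unfolding distr_U[of "Suc n", simplified, symmetric]
    by (simp add: emeasure_distr emeasure_eq_measure ennreal_mult)
qed

text \<open>Stands in for conditional expectation: by the product law of Z and the next innovation,
  Fubini integrates the innovation out while Z is frozen.\<close>

lemma nn_integral_past_U:
  fixes Z :: "'s \<Rightarrow> 'b" and f :: "'b \<times> (real^'r) \<Rightarrow> ennreal"
  assumes "Z \<in> measurable (past n) K" "f \<in> borel_measurable (K \<Otimes>\<^sub>M borel)"
  shows "(\<integral>\<^sup>+\<omega>. f (Z \<omega>, U (Suc n) \<omega>) \<partial>M) = (\<integral>\<^sup>+\<omega>. (\<integral>\<^sup>+u. f (Z \<omega>, u) \<partial>innovation) \<partial>M)"
proof -
  have meas[measurable]: "Z \<in> measurable M K" "U (Suc n) \<in> borel_measurable M"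
    using measurable_past[OF assms(1)] U_measurable[of "Suc n"] by auto
  have f: "f \<in> borel_measurable (K \<Otimes>\<^sub>M innovation)"
    using assms(2) measurable_cong_sets[OF sets_pair_measure_cong[OF refl innovation.sets_mu] refl] by blast
  note * = distr_past_U[OF assms(1)]
  have f': "f \<in> borel_measurable (distr M K Z \<Otimes>\<^sub>M innovation)"
    using f measurable_cong_sets[OF sets_pair_measure_cong[OF sets_distr refl] refl] by blast
  have "(\<integral>\<^sup>+\<omega>. f (Z \<omega>, U (Suc n) \<omega>) \<partial>M) = (\<integral>\<^sup>+z. f z \<partial>distr M (K \<Otimes>\<^sub>M borel) (\<lambda>\<omega>. (Z \<omega>, U (Suc n) \<omega>)))"
    by (subst nn_integral_distr) (use assms(2) in auto)
  also have "\<dots> = (\<integral>\<^sup>+z. (\<integral>\<^sup>+u. f (z, u) \<partial>innovation) \<partial>distr M K Z)"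
    unfolding *[symmetric] by (rule innovation.nn_integral_fst[OF f', symmetric])
  also have "\<dots> = (\<integral>\<^sup>+\<omega>. (\<integral>\<^sup>+u. f (Z \<omega>, u) \<partial>innovation) \<partial>M)"
    by (intro nn_integral_distr meas innovation.borel_measurable_nn_integral_fst f f')
  finally show ?thesis .
qed

section \<open>Transitions of the scheme and exponential supermartingales\<close>

definition step :: "nat \<Rightarrow> real^'d \<Rightarrow> real^'r \<Rightarrow> real^'d" where
  "step n x u = x + \<gamma> (Suc n) *\<^sub>R b x + sqrt (\<gamma> (Suc n)) *\<^sub>R (\<sigma> x *v u)"

lemma X_Suc: "X (Suc n) \<omega> = step n (X n \<omega>) (U (Suc n) \<omega>)"
  by (simp add: step_def)

lemma step_measurable: "(\<lambda>(x, u). step n x u) \<in> borel_measurable (borel \<Otimes>\<^sub>M borel)"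
  unfolding borel_prod step_def case_prod_beta
  by (intro borel_measurable_continuous_onI continuous_intros continuous_on_matrix_vector_mult
      continuous_on_compose2[OF b_continuous] continuous_on_compose2[OF \<sigma>_continuous]) auto

lemma X_measurable_past: "X n \<in> borel_measurable (past n)"
proof (induction n)
  case 0
  then show ?case by (simp add: X0_measurable_past)
next
  case (Suc n)
  have "(\<lambda>\<omega>. (X n \<omega>, U (Suc n) \<omega>)) \<in> measurable (past (Suc n)) (borel \<Otimes>\<^sub>M borel)"
    by (intro measurable_Pair measurable_past_mono[OF Suc] U_measurable_past) auto
  from measurable_compose[OF this step_measurable[of n]] show ?case
    unfolding X_Suc[abs_def] by simp
qed

lemma X_measurable: "X n \<in> borel_measurable M"
  using measurable_past[OF X_measurable_past] .

definition functional :: "(nat \<Rightarrow> real^'d \<Rightarrow> real^'r \<Rightarrow> real) \<Rightarrow> nat \<Rightarrow> 's \<Rightarrow> real" where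
  "functional G n \<omega> = (\<Sum>k<n. G k (X k \<omega>) (U (Suc k) \<omega>))"

lemma functional_measurable_past:
  assumes "\<And>k. (\<lambda>(x, u). G k x u) \<in> borel_measurable (borel \<Otimes>\<^sub>M borel)"
  shows "functional G n \<in> borel_measurable (past n)"
proof -
  have "(\<lambda>\<omega>. G k (X k \<omega>) (U (Suc k) \<omega>)) \<in> borel_measurable (past n)" if "k < n" for k
  proof -
    have "(\<lambda>\<omega>. (X k \<omega>, U (Suc k) \<omega>)) \<in> measurable (past n) (borel \<Otimes>\<^sub>M borel)"
      using that by (intro measurable_Pair measurable_past_mono[OF X_measurable_past] U_measurable_past) auto
    from measurable_compose[OF this assms[of k]] show ?thesis by simp
  qed
  then show ?thesis unfolding functional_def[abs_def] by (intro borel_measurable_sum) auto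
qed

text \<open>The pair of partial sum and current state is known at time n, so integrating the next
  innovation with this pair frozen contributes a factor of at most 1.\<close>

lemma exp_supermartingale:
  assumes G: "\<And>k. (\<lambda>(x, u). G k x u) \<in> borel_measurable (borel \<Otimes>\<^sub>M borel)"
    and "\<And>k x. (\<integral>\<^sup>+u. ennreal (exp (G k x u)) \<partial>innovation) \<le> 1"
  shows "(\<integral>\<^sup>+\<omega>. ennreal (exp (functional G n \<omega>)) \<partial>M) \<le> 1"
proof (induction n)
  case 0
  then show ?case by (simp add: functional_def emeasure_space_1)
next
  case (Suc n)
  let ?f = "\<lambda>((s, x), u). ennreal (exp (s + G n x u))"
  let ?Z = "\<lambda>\<omega>. (functional G n \<omega>, X n \<omega>)"
  have Z: "?Z \<in> measurable (past n) (borel \<Otimes>\<^sub>M borel)"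
    by (intro measurable_Pair functional_measurable_past G X_measurable_past)
  have [measurable]: "(\<lambda>z. G n (snd (fst z)) (snd z)) \<in> borel_measurable ((borel \<Otimes>\<^sub>M borel) \<Otimes>\<^sub>M borel)"
  proof -
    have "(\<lambda>z. (snd (fst z), snd z)) \<in> measurable ((borel \<Otimes>\<^sub>M borel) \<Otimes>\<^sub>M borel) (borel \<Otimes>\<^sub>M borel)"
      by measurable
    from measurable_compose[OF this G[of n]] show ?thesis by simp
  qed
  have f: "?f \<in> borel_measurable ((borel \<Otimes>\<^sub>M borel) \<Otimes>\<^sub>M borel)"
    unfolding case_prod_beta by measurable
  have "(\<integral>\<^sup>+\<omega>. ennreal (exp (functional G (Suc n) \<omega>)) \<partial>M) = (\<integral>\<^sup>+\<omega>. ?f (?Z \<omega>, U (Suc n) \<omega>) \<partial>M)"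
    by (simp add: functional_def)
  also have "\<dots> = (\<integral>\<^sup>+\<omega>. (\<integral>\<^sup>+u. ?f (?Z \<omega>, u) \<partial>innovation) \<partial>M)"
    by (rule nn_integral_past_U[OF Z f])
  also have "\<dots> \<le> (\<integral>\<^sup>+\<omega>. ennreal (exp (functional G n \<omega>)) \<partial>M)"
  proof (intro nn_integral_mono)
    fix \<omega>
    have "(\<lambda>u. G n (X n \<omega>) u) \<in> borel_measurable borel"
      using measurable_compose[OF measurable_Pair1' G[of n], of "X n \<omega>"] by simp
    note * = innovation.nn_integral_exp_add_const[OF innovation.measurable_mu[OF this], of "functional G n \<omega>"]
    have "(\<integral>\<^sup>+u. ?f (?Z \<omega>, u) \<partial>innovation)
        = ennreal (exp (functional G n \<omega>)) * (\<integral>\<^sup>+u. ennreal (exp (G n (X n \<omega>) u)) \<partial>innovation)"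
      using * by (simp add: add.commute)
    also have "\<dots> \<le> ennreal (exp (functional G n \<omega>)) * 1"
      by (intro mult_left_mono assms(2)) simp
    finally show "(\<integral>\<^sup>+u. ?f (?Z \<omega>, u) \<partial>innovation) \<le> ennreal (exp (functional G n \<omega>))" by simp
  qed
  also note Suc
  finally show ?case .
qed

end

section \<open>The Lyapunov function\<close>

lemma op_norm_hess_le:
  assumes "bdd_above (range (\<lambda>x. op_norm (hess f x)))"
  shows "op_norm (hess f x) \<le> hess_sup f"
  unfolding hess_sup_def using assms by (intro cSUP_upper) auto

lemma C_2_upper_bound:
  fixes f :: "real^'n \<Rightarrow> real"
  assumes f: "C_k 2 f" and H: "bdd_above (range (\<lambda>x. op_norm (hess f x)))"
  shows "f (x + h) \<le> f x + h \<bullet> grad f x + hess_sup f / 2 * (norm h)\<^sup>2"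
proof -
  obtain t where t: "0 < t" "t < 1"
    "f (x + h) = (\<Sum>m<2. dir_deriv h m [] f x / fact m) + dir_deriv h 2 [] f (x + t *\<^sub>R h) / fact 2"
    using taylor_dir_deriv[OF f, of x h] by auto
  let ?z = "x + t *\<^sub>R h"
  have "h \<bullet> (hess f ?z *v h) \<le> norm h * norm (hess f ?z *v h)"
    by (rule norm_cauchy_schwarz)
  also have "\<dots> \<le> norm h * (op_norm (hess f ?z) * norm h)"
    by (intro mult_left_mono norm_matrix_vector_le) simp
  also have "\<dots> \<le> norm h * (hess_sup f * norm h)"
    by (intro mult_left_mono mult_right_mono op_norm_hess_le H) auto
  finally have "dir_deriv h 2 [] f ?z \<le> hess_sup f * (norm h)\<^sup>2"
    unfolding hess_eq_sum by (simp add: power2_eq_square mult_ac)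
  moreover have "f (x + h) = f x + h \<bullet> grad f x + dir_deriv h 2 [] f ?z / 2"
    unfolding t(3) grad_eq_sum by (simp del: dir_deriv.simps add: eval_nat_numeral) (simp add: pdiffs_def)
  ultimately show ?thesis by simp
qed

section \<open>Exponential drift of the Lyapunov function over one step\<close>

context gaussian_concentration
begin

text \<open>The point is the linear exponent s K: with s proportional to the step size, the
  quadratic part of the noise costs only a multiple of the step size.\<close>

lemma nn_integral_exp_square_scale:
  obtains K where "0 \<le> K"
    "\<And>s. 0 \<le> s \<Longrightarrow> s \<le> 1 \<Longrightarrow> (\<integral>\<^sup>+u. ennreal (exp (s * ((norm u)\<^sup>2 / 4))) \<partial>\<mu>) \<le> ennreal (exp (s * K))"
proof -
  let ?I = "\<integral>\<^sup>+u. ennreal (exp ((norm u)\<^sup>2 / 4)) \<partial>\<mu>"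
  obtain r where r: "?I = ennreal r" "0 \<le> r"
    using nn_integral_exp_square_finite by (cases ?I) auto
  let ?K = "ln (max 1 r)"
  have "?I \<le> ennreal (exp ?K)" unfolding r by (intro ennreal_leI) simp
  then have "(\<integral>\<^sup>+u. ennreal (exp (s * ((norm u)\<^sup>2 / 4))) \<partial>\<mu>) \<le> ennreal (exp (s * ?K))" if "0 \<le> s" "s \<le> 1" for s
    using that by (intro nn_integral_exp_scale measurable_mu) auto
  with that[of ?K] show ?thesis by simp
qed

text \<open>In the second-order bound for V the part linear in the noise is Lipschitz, the quadratic
  part has a squared-norm moment, and Hoelder with weight 1/2 separates them. Of the drift - g
  \<alpha> V, the squared drift vector uses up one half (by \<open>gm\<close>), the linear noise one
  quarter (small l); one quarter remains.\<close>

lemma lyapunov_drift: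
  fixes V :: "real^'d \<Rightarrow> real" and \<sigma> :: "real^'d \<Rightarrow> real^'r^'d"
  assumes LV: "assm_LV b \<sigma> V vs CV \<alpha> \<beta>" and \<kappa>: "\<And>x. op_norm (\<sigma> x) \<le> \<kappa>"
    and gm: "0 < gm" "gm * (CV * hess_sup V) \<le> \<alpha> / 2"
  obtains l1 C where "0 < l1" "0 \<le> C"
    "\<And>l g x. 0 < l \<Longrightarrow> l \<le> l1 \<Longrightarrow> 0 \<le> g \<Longrightarrow> g \<le> gm \<Longrightarrow>
      (\<integral>\<^sup>+u. ennreal (exp (l * V (x + g *\<^sub>R b x + sqrt g *\<^sub>R (\<sigma> x *v u)))) \<partial>\<mu>)
      \<le> ennreal (exp (l * V x * (1 - g * \<alpha> / 4) + C * g))"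
proof -
  let ?H = "hess_sup V" and ?d = "real CARD('d)" and ?r = "real CARD('r)"
  have CV: "0 < CV" "0 < \<alpha>" "0 \<le> \<beta>" "0 < vs" and V2: "C_k 2 V" and Hb: "bdd_above (range (\<lambda>x. op_norm (hess V x)))"
    and growth: "\<And>x. (norm (grad V x))\<^sup>2 + (norm (b x))\<^sup>2 \<le> CV * V x"
    and drift: "\<And>x. generator b \<sigma> V x \<le> - \<alpha> * V x + \<beta>" and Vpos: "\<And>x. vs \<le> V x"
    using LV by (auto simp: assm_LV_def)
  have H0: "0 \<le> ?H" using op_norm_hess_le[OF Hb, of 0] op_norm_nonneg[of "hess V 0"] by linarith
  have \<kappa>0: "0 \<le> \<kappa>" using \<kappa>[of 0] op_norm_nonneg[of "\<sigma> 0"] by linarith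
  have V0: "0 \<le> V x" for x using Vpos[of x] CV by linarith
  obtain K where K: "0 \<le> K"
    "\<And>s. 0 \<le> s \<Longrightarrow> s \<le> 1 \<Longrightarrow> (\<integral>\<^sup>+u. ennreal (exp (s * ((norm u)\<^sup>2 / 4))) \<partial>\<mu>) \<le> ennreal (exp (s * K))"
    using nn_integral_exp_square_scale by metis
  define T where "T = ?d\<^sup>2 * ?r * \<kappa>\<^sup>2 * ?H"
  have T0: "0 \<le> T" using H0 by (simp add: T_def)
  \<comment> \<open>The first entry keeps the cost of the linear noise below a quarter of the drift,
    the second gives s <= 1 below; both denominators carry + 1 to stay positive.\<close>
  define l1 where "l1 = min (\<alpha> / (4 * (\<kappa>\<^sup>2 * CV + 1))) (1 / (8 * ?H * gm * \<kappa>\<^sup>2 + 1))"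
  have den: "0 < \<kappa>\<^sup>2 * CV + 1" "0 < 8 * ?H * gm * \<kappa>\<^sup>2 + 1"
    using CV H0 gm by (auto intro!: add_nonneg_pos mult_nonneg_nonneg)
  have l1: "0 < l1" "l1 \<le> \<alpha> / (4 * (\<kappa>\<^sup>2 * CV + 1))" "l1 \<le> 1 / (8 * ?H * gm * \<kappa>\<^sup>2 + 1)"
    using CV den by (auto simp: l1_def)
  define C where "C = l1 * (\<beta> + T + 4 * ?H * \<kappa>\<^sup>2 * K)"
  have C0: "0 \<le> C" using l1 CV T0 H0 K by (simp add: C_def)
  have "(\<integral>\<^sup>+u. ennreal (exp (l * V (x + g *\<^sub>R b x + sqrt g *\<^sub>R (\<sigma> x *v u)))) \<partial>\<mu>)
      \<le> ennreal (exp (l * V x * (1 - g * \<alpha> / 4) + C * g))"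
    if l: "0 < l" "l \<le> l1" and g: "0 \<le> g" "g \<le> gm" for l g x
  proof -
    have l\<alpha>: "l * (\<kappa>\<^sup>2 * CV) \<le> \<alpha> / 4"
    proof -
      have "l * (4 * (\<kappa>\<^sup>2 * CV + 1)) \<le> \<alpha>"
        using order_trans[OF l(2) l1(2)] den by (simp add: pos_le_divide_eq)
      then show ?thesis using l(1) by (simp add: algebra_simps)
    qed
    have lg: "l * (8 * ?H * gm * \<kappa>\<^sup>2) \<le> 1"
    proof -
      have "l * (8 * ?H * gm * \<kappa>\<^sup>2 + 1) \<le> 1"
        using order_trans[OF l(2) l1(3)] den by (simp add: pos_le_divide_eq)
      then show ?thesis using l(1) by (simp add: algebra_simps)
    qed
    \<comment> \<open>Half of s / 4, the share left by the Hoelder weight, is the coefficient of the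
      squared norm of u in the bound for l V.\<close>
    define s where "s = 8 * l * ?H * g * \<kappa>\<^sup>2"
    have s: "0 \<le> s" "s \<le> 1"
    proof -
      show "0 \<le> s" using l g H0 by (simp add: s_def)
      have "l * (8 * ?H * g * \<kappa>\<^sup>2) \<le> l * (8 * ?H * gm * \<kappa>\<^sup>2)"
        using l g H0 by (intro mult_left_mono mult_right_mono) auto
      with lg show "s \<le> 1" by (simp add: s_def mult_ac)
    qed
    \<comment> \<open>The factor 2 undoes the Hoelder weight 1/2.\<close>
    let ?A = "\<lambda>u. 2 * l * (sqrt g * ((\<sigma> x *v u) \<bullet> grad V x))"
    let ?L = "2 * l * (sqrt g * (\<kappa> * norm (grad V x)))"
    have lip: "?L-lipschitz_on UNIV ?A"
    proof (rule lipschitz_onI_real)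
      show "0 \<le> ?L" using l g \<kappa>0 by simp
      fix u v
      have "\<bar>(\<sigma> x *v (u - v)) \<bullet> grad V x\<bar> \<le> norm (\<sigma> x *v (u - v)) * norm (grad V x)"
        by (rule Cauchy_Schwarz_ineq2)
      also have "\<dots> \<le> (\<kappa> * norm (u - v)) * norm (grad V x)"
        by (intro mult_right_mono order_trans[OF norm_matrix_vector_le] \<kappa>) auto
      finally have "2 * l * (sqrt g * \<bar>(\<sigma> x *v (u - v)) \<bullet> grad V x\<bar>) \<le> 2 * l * (sqrt g * ((\<kappa> * norm (u - v)) * norm (grad V x)))"
        using l g by (intro mult_left_mono) auto
      moreover have "\<bar>?A u - ?A v\<bar> = 2 * l * (sqrt g * \<bar>(\<sigma> x *v (u - v)) \<bullet> grad V x\<bar>)"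
        using l g by (simp add: matrix_vector_mult_diff_distrib inner_diff_left right_diff_distrib[symmetric] abs_mult)
      ultimately show "\<bar>?A u - ?A v\<bar> \<le> ?L * norm (u - v)" by (simp add: mult_ac)
    qed
    have mean0: "(\<integral>u. ?A u \<partial>\<mu>) = 0"
    proof -
      have "has_bochner_integral \<mu> (\<lambda>u. \<Sum>i\<in>UNIV. (\<sigma> x *v u) $ i * grad V x $ i) (\<Sum>i\<in>UNIV. 0 * grad V x $ i)"
        by (intro has_bochner_integral_sum has_bochner_integral_mult_left integral_linear1)
      then have "(\<integral>u. (\<sigma> x *v u) \<bullet> grad V x \<partial>\<mu>) = 0"
        by (simp add: inner_vec_def has_bochner_integral_iff)
      then show ?thesis by simp
    qed
    define p where "p = 2 * l\<^sup>2 * g * \<kappa>\<^sup>2 * (norm (grad V x))\<^sup>2"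
    have expA: "(\<integral>\<^sup>+u. ennreal (exp (?A u)) \<partial>\<mu>) \<le> ennreal (exp p)"
    proof -
      have "?L\<^sup>2 / 2 = p" using g by (simp add: p_def power_mult_distrib real_sqrt_pow2)
      with nn_integral_exp_lipschitz[OF lip] mean0 show ?thesis by (simp only: diff_0_right)
    qed
    have combined: "(\<integral>\<^sup>+u. ennreal (exp (1/2 * ?A u + (1 - 1/2) * (s * ((norm u)\<^sup>2 / 4)))) \<partial>\<mu>)
        \<le> ennreal (exp (1/2 * p + (1 - 1/2) * (s * K)))"
      by (intro nn_integral_exp_hoelder expA K(2) s lipschitz_measurable[OF lip] measurable_mu) auto
    let ?c = "l * (V x * (1 - g * \<alpha> / 2) + g * (\<beta> + T))"
    have upper: "l * V (x + g *\<^sub>R b x + sqrt g *\<^sub>R (\<sigma> x *v u))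
        \<le> (1/2 * ?A u + (1 - 1/2) * (s * ((norm u)\<^sup>2 / 4))) + ?c" for u
    proof -
      let ?h = "g *\<^sub>R b x + sqrt g *\<^sub>R (\<sigma> x *v u)"
      have "(norm ?h)\<^sup>2 \<le> (norm (g *\<^sub>R b x) + norm (sqrt g *\<^sub>R (\<sigma> x *v u)))\<^sup>2"
        by (intro power_mono norm_triangle_ineq) auto
      also have "\<dots> \<le> 2 * (norm (g *\<^sub>R b x))\<^sup>2 + 2 * (norm (sqrt g *\<^sub>R (\<sigma> x *v u)))\<^sup>2"
        using sum_squares_bound[of "norm (g *\<^sub>R b x)" "norm (sqrt g *\<^sub>R (\<sigma> x *v u))"]
        by (simp add: power2_sum)
      also have "\<dots> = 2 * (g\<^sup>2 * (norm (b x))\<^sup>2) + 2 * (g * (norm (\<sigma> x *v u))\<^sup>2)"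
        using g by (simp add: power_mult_distrib)
      also have "\<dots> \<le> 2 * (g\<^sup>2 * (CV * V x)) + 2 * (g * (\<kappa> * norm u)\<^sup>2)"
      proof (intro add_mono mult_left_mono power_mono)
        show "(norm (b x))\<^sup>2 \<le> CV * V x" using growth[of x] zero_le_power2[of "norm (grad V x)"] by linarith
        show "norm (\<sigma> x *v u) \<le> \<kappa> * norm u"
          by (rule order_trans[OF norm_matrix_vector_le mult_right_mono[OF \<kappa>]]) simp
      qed (use g in auto)
      finally have "?H / 2 * (norm ?h)\<^sup>2 \<le> ?H / 2 * (2 * (g\<^sup>2 * (CV * V x)) + 2 * (g * (\<kappa> * norm u)\<^sup>2))"
        using H0 by (intro mult_left_mono) auto
      also have "\<dots> = g * ((g * (CV * ?H)) * V x) + ?H * g * \<kappa>\<^sup>2 * (norm u)\<^sup>2"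
        by (simp add: power2_eq_square algebra_simps)
      also have "\<dots> \<le> g * (\<alpha> / 2 * V x) + ?H * g * \<kappa>\<^sup>2 * (norm u)\<^sup>2"
      proof -
        have "g * (CV * ?H) \<le> gm * (CV * ?H)" using g CV H0 by (intro mult_right_mono) auto
        then have "g * (CV * ?H) * V x \<le> \<alpha> / 2 * V x" using gm V0 by (intro mult_right_mono) auto
        from mult_left_mono[OF this g(1)] show ?thesis by simp
      qed
      finally have quad: "?H / 2 * (norm ?h)\<^sup>2 \<le> g * (\<alpha> / 2 * V x) + ?H * g * \<kappa>\<^sup>2 * (norm u)\<^sup>2" .
      have tr: "b x \<bullet> grad V x \<le> - \<alpha> * V x + \<beta> + T"
      proof -
        let ?S = "\<Sum>i\<in>UNIV. \<Sum>j\<in>UNIV. (\<sigma> x ** transpose (\<sigma> x)) $ i $ j * pdiffs [j, i] V x"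
        have "\<bar>?S\<bar> \<le> (\<Sum>i\<in>UNIV. \<Sum>j\<in>UNIV. \<bar>(\<sigma> x ** transpose (\<sigma> x)) $ i $ j * pdiffs [j, i] V x\<bar>)"
          by (intro order_trans[OF sum_abs] sum_mono sum_abs)
        also have "\<dots> \<le> (\<Sum>i\<in>(UNIV::'d set). \<Sum>j\<in>(UNIV::'d set). (?r * \<kappa>\<^sup>2) * ?H)"
          unfolding abs_mult
        proof (intro sum_mono mult_mono abs_mult_transpose_nth_le \<kappa>)
          fix i j
          show "\<bar>pdiffs [j, i] V x\<bar> \<le> ?H"
            using order_trans[OF matrix_component_le_onorm op_norm_hess_le[OF Hb], of x j i] by (simp add: hess_def)
        qed auto
        also have "\<dots> = T" by (simp add: T_def power2_eq_square)
        finally have "\<bar>?S\<bar> \<le> T" .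
        moreover have "generator b \<sigma> V x = b x \<bullet> grad V x + 1/2 * ?S"
          by (simp add: generator_eq_sum inner_vec_def grad_def pdiffs_def)
        ultimately show ?thesis using drift[of x] T0 by linarith
      qed
      have "V (x + ?h) \<le> V x + ?h \<bullet> grad V x + ?H / 2 * (norm ?h)\<^sup>2"
        by (rule C_2_upper_bound[OF V2 Hb])
      also have "\<dots> \<le> V x + (g * (- \<alpha> * V x + \<beta> + T) + sqrt g * ((\<sigma> x *v u) \<bullet> grad V x))
          + (g * (\<alpha> / 2 * V x) + ?H * g * \<kappa>\<^sup>2 * (norm u)\<^sup>2)"
        using mult_left_mono[OF tr g(1)] quad by (simp add: inner_add_left)
      finally have "l * V (x + ?h) \<le> l * (V x + (g * (- \<alpha> * V x + \<beta> + T) + sqrt g * ((\<sigma> x *v u) \<bullet> grad V x))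
          + (g * (\<alpha> / 2 * V x) + ?H * g * \<kappa>\<^sup>2 * (norm u)\<^sup>2))"
        using l by (intro mult_left_mono) auto
      also have "\<dots> = (1/2 * ?A u + (1 - 1/2) * (s * ((norm u)\<^sup>2 / 4))) + ?c"
        by (simp add: s_def field_simps)
      finally show ?thesis by (simp add: add.assoc)
    qed
    have meas: "(\<lambda>u. 1/2 * ?A u + (1 - 1/2) * (s * ((norm u)\<^sup>2 / 4))) \<in> borel_measurable \<mu>"
      by (intro borel_measurable_add borel_measurable_times lipschitz_measurable[OF lip] measurable_mu) auto
    have "(\<integral>\<^sup>+u. ennreal (exp (l * V (x + g *\<^sub>R b x + sqrt g *\<^sub>R (\<sigma> x *v u)))) \<partial>\<mu>)
        \<le> (\<integral>\<^sup>+u. ennreal (exp ((1/2 * ?A u + (1 - 1/2) * (s * ((norm u)\<^sup>2 / 4))) + ?c)) \<partial>\<mu>)"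
      using upper by (intro nn_integral_mono ennreal_leI) simp
    also have "\<dots> \<le> ennreal (exp ?c) * ennreal (exp (1/2 * p + (1 - 1/2) * (s * K)))"
      unfolding nn_integral_exp_add_const[OF meas] by (intro mult_left_mono combined) simp
    also have "\<dots> = ennreal (exp (?c + (p / 2 + s * K / 2)))"
      by (simp add: ennreal_mult[symmetric] exp_add)
    also have "\<dots> \<le> ennreal (exp (l * V x * (1 - g * \<alpha> / 4) + C * g))"
    proof -
      have "p / 2 = l * g * ((l * \<kappa>\<^sup>2) * (norm (grad V x))\<^sup>2)"
        by (simp add: p_def power2_eq_square)
      also have "\<dots> \<le> l * g * ((l * \<kappa>\<^sup>2) * (CV * V x))"
        using l g growth[of x] zero_le_power2[of "norm (b x)"] by (intro mult_left_mono) (auto intro: order_trans[rotated])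
      also have "\<dots> = l * g * (l * (\<kappa>\<^sup>2 * CV) * V x)" by (simp add: mult_ac)
      also have "\<dots> \<le> l * g * (\<alpha> / 4 * V x)"
        using l g V0 l\<alpha> by (intro mult_left_mono mult_right_mono) auto
      finally have "p / 2 \<le> l * g * (\<alpha> / 4 * V x)" .
      moreover have "l * (g * (\<beta> + T)) + s * K / 2 \<le> C * g"
      proof -
        have "l * (g * (\<beta> + T)) + s * K / 2 = l * (g * (\<beta> + T + 4 * ?H * \<kappa>\<^sup>2 * K))"
          by (simp add: s_def algebra_simps)
        also have "\<dots> \<le> l1 * (g * (\<beta> + T + 4 * ?H * \<kappa>\<^sup>2 * K))"
          using l g CV T0 H0 K by (intro mult_right_mono) auto
        finally show ?thesis by (simp add: C_def mult_ac)
      qed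
      moreover have "?c = l * V x * (1 - g * \<alpha> / 4) - l * g * (\<alpha> / 4 * V x) + l * (g * (\<beta> + T))"
        by (simp add: field_simps)
      ultimately show ?thesis by (intro ennreal_leI) simp
    qed
    finally show ?thesis .
  qed
  with that[OF l1(1) C0] show ?thesis by blast
qed

end

context euler_scheme
begin

text \<open>After weakening the contraction to 1 - s, the one-step exponent is a convex combination
  of l V(X n) and the constant B, so Hoelder reproduces the bound exp B with no loss over
  time.\<close>

lemma lyapunov_moments:
  assumes LV: "assm_LV b \<sigma> V vs CV \<alpha> \<beta>" and \<kappa>: "\<And>x. op_norm (\<sigma> x) \<le> \<kappa>"
    and \<gamma>: "\<And>k. 1 \<le> k \<Longrightarrow> 0 < \<gamma> k" "\<And>k. 1 \<le> k \<Longrightarrow> \<gamma> k \<le> gm"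
    and gm: "gm * (CV * hess_sup V) \<le> \<alpha> / 2" and C1: "assm_C1 M X0"
  obtains l B where "0 < l" "0 \<le> B" "\<And>n. (\<integral>\<^sup>+\<omega>. ennreal (exp (l * V (X n \<omega>))) \<partial>M) \<le> ennreal (exp B)"
proof -
  have gm0: "0 < gm" using \<gamma>[of 1] by simp
  have CV: "0 < CV" "0 < \<alpha>" "0 < vs" and V2: "C_k 2 V" and Hb: "bdd_above (range (\<lambda>x. op_norm (hess V x)))"
    and Vpos: "\<And>x. vs \<le> V x"
    using LV by (auto simp: assm_LV_def)
  have V0: "0 \<le> V x" for x using Vpos[of x] CV by linarith
  have H0: "0 \<le> hess_sup V" using op_norm_hess_le[OF Hb, of 0] op_norm_nonneg[of "hess V 0"] by linarith
  have Vm: "V \<in> borel_measurable borel"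
    by (intro borel_measurable_continuous_onI C_k_continuous[OF V2])
  obtain l1 C where l1: "0 < l1" "0 \<le> C"
    "\<And>l g x. 0 < l \<Longrightarrow> l \<le> l1 \<Longrightarrow> 0 \<le> g \<Longrightarrow> g \<le> gm \<Longrightarrow>
      (\<integral>\<^sup>+u. ennreal (exp (l * V (x + g *\<^sub>R b x + sqrt g *\<^sub>R (\<sigma> x *v u)))) \<partial>innovation)
      \<le> ennreal (exp (l * V x * (1 - g * \<alpha> / 4) + C * g))"
    by (rule innovation.lyapunov_drift[OF LV \<kappa> gm0 gm]) (rule that)
  \<comment> \<open>The second-order bound at 0 makes V grow at most quadratically, so (C1) yields
    the initial moment as soon as l A < l0.\<close>
  define A where "A = V 0 + norm (grad V 0) + hess_sup V / 2 + 1"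
  have A0: "0 < A" using V0[of 0] H0 norm_ge_zero[of "grad V 0"] unfolding A_def by linarith
  have V_le: "V x \<le> A * (1 + (norm x)\<^sup>2)" for x
  proof -
    have "V (0 + x) \<le> V 0 + x \<bullet> grad V 0 + hess_sup V / 2 * (norm x)\<^sup>2"
      by (rule C_2_upper_bound[OF V2 Hb])
    moreover have "x \<bullet> grad V 0 \<le> (1 + (norm x)\<^sup>2) * norm (grad V 0)"
    proof -
      have "2 * norm x \<le> 1 + (norm x)\<^sup>2"
        using sum_squares_bound[of 1 "norm x"] by simp
      then have "norm x \<le> 1 + (norm x)\<^sup>2" using norm_ge_zero[of x] by linarith
      then show ?thesis
        by (intro order_trans[OF norm_cauchy_schwarz] mult_right_mono) auto
    qed
    moreover have "0 \<le> V 0 * (norm x)\<^sup>2" using V0[of 0] by simp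
    ultimately show ?thesis
      using H0 less_le_trans[of "- 1" 0 "(norm x)\<^sup>2"] by (simp add: A_def algebra_simps)
  qed
  obtain l0 where l0: "0 < l0" "\<And>l. l < l0 \<Longrightarrow> integrable M (\<lambda>\<omega>. exp (l * (norm (X0 \<omega>))\<^sup>2))"
    using C1 by (auto simp: assm_C1_def)
  define l where "l = min l1 (l0 / (2 * A))"
  have l: "0 < l" "l \<le> l1" "l * A < l0"
  proof -
    show "0 < l" "l \<le> l1" using l1 l0 A0 by (auto simp: l_def)
    have "l * A \<le> l0 / (2 * A) * A" using A0 by (intro mult_right_mono) (auto simp: l_def)
    also have "\<dots> = l0 / 2" using A0 by simp
    finally show "l * A < l0" using l0(1) by linarith
  qed
  obtain B0 where B0: "(\<integral>\<^sup>+\<omega>. ennreal (exp (l * V (X 0 \<omega>))) \<partial>M) \<le> ennreal (exp B0)"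
  proof -
    let ?I = "\<integral>\<omega>. exp (l * A * (norm (X0 \<omega>))\<^sup>2) \<partial>M"
    have "(\<integral>\<^sup>+\<omega>. ennreal (exp (l * V (X 0 \<omega>))) \<partial>M)
        \<le> (\<integral>\<^sup>+\<omega>. ennreal (exp (l * A * (norm (X0 \<omega>))\<^sup>2 + l * A)) \<partial>M)"
      using mult_left_mono[OF V_le, of l] l(1)
      by (intro nn_integral_mono ennreal_leI) (simp add: algebra_simps)
    also have "\<dots> = ennreal (exp (l * A)) * ennreal ?I"
      using X0_measurable nn_integral_eq_integral[OF l0(2)[OF l(3)]]
      by (subst nn_integral_exp_add_const) auto
    also have "\<dots> \<le> ennreal (exp (l * A + ln (max 1 ?I)))"
      unfolding exp_add by (subst ennreal_mult[symmetric]) (auto intro!: ennreal_leI mult_left_mono)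
    finally show ?thesis using that by blast
  qed
  \<comment> \<open>The contraction rate \<alpha> / 4, lowered if necessary so that \<delta> times
    any step is an admissible convex weight.\<close>
  define \<delta> where "\<delta> = min (\<alpha> / 4) (1 / gm)"
  have \<delta>: "0 < \<delta>" "\<delta> \<le> \<alpha> / 4" "\<delta> * gm \<le> 1"
  proof -
    show "0 < \<delta>" "\<delta> \<le> \<alpha> / 4" using CV gm0 by (auto simp: \<delta>_def)
    have "\<delta> * gm \<le> 1 / gm * gm" using gm0 by (intro mult_right_mono) (auto simp: \<delta>_def)
    then show "\<delta> * gm \<le> 1" using gm0 by simp
  qed
  \<comment> \<open>\<open>B0\<close> covers the start, and C <= \<delta> B lets the additive term
    of each step be absorbed by the weight of B.\<close>
  define B where "B = max (max B0 (C / \<delta>)) 0"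
  have "(\<integral>\<^sup>+\<omega>. ennreal (exp (l * V (X n \<omega>))) \<partial>M) \<le> ennreal (exp B)" for n
  proof (induction n)
    case 0
    have "ennreal (exp B0) \<le> ennreal (exp B)" by (intro ennreal_leI) (simp add: B_def)
    with B0 show ?case by (rule order_trans)
  next
    case (Suc n)
    let ?s = "\<delta> * \<gamma> (Suc n)"
    have g: "0 \<le> \<gamma> (Suc n)" "\<gamma> (Suc n) \<le> gm" using \<gamma>[of "Suc n"] by auto
    have s: "0 \<le> ?s" "?s \<le> 1"
      using \<delta> g order_trans[OF mult_left_mono[OF g(2)] \<delta>(3)] by auto
    have f: "(\<lambda>(x, u). ennreal (exp (l * V (step n x u)))) \<in> borel_measurable (borel \<Otimes>\<^sub>M borel)"
    proof -
      have "(\<lambda>z. V (case z of (x, u) \<Rightarrow> step n x u)) \<in> borel_measurable (borel \<Otimes>\<^sub>M borel)"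
        by (rule measurable_compose[OF step_measurable Vm])
      then show ?thesis by (simp add: case_prod_beta)
    qed
    have "(\<integral>\<^sup>+\<omega>. ennreal (exp (l * V (X (Suc n) \<omega>))) \<partial>M)
        = (\<integral>\<^sup>+\<omega>. (\<integral>\<^sup>+u. ennreal (exp (l * V (step n (X n \<omega>) u))) \<partial>innovation) \<partial>M)"
      unfolding X_Suc using nn_integral_past_U[OF X_measurable_past f] by simp
    also have "\<dots> \<le> (\<integral>\<^sup>+\<omega>. ennreal (exp ((1 - ?s) * (l * V (X n \<omega>)) + (1 - (1 - ?s)) * B)) \<partial>M)"
    proof (intro nn_integral_mono)
      fix \<omega>
      let ?x = "X n \<omega>"
      have "(\<integral>\<^sup>+u. ennreal (exp (l * V (step n ?x u))) \<partial>innovation)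
          \<le> ennreal (exp (l * V ?x * (1 - \<gamma> (Suc n) * \<alpha> / 4) + C * \<gamma> (Suc n)))"
        unfolding step_def by (rule l1(3)[OF l(1,2) g])
      also have "\<dots> \<le> ennreal (exp ((1 - ?s) * (l * V ?x) + (1 - (1 - ?s)) * B))"
      proof -
        have "?s \<le> \<gamma> (Suc n) * \<alpha> / 4" using mult_right_mono[OF \<delta>(2) g(1)] by (simp add: mult_ac)
        then have "l * V ?x * (1 - \<gamma> (Suc n) * \<alpha> / 4) \<le> l * V ?x * (1 - ?s)"
          using l V0 by (intro mult_left_mono) auto
        moreover have "C \<le> \<delta> * B"
          using \<delta>(1) mult_left_mono[of "C / \<delta>" B \<delta>] by (simp add: B_def)
        then have "C * \<gamma> (Suc n) \<le> ?s * B"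
          using mult_right_mono[OF _ g(1), of C "\<delta> * B"] by (simp add: mult_ac)
        ultimately show ?thesis by (intro ennreal_leI) (simp add: mult_ac)
      qed
      finally show "(\<integral>\<^sup>+u. ennreal (exp (l * V (step n ?x u))) \<partial>innovation)
          \<le> ennreal (exp ((1 - ?s) * (l * V ?x) + (1 - (1 - ?s)) * B))" .
    qed
    also have "\<dots> \<le> ennreal (exp ((1 - ?s) * B + (1 - (1 - ?s)) * B))"
      using s Suc measurable_compose[OF X_measurable Vm]
      by (intro nn_integral_exp_hoelder) (auto simp: emeasure_space_1)
    also have "(1 - ?s) * B + (1 - (1 - ?s)) * B = B" by (simp add: algebra_simps)
    finally show ?case .
  qed
  moreover have "0 \<le> B" by (simp add: B_def)
  ultimately show ?thesis using that l(1) by blast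
qed

end

section \<open>Splitting the weighted sums\<close>

text \<open>From here on the Lyapunov condition acts only through the growth bounds and the uniform
  moment \<open>moments\<close>, and \<beta> is the Hoelder exponent; in the two drift lemmas above
  it was the additive constant of \<open>assm_LV\<close>.\<close>

locale lyapunov_scheme = euler_scheme M X0 U b \<sigma> \<gamma>
  for M :: "'s measure" and X0 :: "'s \<Rightarrow> real^'d" and U :: "nat \<Rightarrow> 's \<Rightarrow> real^'r"
    and b :: "real^'d \<Rightarrow> real^'d" and \<sigma> :: "real^'d \<Rightarrow> real^'r^'d" and \<gamma> :: "nat \<Rightarrow> real" +
  fixes V :: "real^'d \<Rightarrow> real" and vs CV \<kappa> \<beta> l B :: real
  assumes V_measurable: "V \<in> borel_measurable borel"
    and vs_pos: "0 < vs" and V_ge: "vs \<le> V x"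
    and CV_pos: "0 < CV" and b_bound: "(norm (b x))\<^sup>2 \<le> CV * V x"
    and \<sigma>_bound: "op_norm (\<sigma> x) \<le> \<kappa>"
    and \<gamma>_pos: "1 \<le> k \<Longrightarrow> 0 < \<gamma> k"
    and \<beta>: "0 < \<beta>" "\<beta> \<le> 1"
    and l_pos: "0 < l" and B_nonneg: "0 \<le> B"
    and moments: "(\<integral>\<^sup>+\<omega>. ennreal (exp (l * V (X n \<omega>))) \<partial>M) \<le> ennreal (exp B)"
begin

section \<open>Martingale increments, remainders and boundary terms\<close>

lemma V_nonneg: "0 \<le> V x"
  using V_ge[of x] vs_pos by linarith

lemma V_X_measurable: "(\<lambda>\<omega>. V (X n \<omega>)) \<in> borel_measurable M"
  by (rule measurable_compose[OF X_measurable V_measurable])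

definition transition :: "(real^'d \<Rightarrow> real) \<Rightarrow> nat \<Rightarrow> real^'d \<Rightarrow> real" where
  "transition f k x = (\<integral>u. f (step k x u) \<partial>innovation)"

definition increment :: "(real^'d \<Rightarrow> real) \<Rightarrow> nat \<Rightarrow> real^'d \<Rightarrow> real^'r \<Rightarrow> real" where
  "increment f k x u = f (step k x u) - transition f k x"

definition remainder :: "(real^'d \<Rightarrow> real) \<Rightarrow> nat \<Rightarrow> real^'d \<Rightarrow> real" where
  "remainder f k x = transition f k x - f x - \<gamma> (Suc k) * generator b \<sigma> f x"

definition weighted_sum :: "(real^'d \<Rightarrow> real) \<Rightarrow> nat \<Rightarrow> 's \<Rightarrow> real" where
  "weighted_sum g n \<omega> = (\<Sum>k<n. \<gamma> (Suc k) * g (X k \<omega>))"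

definition boundary :: "(real^'d \<Rightarrow> real) \<Rightarrow> nat \<Rightarrow> 's \<Rightarrow> real" where
  "boundary f n \<omega> = f (X n \<omega>) - f (X 0 \<omega>) - (\<Sum>k<n. remainder f k (X k \<omega>))"

lemma weighted_sum_generator:
  "weighted_sum (generator b \<sigma> f) n \<omega> = boundary f n \<omega> - functional (increment f) n \<omega>"
proof (induction n)
  case (Suc n)
  have "weighted_sum (generator b \<sigma> f) (Suc n) \<omega>
      = weighted_sum (generator b \<sigma> f) n \<omega> + \<gamma> (Suc n) * generator b \<sigma> f (X n \<omega>)"
    by (simp add: weighted_sum_def)
  moreover have "boundary f (Suc n) \<omega> = boundary f n \<omega> + f (X (Suc n) \<omega>) - f (X n \<omega>) - remainder f n (X n \<omega>)"
    by (simp add: boundary_def)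
  moreover have "functional (increment f) (Suc n) \<omega>
      = functional (increment f) n \<omega> + (f (X (Suc n) \<omega>) - transition f n (X n \<omega>))"
    unfolding functional_def X_Suc increment_def by simp
  ultimately show ?case using Suc by (simp add: remainder_def)
qed (simp add: weighted_sum_def boundary_def functional_def)

lemma weighted_sum_measurable:
  assumes "g \<in> borel_measurable borel"
  shows "weighted_sum g n \<in> borel_measurable M"
  unfolding weighted_sum_def[abs_def]
  by (intro borel_measurable_sum borel_measurable_times borel_measurable_const measurable_compose[OF X_measurable assms])

lemma test_functionD:
  assumes "test_function \<beta> V f"
  shows "C_k_holder 3 \<beta> f" "C_k 3 f" "continuous_on UNIV f" "f \<in> borel_measurable borel"
    "generator b \<sigma> f \<in> borel_measurable borel"
proof -
  show 1: "C_k_holder 3 \<beta> f" using assms by (simp add: test_function_def)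
  then show 2: "C_k 3 f" by (simp add: C_k_holder_def)
  show 3: "continuous_on UNIV f" by (rule C_k_continuous[OF 2])
  then show "f \<in> borel_measurable borel" by (rule borel_measurable_continuous_onI)
  show "generator b \<sigma> f \<in> borel_measurable borel"
    by (intro borel_measurable_continuous_onI continuous_on_generator[OF 2] b_continuous \<sigma>_continuous) simp
qed

lemma increment_measurable:
  assumes "test_function \<beta> V f"
  shows "(\<lambda>(x, u). increment f k x u) \<in> borel_measurable (borel \<Otimes>\<^sub>M borel)"
proof -
  have f: "(\<lambda>z. f (case z of (x, u) \<Rightarrow> step k x u)) \<in> borel_measurable (borel \<Otimes>\<^sub>M borel)"
    by (rule measurable_compose[OF step_measurable test_functionD(4)[OF assms]])
  then have f': "(\<lambda>(x, u). f (step k x u)) \<in> borel_measurable (borel \<Otimes>\<^sub>M innovation)"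
    by (simp only: measurable_cong_sets[OF sets_pair_measure_cong[OF refl innovation.sets_mu] refl] case_prod_unfold)
  have "transition f k \<in> borel_measurable borel"
    unfolding transition_def[abs_def] by (rule innovation.borel_measurable_lebesgue_integral[OF f'])
  then have "(\<lambda>z. transition f k (fst z)) \<in> borel_measurable (borel \<Otimes>\<^sub>M borel)"
    by (rule measurable_compose[OF measurable_fst])
  with f show ?thesis
    unfolding increment_def case_prod_beta by (intro borel_measurable_diff)
qed

text \<open>The constant keeps the local operator norm of \<sigma>(x) instead of \<kappa>; otherwise
  the rate would contain the supremum of its square and not the mean.\<close>

lemma step_lipschitz:
  assumes "test_function \<beta> V f"
  shows "(grad_sup f * (sqrt (\<gamma> (Suc k)) * op_norm (\<sigma> x)))-lipschitz_on UNIV (\<lambda>u. f (step k x u))"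
proof (rule lipschitz_onI_real)
  note f = test_functionD(1)[OF assms]
  have L: "0 \<le> grad_sup f" by (rule grad_sup_nonneg[OF f]) simp
  have g: "0 < \<gamma> (Suc k)" by (rule \<gamma>_pos) simp
  then show "0 \<le> grad_sup f * (sqrt (\<gamma> (Suc k)) * op_norm (\<sigma> x))"
    using L op_norm_nonneg[of "\<sigma> x"] by simp
  fix u v
  have "\<bar>f (step k x u) - f (step k x v)\<bar> \<le> grad_sup f * norm (step k x u - step k x v)"
    by (rule grad_sup_lipschitz[OF f]) simp
  also have "step k x u - step k x v = sqrt (\<gamma> (Suc k)) *\<^sub>R (\<sigma> x *v (u - v))"
    by (simp add: step_def matrix_vector_mult_diff_distrib scaleR_diff_right)
  also have "norm \<dots> = sqrt (\<gamma> (Suc k)) * norm (\<sigma> x *v (u - v))"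
    using g by simp
  also have "\<dots> \<le> sqrt (\<gamma> (Suc k)) * (op_norm (\<sigma> x) * norm (u - v))"
    using g by (intro mult_left_mono norm_matrix_vector_le) auto
  finally show "\<bar>f (step k x u) - f (step k x v)\<bar> \<le> grad_sup f * (sqrt (\<gamma> (Suc k)) * op_norm (\<sigma> x)) * norm (u - v)"
    using L by (simp add: mult.assoc mult_left_mono)
qed

lemma nn_integral_exp_increment:
  assumes "test_function \<beta> V f"
  shows "(\<integral>\<^sup>+u. ennreal (exp (c * increment f k x u)) \<partial>innovation)
    \<le> ennreal (exp (c\<^sup>2 * (grad_sup f)\<^sup>2 / 2 * \<gamma> (Suc k) * (op_norm (\<sigma> x))\<^sup>2))"
proof -
  let ?K = "grad_sup f * (sqrt (\<gamma> (Suc k)) * op_norm (\<sigma> x))"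
  have g: "0 \<le> \<gamma> (Suc k)" using \<gamma>_pos[of "Suc k"] by simp
  have "(\<bar>c\<bar> * ?K)-lipschitz_on UNIV (\<lambda>u. c * f (step k x u))"
    by (rule lipschitz_on_cmult_real[OF step_lipschitz[OF assms]])
  from innovation.nn_integral_exp_lipschitz[OF this]
  have "(\<integral>\<^sup>+u. ennreal (exp (c * increment f k x u)) \<partial>innovation) \<le> ennreal (exp ((\<bar>c\<bar> * ?K)\<^sup>2 / 2))"
    by (simp add: increment_def transition_def right_diff_distrib)
  also have "(\<bar>c\<bar> * ?K)\<^sup>2 / 2 = c\<^sup>2 * (grad_sup f)\<^sup>2 / 2 * \<gamma> (Suc k) * (op_norm (\<sigma> x))\<^sup>2"
    using g by (simp add: power_mult_distrib)
  finally show ?thesis .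
qed

text \<open>Subtracting a majorant of the bracket makes each one-step moment at most 1. S is chosen
  twice: from the Poisson equation for the main martingale, and as the constant
  \<open>\<kappa>\<^sup>2\<close> for the secondary one.\<close>

lemma nn_integral_exp_functional_increment:
  assumes f: "test_function \<beta> V f" and S: "S \<in> borel_measurable borel" "\<And>x. (op_norm (\<sigma> x))\<^sup>2 \<le> S x"
  shows "(\<integral>\<^sup>+\<omega>. ennreal (exp (c * functional (increment f) n \<omega> - c\<^sup>2 * (grad_sup f)\<^sup>2 / 2 * weighted_sum S n \<omega>)) \<partial>M) \<le> 1"
proof -
  let ?d = "\<lambda>k x. c\<^sup>2 * (grad_sup f)\<^sup>2 / 2 * \<gamma> (Suc k) * S x"
  let ?G = "\<lambda>k x u. c * increment f k x u - ?d k x"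
  have "(\<integral>\<^sup>+\<omega>. ennreal (exp (functional ?G n \<omega>)) \<partial>M) \<le> 1"
  proof (rule exp_supermartingale)
    fix k
    have "(\<lambda>z. S (fst z)) \<in> borel_measurable (borel \<Otimes>\<^sub>M borel)"
      by (rule measurable_compose[OF measurable_fst S(1)])
    with increment_measurable[OF f, of k]
    show "(\<lambda>(x, u). ?G k x u) \<in> borel_measurable (borel \<Otimes>\<^sub>M borel)"
      by (auto simp: case_prod_unfold intro!: borel_measurable_diff borel_measurable_times borel_measurable_divide)
    fix x
    have "(\<lambda>u. increment f k x u) \<in> borel_measurable borel"
      using measurable_compose[OF measurable_Pair1' increment_measurable[OF f, of k], of x] by simp
    moreover have "(\<integral>\<^sup>+u. ennreal (exp (c * increment f k x u)) \<partial>innovation) \<le> ennreal (exp (?d k x))"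
    proof (rule order_trans[OF nn_integral_exp_increment[OF f]])
      show "ennreal (exp (c\<^sup>2 * (grad_sup f)\<^sup>2 / 2 * \<gamma> (Suc k) * (op_norm (\<sigma> x))\<^sup>2)) \<le> ennreal (exp (?d k x))"
        using \<gamma>_pos[of "Suc k"] by (intro ennreal_leI iffD2[OF exp_le_cancel_iff] mult_left_mono S(2)) auto
    qed
    ultimately show "(\<integral>\<^sup>+u. ennreal (exp (?G k x u)) \<partial>innovation) \<le> 1"
      by (intro innovation.nn_integral_exp_diff_le_1 innovation.measurable_mu) auto
  qed
  moreover have "functional ?G n \<omega> = c * functional (increment f) n \<omega> - c\<^sup>2 * (grad_sup f)\<^sup>2 / 2 * weighted_sum S n \<omega>" for \<omega>
    by (simp add: functional_def weighted_sum_def sum_subtractf sum_distrib_left mult.assoc)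
  ultimately show ?thesis by simp
qed

lemma remainder_bound:
  assumes "test_function \<beta> V f"
  obtains C where "0 \<le> C" "\<And>k x. \<bar>remainder f k x\<bar> \<le> C * ((\<gamma> (Suc k))\<^sup>2 * V x + \<gamma> (Suc k) powr ((3 + \<beta>) / 2))"
proof -
  obtain C where C: "0 \<le> C"
    "\<And>x g. 0 \<le> g \<Longrightarrow> \<bar>(\<integral>u. f (x + g *\<^sub>R b x + sqrt g *\<^sub>R (\<sigma> x *v u)) \<partial>innovation) - f x - g * generator b \<sigma> f x\<bar>
     \<le> C * (g\<^sup>2 * ((norm (b x))\<^sup>2 + norm (b x)) + g powr ((3 + \<beta>) / 2))"
    by (rule innovation.one_step_remainder[OF test_functionD(1)[OF assms] \<beta> \<sigma>_bound]) (rule that)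
  \<comment> \<open>2 CV pays for twice the squared drift, 1 / vs turns the constant 1 into a
    multiple of V, and the last 1 gives \<open>1 \<le> ?D\<close>, so that it also covers the pure
    power of the step.\<close>
  let ?D = "2 * CV + 1 / vs + 1"
  have D: "1 \<le> ?D" using CV_pos vs_pos by simp
  have "\<bar>remainder f k x\<bar> \<le> (C * ?D) * ((\<gamma> (Suc k))\<^sup>2 * V x + \<gamma> (Suc k) powr ((3 + \<beta>) / 2))" for k x
  proof -
    let ?g = "\<gamma> (Suc k)"
    have "2 * norm (b x) \<le> 1 + (norm (b x))\<^sup>2"
      using sum_squares_bound[of 1 "norm (b x)"] by simp
    then have "norm (b x) \<le> 1 + (norm (b x))\<^sup>2" using norm_ge_zero[of "b x"] by linarith
    moreover have "1 \<le> 1 / vs * V x" using V_ge[of x] vs_pos by simp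
    ultimately have "(norm (b x))\<^sup>2 + norm (b x) \<le> 2 * (CV * V x) + 1 / vs * V x"
      using b_bound[of x] by linarith
    also have "\<dots> \<le> ?D * V x" using V_nonneg[of x] by (simp add: algebra_simps)
    finally have "?g\<^sup>2 * ((norm (b x))\<^sup>2 + norm (b x)) + ?g powr ((3 + \<beta>) / 2)
        \<le> ?g\<^sup>2 * (?D * V x) + ?D * ?g powr ((3 + \<beta>) / 2)"
      using mult_right_mono[OF D, of "?g powr ((3 + \<beta>) / 2)"]
      by (intro add_mono mult_left_mono) auto
    then have "C * (?g\<^sup>2 * ((norm (b x))\<^sup>2 + norm (b x)) + ?g powr ((3 + \<beta>) / 2))
        \<le> C * (?g\<^sup>2 * (?D * V x) + ?D * ?g powr ((3 + \<beta>) / 2))"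
      by (rule mult_left_mono[OF _ C(1)])
    also have "\<dots> = (C * ?D) * (?g\<^sup>2 * V x + ?g powr ((3 + \<beta>) / 2))"
      by (simp only: distrib_left distrib_right mult_ac)
    finally have "C * (?g\<^sup>2 * ((norm (b x))\<^sup>2 + norm (b x)) + ?g powr ((3 + \<beta>) / 2))
        \<le> (C * ?D) * (?g\<^sup>2 * V x + ?g powr ((3 + \<beta>) / 2))" .
    moreover have "\<bar>remainder f k x\<bar> \<le> C * (?g\<^sup>2 * ((norm (b x))\<^sup>2 + norm (b x)) + ?g powr ((3 + \<beta>) / 2))"
      unfolding remainder_def transition_def step_def using \<gamma>_pos[of "Suc k"] by (intro C(2)) simp
    ultimately show ?thesis by linarith
  qed
  moreover have "0 \<le> C * ?D" using C(1) D by (intro mult_nonneg_nonneg) auto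
  ultimately show ?thesis using that by blast
qed

definition error_sum :: "nat \<Rightarrow> real" where
  "error_sum n = (\<Sum>k<n. \<gamma> (Suc k) powr ((3 + \<beta>) / 2))"

text \<open>One majorant for the boundary terms of all test functions, so that those of f and of the
  Poisson solution can be merged before a moment is taken. The 2 collects the 1 in 1 + sqrt V from
  both end points.\<close>

definition boundary_size :: "nat \<Rightarrow> 's \<Rightarrow> real" where
  "boundary_size n \<omega> = 2 + sqrt (V (X n \<omega>)) + sqrt (V (X 0 \<omega>)) + error_sum n + (\<Sum>k<n. (\<gamma> (Suc k))\<^sup>2 * V (X k \<omega>))"

lemma boundary_bound:
  assumes "test_function \<beta> V f"
  obtains C where "0 \<le> C" "\<And>n \<omega>. \<bar>boundary f n \<omega>\<bar> \<le> C * boundary_size n \<omega>"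
proof -
  obtain C1 where C1: "0 \<le> C1"
    "\<And>k x. \<bar>remainder f k x\<bar> \<le> C1 * ((\<gamma> (Suc k))\<^sup>2 * V x + \<gamma> (Suc k) powr ((3 + \<beta>) / 2))"
    using remainder_bound[OF assms] by metis
  obtain C2 where C2: "0 < C2" "\<And>x. \<bar>f x\<bar> \<le> C2 * (1 + sqrt (V x))"
    using assms by (auto simp: test_function_def)
  have "\<bar>boundary f n \<omega>\<bar> \<le> (C1 + C2) * boundary_size n \<omega>" for n \<omega>
  proof -
    let ?r = "error_sum n + (\<Sum>k<n. (\<gamma> (Suc k))\<^sup>2 * V (X k \<omega>))"
    let ?s = "2 + sqrt (V (X n \<omega>)) + sqrt (V (X 0 \<omega>))"
    have "\<bar>\<Sum>k<n. remainder f k (X k \<omega>)\<bar> \<le> (\<Sum>k<n. C1 * ((\<gamma> (Suc k))\<^sup>2 * V (X k \<omega>) + \<gamma> (Suc k) powr ((3 + \<beta>) / 2)))"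
      by (intro order_trans[OF sum_abs] sum_mono C1(2))
    also have "\<dots> = C1 * ?r"
      unfolding error_sum_def by (simp only: sum_distrib_left sum.distrib distrib_left add.commute)
    finally have r: "\<bar>\<Sum>k<n. remainder f k (X k \<omega>)\<bar> \<le> C1 * ?r" .
    have "C2 * (1 + sqrt (V (X n \<omega>))) + C2 * (1 + sqrt (V (X 0 \<omega>))) = C2 * ?s"
      by (simp add: algebra_simps)
    with r C2(2)[of "X n \<omega>"] C2(2)[of "X 0 \<omega>"]
    have "\<bar>boundary f n \<omega>\<bar> \<le> C2 * ?s + C1 * ?r"
      unfolding boundary_def by linarith
    also have "\<dots> \<le> (C1 + C2) * ?s + (C1 + C2) * ?r"
    proof (intro add_mono mult_right_mono)
      show "0 \<le> ?s" using V_nonneg by (intro add_nonneg_nonneg) auto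
      show "0 \<le> ?r" unfolding error_sum_def using V_nonneg by (intro add_nonneg_nonneg sum_nonneg) auto
    qed (use C1 C2 in auto)
    also have "\<dots> = (C1 + C2) * boundary_size n \<omega>"
      unfolding boundary_size_def by (simp add: distrib_left)
    finally show ?thesis .
  qed
  with that[of "C1 + C2"] C1 C2 show ?thesis by simp
qed

lemma boundary_size_measurable: "boundary_size n \<in> borel_measurable M"
  unfolding boundary_size_def[abs_def]
  using V_X_measurable
  by (intro borel_measurable_add borel_measurable_sum borel_measurable_times borel_measurable_const
      measurable_compose[OF V_X_measurable borel_measurable_sqrt])

section \<open>Exponential moments of boundary terms and weighted sums\<close>

lemma step_sum_eq: "step_sum \<gamma> m n = (\<Sum>k<n. \<gamma> (Suc k) ^ m)"
  unfolding step_sum_def by (rule sum.reindex_bij_witness[of _ Suc "\<lambda>k. k - 1"]) auto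

lemma step_sum_pos: "1 \<le> n \<Longrightarrow> 0 < step_sum \<gamma> m n"
  unfolding step_sum_eq by (intro sum_pos) (auto intro!: zero_less_power \<gamma>_pos simp: lessThan_empty_iff)

text \<open>Each of the three random parts is reduced to \<eta> times V: the two square roots by a
  sqrt v <= a^2 / (4 \<eta>) + \<eta> v, the sum by writing it as a weighted mean of V with total
  coefficient at most \<eta>.\<close>

lemma nn_integral_exp_boundary_size:
  assumes n: "1 \<le> n" and \<eta>: "0 < \<eta>" "3 * \<eta> \<le> l" and a: "0 \<le> a" "a * step_sum \<gamma> 2 n \<le> \<eta>"
  shows "(\<integral>\<^sup>+\<omega>. ennreal (exp (a * boundary_size n \<omega>)) \<partial>M)
    \<le> ennreal (exp (a * (2 + error_sum n) + a\<^sup>2 / (2 * \<eta>) + 3 * \<eta> * B / l))"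
proof -
  let ?G = "step_sum \<gamma> 2 n"
  have G: "0 < ?G" by (rule step_sum_pos[OF n])
  let ?w = "\<lambda>k. (\<gamma> (Suc k))\<^sup>2 / ?G"
  let ?W = "\<lambda>\<omega>. \<Sum>k<n. ?w k * (l * V (X k \<omega>))"
  \<comment> \<open>Equal weights 1/3 for the trajectory mean and the two end points; multiplying by
    3 \<eta> / l <= 1 turns each l V / 3 into \<eta> V and the constant B into 3 \<eta> B /
    l.\<close>
  let ?Z = "\<lambda>\<omega>. 1/3 * ?W \<omega> + (1 - 1/3) * (1/2 * (l * V (X n \<omega>)) + (1 - 1/2) * (l * V (X 0 \<omega>)))"
  let ?c = "a * (2 + error_sum n) + a\<^sup>2 / (2 * \<eta>)"
  have w: "(\<Sum>k<n. ?w k) = 1"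
    using G by (simp add: sum_divide_distrib[symmetric] step_sum_eq)
  have W: "(\<integral>\<^sup>+\<omega>. ennreal (exp (?W \<omega>)) \<partial>M) \<le> ennreal (exp B)"
    using G V_X_measurable by (intro nn_integral_exp_average w moments) auto
  have meas: "?W \<in> borel_measurable M" "(\<lambda>\<omega>. 1/2 * (l * V (X n \<omega>)) + (1 - 1/2) * (l * V (X 0 \<omega>))) \<in> borel_measurable M"
    by (intro borel_measurable_add borel_measurable_sum borel_measurable_times borel_measurable_const V_X_measurable)+
  have "(\<integral>\<^sup>+\<omega>. ennreal (exp (?Z \<omega>)) \<partial>M) \<le> ennreal (exp (1/3 * B + (1 - 1/3) * (1/2 * B + (1 - 1/2) * B)))"
    using meas V_X_measurable V_X_measurable[of 0] by (intro nn_integral_exp_hoelder W moments) auto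
  then have Z: "(\<integral>\<^sup>+\<omega>. ennreal (exp (?Z \<omega>)) \<partial>M) \<le> ennreal (exp B)"
    by simp
  have Zm: "?Z \<in> borel_measurable M"
    by (intro borel_measurable_add borel_measurable_times borel_measurable_const meas)
  have sZ: "(\<integral>\<^sup>+\<omega>. ennreal (exp (3 * \<eta> / l * ?Z \<omega>)) \<partial>M) \<le> ennreal (exp (3 * \<eta> / l * B))"
    using \<eta> l_pos by (intro nn_integral_exp_scale Z Zm) auto
  have sZm: "(\<lambda>\<omega>. 3 * \<eta> / l * ?Z \<omega>) \<in> borel_measurable M"
    by (intro borel_measurable_times borel_measurable_const Zm)
  have le: "a * boundary_size n \<omega> \<le> 3 * \<eta> / l * ?Z \<omega> + ?c" for \<omega>
  proof -
    have amgm: "a * sqrt v \<le> a\<^sup>2 / (4 * \<eta>) + \<eta> * v" if "0 \<le> v" for v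
    proof -
      have "0 \<le> (a - 2 * \<eta> * sqrt v)\<^sup>2 / (4 * \<eta>)" using \<eta> by simp
      also have "\<dots> = a\<^sup>2 / (4 * \<eta>) - a * sqrt v + \<eta> * (sqrt v)\<^sup>2"
        using \<eta> by (simp add: power2_eq_square field_simps)
      finally show ?thesis using that by simp
    qed
    have "a * (\<Sum>k<n. (\<gamma> (Suc k))\<^sup>2 * V (X k \<omega>)) = (a * ?G) * (\<Sum>k<n. ?w k * V (X k \<omega>))"
      using G by (simp add: sum_distrib_left)
    also have "\<dots> \<le> \<eta> * (\<Sum>k<n. ?w k * V (X k \<omega>))"
      using a G V_nonneg by (intro mult_right_mono sum_nonneg mult_nonneg_nonneg divide_nonneg_pos) auto
    finally have "a * (\<Sum>k<n. (\<gamma> (Suc k))\<^sup>2 * V (X k \<omega>)) \<le> \<eta> * (\<Sum>k<n. ?w k * V (X k \<omega>))" .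
    moreover have "3 * \<eta> / l * ?Z \<omega> = \<eta> * (\<Sum>k<n. ?w k * V (X k \<omega>)) + \<eta> * V (X n \<omega>) + \<eta> * V (X 0 \<omega>)"
    proof -
      have "?W \<omega> = l * (\<Sum>k<n. ?w k * V (X k \<omega>))"
        unfolding sum_distrib_left by (intro sum.cong refl) simp
      then show ?thesis using l_pos by (simp only:) (simp add: field_simps)
    qed
    moreover have "a * boundary_size n \<omega> = a * (2 + error_sum n) + a * sqrt (V (X n \<omega>)) + a * sqrt (V (X 0 \<omega>))
        + a * (\<Sum>k<n. (\<gamma> (Suc k))\<^sup>2 * V (X k \<omega>))"
      unfolding boundary_size_def by (simp only: distrib_left)
    moreover have "a\<^sup>2 / (4 * \<eta>) + a\<^sup>2 / (4 * \<eta>) = a\<^sup>2 / (2 * \<eta>)" using \<eta> by (simp add: field_simps)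
    ultimately show ?thesis
      using amgm[OF V_nonneg[of "X n \<omega>"]] amgm[OF V_nonneg[of "X 0 \<omega>"]] by linarith
  qed
  have "(\<integral>\<^sup>+\<omega>. ennreal (exp (a * boundary_size n \<omega>)) \<partial>M) \<le> (\<integral>\<^sup>+\<omega>. ennreal (exp (3 * \<eta> / l * ?Z \<omega> + ?c)) \<partial>M)"
    using le by (intro nn_integral_mono ennreal_leI) simp
  also have "\<dots> \<le> ennreal (exp ?c) * ennreal (exp (3 * \<eta> / l * B))"
    unfolding nn_integral_exp_add_const[OF sZm] by (intro mult_left_mono sZ) simp
  also have "\<dots> = ennreal (exp (?c + 3 * \<eta> * B / l))"
    by (simp add: ennreal_mult[symmetric] exp_add)
  finally show ?thesis .
qed

text \<open>The weight w goes to the compensated main martingale, which contributes nothing to the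
  bound. Its compensator must be added back: by the Poisson equation it is the deterministic leading
  term plus \<mu> times boundary and martingale of h. These and the boundary of f share the weight 1
  - w.\<close>

lemma nn_integral_exp_weighted_sum:
  assumes f: "test_function \<beta> V f" "\<And>n \<omega>. \<bar>boundary f n \<omega>\<bar> \<le> Cf * boundary_size n \<omega>" "0 \<le> Cf"
    and h: "test_function \<beta> V h" "\<And>n \<omega>. \<bar>boundary h n \<omega>\<bar> \<le> Ch * boundary_size n \<omega>" "0 \<le> Ch"
    and poisson: "\<And>x. generator b \<sigma> h x = S x - v" and S: "\<And>x. (op_norm (\<sigma> x))\<^sup>2 \<le> S x"
    and n: "1 \<le> n" and \<eta>: "0 < \<eta>" "3 * \<eta> \<le> l" and w: "0 < w" "w < 1"
    and \<mu>: "\<mu> = \<tau>\<^sup>2 * (grad_sup f)\<^sup>2 / (2 * w)" "\<mu> \<le> \<bar>\<tau>\<bar>"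
    and a: "a = 2 * \<bar>\<tau>\<bar> * (Cf + Ch) / (1 - w)" "a * step_sum \<gamma> 2 n \<le> \<eta>"
  shows "(\<integral>\<^sup>+\<omega>. ennreal (exp (\<tau> * weighted_sum (generator b \<sigma> f) n \<omega>)) \<partial>M)
    \<le> ennreal (exp (\<mu> * v * Gam \<gamma> n
        + (1 - w) * (1/2 * (a * (2 + error_sum n) + a\<^sup>2 / (2 * \<eta>) + 3 * \<eta> * B / l)
        + (1 - 1/2) * ((2 * \<mu> / (1 - w))\<^sup>2 * (grad_sup h)\<^sup>2 / 2 * (\<kappa>\<^sup>2 * Gam \<gamma> n)))))"
proof -
  have Sm: "S \<in> borel_measurable borel"
  proof -
    have "S = (\<lambda>x. generator b \<sigma> h x + v)" using poisson by (simp add: fun_eq_iff)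
    then show ?thesis using test_functionD(5)[OF h(1)] by simp
  qed
  have \<mu>0: "0 \<le> \<mu>" using w by (simp add: \<mu>)
  have a0: "0 \<le> a" using w f(3) h(3) by (simp add: a)
  have func_meas: "functional (increment g) n \<in> borel_measurable M" if "test_function \<beta> V g" for g
    by (intro measurable_past[OF functional_measurable_past] increment_measurable that)
  \<comment> \<open>Division by w anticipates the Hoelder weight: w times \<open>?A\<close> is -
    \<tau> times the martingale minus \<mu> times the weighted sum of S.\<close>
  let ?A = "\<lambda>\<omega>. - \<tau> / w * functional (increment f) n \<omega> - (- \<tau> / w)\<^sup>2 * (grad_sup f)\<^sup>2 / 2 * weighted_sum S n \<omega>"
  \<comment> \<open>Two nested Hoelder splits, with weights 1 - w and 1/2, produce the factor 2 / (1
    - w), here and in a.\<close>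
  let ?c = "- (2 * \<mu> / (1 - w))"
  let ?d = "?c\<^sup>2 * (grad_sup h)\<^sup>2 / 2 * (\<kappa>\<^sup>2 * Gam \<gamma> n)"
  let ?B = "\<lambda>\<omega>. 1/2 * (a * boundary_size n \<omega>) + (1 - 1/2) * (?c * functional (increment h) n \<omega>)"
  let ?b = "1/2 * (a * (2 + error_sum n) + a\<^sup>2 / (2 * \<eta>) + 3 * \<eta> * B / l) + (1 - 1/2) * ?d"
  have Am: "?A \<in> borel_measurable M"
    using func_meas[OF f(1)] weighted_sum_measurable[OF Sm] by simp
  have cm: "(\<lambda>\<omega>. ?c * functional (increment h) n \<omega>) \<in> borel_measurable M"
    using func_meas[OF h(1)] by simp
  have Bm: "?B \<in> borel_measurable M"
    by (intro borel_measurable_add borel_measurable_times borel_measurable_const cm boundary_size_measurable)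
  have A: "(\<integral>\<^sup>+\<omega>. ennreal (exp (?A \<omega>)) \<partial>M) \<le> ennreal (exp 0)"
    using nn_integral_exp_functional_increment[OF f(1) Sm S, of "- \<tau> / w" n] by simp
  have "(\<integral>\<^sup>+\<omega>. ennreal (exp (?c * functional (increment h) n \<omega>)) \<partial>M) \<le> ennreal (exp ?d)"
  proof (rule nn_integral_exp_diffD[OF cm])
    have "weighted_sum (\<lambda>_. \<kappa>\<^sup>2) n \<omega> = \<kappa>\<^sup>2 * Gam \<gamma> n" for \<omega>
      by (simp add: weighted_sum_def step_sum_eq sum_distrib_right[symmetric] mult.commute)
    moreover have "(op_norm (\<sigma> x))\<^sup>2 \<le> \<kappa>\<^sup>2" for x
      by (intro power_mono \<sigma>_bound op_norm_nonneg)
    ultimately show "(\<integral>\<^sup>+\<omega>. ennreal (exp (?c * functional (increment h) n \<omega> - ?d)) \<partial>M) \<le> 1"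
      using nn_integral_exp_functional_increment[OF h(1), of "\<lambda>_. \<kappa>\<^sup>2" ?c n] by simp
  qed
  then have Bb: "(\<integral>\<^sup>+\<omega>. ennreal (exp (?B \<omega>)) \<partial>M) \<le> ennreal (exp ?b)"
    using nn_integral_exp_boundary_size[OF n \<eta> a0 a(2)] boundary_size_measurable cm
    by (intro nn_integral_exp_hoelder) auto
  have AB: "(\<integral>\<^sup>+\<omega>. ennreal (exp (w * ?A \<omega> + (1 - w) * ?B \<omega>)) \<partial>M) \<le> ennreal (exp (w * 0 + (1 - w) * ?b))"
    by (rule nn_integral_exp_hoelder[OF Am Bm _ _ A Bb]) (use w in auto)
  have le: "\<tau> * weighted_sum (generator b \<sigma> f) n \<omega> \<le> (w * ?A \<omega> + (1 - w) * ?B \<omega>) + \<mu> * v * Gam \<gamma> n" for \<omega>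
  proof -
    let ?F = "functional (increment f) n \<omega>" and ?H = "functional (increment h) n \<omega>"
    have "weighted_sum S n \<omega> = v * Gam \<gamma> n + weighted_sum (generator b \<sigma> h) n \<omega>"
      by (simp add: weighted_sum_def poisson right_diff_distrib sum_subtractf step_sum_eq sum_distrib_left mult.commute)
    then have ws: "weighted_sum S n \<omega> = v * Gam \<gamma> n + boundary h n \<omega> - ?H"
      by (simp add: weighted_sum_generator)
    have A_eq: "w * ?A \<omega> = - \<tau> * ?F - \<mu> * weighted_sum S n \<omega>"
      using w by (simp add: \<mu> right_diff_distrib power2_eq_square)
    \<comment> \<open>As \<mu> <= |\<tau>|, the boundary of h may be charged at the rate of that of
      f, and a single coefficient a covers both.\<close>
    have "\<tau> * boundary f n \<omega> + \<mu> * boundary h n \<omega> \<le> \<bar>\<tau>\<bar> * (Cf * boundary_size n \<omega>) + \<bar>\<tau>\<bar> * (Ch * boundary_size n \<omega>)"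
    proof (intro add_mono)
      have "\<tau> * boundary f n \<omega> \<le> \<bar>\<tau>\<bar> * \<bar>boundary f n \<omega>\<bar>" by (metis abs_ge_self abs_mult)
      also have "\<dots> \<le> \<bar>\<tau>\<bar> * (Cf * boundary_size n \<omega>)" by (intro mult_left_mono f(2)) simp
      finally show "\<tau> * boundary f n \<omega> \<le> \<bar>\<tau>\<bar> * (Cf * boundary_size n \<omega>)" .
      have "\<mu> * boundary h n \<omega> \<le> \<mu> * \<bar>boundary h n \<omega>\<bar>" using \<mu>0 by (intro mult_left_mono) auto
      also have "\<dots> \<le> \<bar>\<tau>\<bar> * (Ch * boundary_size n \<omega>)" using \<mu>0 \<mu>(2) by (intro mult_mono h(2)) auto
      finally show "\<mu> * boundary h n \<omega> \<le> \<bar>\<tau>\<bar> * (Ch * boundary_size n \<omega>)" .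
    qed
    also have "\<dots> = (1 - w) * (1/2 * (a * boundary_size n \<omega>))"
      using w by (simp add: a field_simps)
    finally have bd: "\<tau> * boundary f n \<omega> + \<mu> * boundary h n \<omega> \<le> (1 - w) * (1/2 * (a * boundary_size n \<omega>))" .
    have B_eq: "(1 - w) * ?B \<omega> = (1 - w) * (1/2 * (a * boundary_size n \<omega>)) - \<mu> * ?H"
      using w by (simp add: distrib_left right_diff_distrib)
    have "\<tau> * weighted_sum (generator b \<sigma> f) n \<omega> = \<tau> * boundary f n \<omega> - \<tau> * ?F"
      by (simp add: weighted_sum_generator right_diff_distrib)
    moreover have "\<mu> * weighted_sum S n \<omega> = \<mu> * v * Gam \<gamma> n + \<mu> * boundary h n \<omega> - \<mu> * ?H"
      unfolding ws by (simp add: algebra_simps)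
    ultimately show ?thesis using bd unfolding A_eq B_eq by linarith
  qed
  have ABm: "(\<lambda>\<omega>. w * ?A \<omega> + (1 - w) * ?B \<omega>) \<in> borel_measurable M"
    by (intro borel_measurable_add borel_measurable_times borel_measurable_const Am Bm)
  have "(\<integral>\<^sup>+\<omega>. ennreal (exp (\<tau> * weighted_sum (generator b \<sigma> f) n \<omega>)) \<partial>M)
      \<le> (\<integral>\<^sup>+\<omega>. ennreal (exp ((w * ?A \<omega> + (1 - w) * ?B \<omega>) + \<mu> * v * Gam \<gamma> n)) \<partial>M)"
    using le by (intro nn_integral_mono ennreal_leI) simp
  also have "\<dots> \<le> ennreal (exp (\<mu> * v * Gam \<gamma> n)) * ennreal (exp (w * 0 + (1 - w) * ?b))"
    unfolding nn_integral_exp_add_const[OF ABm] by (intro mult_left_mono AB) simp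
  also have "\<dots> = ennreal (exp (\<mu> * v * Gam \<gamma> n + (1 - w) * ?b))"
    by (simp only: ennreal_mult[symmetric] exp_ge_zero exp_add[symmetric] mult_zero_right add_0_left)
  finally show ?thesis by simp
qed

end

section \<open>The deviation bound\<close>

lemma summable_powr_if_bigtheta:
  assumes \<gamma>: "\<And>k. 1 \<le> k \<Longrightarrow> 0 < \<gamma> k" and theta: "\<gamma> \<in> \<Theta>(\<lambda>k. real k powr (- \<theta>))"
    and p: "0 \<le> p" "1 < \<theta> * p"
  shows "summable (\<lambda>k. \<gamma> (Suc k) powr p)"
proof -
  have "\<gamma> \<in> O(\<lambda>k. real k powr (- \<theta>))" using theta by blast
  then obtain c where c: "0 < c" "eventually (\<lambda>k. norm (\<gamma> k) \<le> c * norm (real k powr (- \<theta>))) sequentially"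
    using landau_o.bigE by blast
  have "summable (\<lambda>k. \<gamma> k powr p)"
  proof (rule summable_comparison_test_ev)
    show "eventually (\<lambda>k. norm (\<gamma> k powr p) \<le> c powr p * real k powr (- (\<theta> * p))) sequentially"
      using c(2) eventually_ge_at_top[of 1]
    proof eventually_elim
      case (elim k)
      then have "\<gamma> k \<le> c * real k powr (- \<theta>)" "0 < \<gamma> k" using \<gamma>[of k] by auto
      then have "\<gamma> k powr p \<le> (c * real k powr (- \<theta>)) powr p" using p by (intro powr_mono2) auto
      also have "\<dots> = c powr p * real k powr (- (\<theta> * p))"
        using c(1) by (simp add: powr_mult powr_powr)
      finally show ?case by simp
    qed
    show "summable (\<lambda>k. c powr p * real k powr (- (\<theta> * p)))"
      using p by (intro summable_mult) (simp add: summable_real_powr_iff)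
  qed
  then show ?thesis by (subst summable_Suc_iff)
qed

text \<open>
  By Cauchy--Schwarz, \<open>\<Sum> g\<^sup>1\<^sup>/\<^sup>2 g\<^sup>p\<^sup>/\<^sup>2\<close> over a late block of indices is at most
  \<open>(\<Sum> g)\<^sup>1\<^sup>/\<^sup>2\<close> times the square root of a small tail of the series \<open>\<Sum> g\<^sup>p\<close>.
\<close>

lemma sum_powr_little_o_sqrt_sum:
  fixes g :: "nat \<Rightarrow> real"
  assumes g: "\<And>k. 0 < g k" and div: "filterlim (\<lambda>n. \<Sum>k<n. g k) at_top sequentially"
    and sm: "summable (\<lambda>k. g k powr p)"
  shows "(\<lambda>n. (\<Sum>k<n. g k powr ((1 + p) / 2)) / sqrt (\<Sum>k<n. g k)) \<longlonglongrightarrow> 0"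
proof (rule LIMSEQ_I)
  fix e :: real assume e: "0 < e"
  let ?S = "\<lambda>n. \<Sum>k<n. g k" and ?Q = "\<lambda>n. \<Sum>k<n. g k powr ((1 + p) / 2)"
  have "0 < (e / 2)\<^sup>2" using e by simp
  from summable_Cauchy[THEN iffD1, OF sm, rule_format, OF this]
  obtain m where m: "\<And>i j. m \<le> i \<Longrightarrow> norm (\<Sum>k=i..<j. g k powr p) < (e / 2)\<^sup>2" by blast
  \<comment> \<open>The head \<open>?Q m\<close> is a fixed number and is beaten by the divergent
    denominator; the + 1 gives strictness and a positive denominator even if \<open>?Q m\<close> is
    0.\<close>
  have "filterlim (\<lambda>n. sqrt (?S n)) at_top sequentially"
    by (rule filterlim_compose[OF sqrt_at_top div])
  then have "eventually (\<lambda>n. ?Q m * 2 / e + 1 \<le> sqrt (?S n)) sequentially"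
    unfolding filterlim_at_top by blast
  then obtain n0 where n0: "\<And>n. n0 \<le> n \<Longrightarrow> ?Q m * 2 / e + 1 \<le> sqrt (?S n)"
    unfolding eventually_sequentially by blast
  have "norm (?Q n / sqrt (?S n) - 0) < e" if n: "max m n0 \<le> n" for n
  proof -
    have Q0: "0 \<le> ?Q j" for j by (rule sum_nonneg) simp
    have s: "?Q m * 2 / e + 1 \<le> sqrt (?S n)" using n0 n by simp
    have "0 \<le> ?Q m * 2 / e" using Q0[of m] e by simp
    then have s0: "0 < sqrt (?S n)" using s by linarith
    have "(\<Sum>k=m..<n. g k powr ((1 + p) / 2))\<^sup>2 = (\<Sum>k=m..<n. sqrt (g k) * g k powr (p / 2))\<^sup>2"
      using g by (simp add: powr_half_sqrt[symmetric] powr_add[symmetric] add_divide_distrib less_imp_le)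
    also have "\<dots> \<le> (\<Sum>k=m..<n. (sqrt (g k))\<^sup>2) * (\<Sum>k=m..<n. (g k powr (p / 2))\<^sup>2)"
      by (rule Cauchy_Schwarz_ineq_sum)
    also have "\<dots> = (\<Sum>k=m..<n. g k) * (\<Sum>k=m..<n. g k powr p)"
      using g by (simp add: less_imp_le power2_eq_square powr_add[symmetric])
    also have "\<dots> \<le> ?S n * (e / 2)\<^sup>2"
      using m[of m n] less_imp_le[OF g]
      by (intro mult_mono sum_mono2) (auto intro!: sum_nonneg)
    also have "\<dots> = (sqrt (?S n) * (e / 2))\<^sup>2"
      by (simp only: power_mult_distrib real_sqrt_pow2[OF sum_nonneg[OF less_imp_le[OF g]]])
    finally have "(\<Sum>k=m..<n. g k powr ((1 + p) / 2)) \<le> sqrt (?S n) * (e / 2)"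
      by (rule power2_le_imp_le) (use s0 e in simp)
    moreover have "?Q n = ?Q m + (\<Sum>k=m..<n. g k powr ((1 + p) / 2))"
      using n sum.atLeastLessThan_concat[of 0 m n "\<lambda>k. g k powr ((1 + p) / 2)"]
      by (simp add: lessThan_atLeast0)
    moreover have "?Q m < sqrt (?S n) * (e / 2)"
      using s e by (simp add: field_simps)
    ultimately have "?Q n < sqrt (?S n) * e" by (simp add: field_simps)
    then show ?thesis using s0 Q0[of n] by (simp add: pos_divide_less_eq mult.commute abs_of_pos)
  qed
  then show "\<exists>no. \<forall>n\<ge>no. norm (?Q n / sqrt (?S n) - 0) < e" by blast
qed

text \<open>
  Thresholds for the accuracies \<open>1 / (j + 2)\<close> are turned into monotone sequences: \<open>J n\<close> is the best
  accuracy guaranteed from \<open>n\<close> on.  The finitely many \<open>n\<close> without any guarantee are absorbed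
  into the constant, as \<open>P n \<le> 1\<close> and the deviations are bounded.
\<close>

lemma monotone_constants_from_asymptotic_bound:
  fixes P :: "nat \<Rightarrow> real \<Rightarrow> real"
  assumes P1: "\<And>n a. P n a \<le> 1" and q: "0 < q"
    and asym: "\<And>\<epsilon>. 0 < \<epsilon> \<Longrightarrow> \<epsilon> < 1 \<Longrightarrow> \<exists>n0. \<forall>n\<ge>n0. \<forall>a. 0 < a \<and> a \<le> A n \<longrightarrow>
      P n a \<le> 2 * exp \<epsilon> * exp (- (1 - \<epsilon>) * (a\<^sup>2 / q))"
  shows "\<exists>c C. incseq c \<and> decseq C \<and> (\<forall>n. 0 < c n \<and> c n \<le> 1 \<and> 1 \<le> C n) \<and> c \<longlonglongrightarrow> 1 \<and> C \<longlonglongrightarrow> (1::real) \<and>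
    (\<forall>n. \<forall>a. 0 < a \<and> a \<le> A n \<longrightarrow> P n a \<le> 2 * C n * exp (- c n * (a\<^sup>2 / q)))"
proof -
  \<comment> \<open>The shift by 2 keeps every accuracy at most 1/2, so that c stays
    positive.\<close>
  let ?\<epsilon> = "\<lambda>j::nat. 1 / (real j + 2)"
  define good where "good j n \<longleftrightarrow> (\<forall>m\<ge>n. \<forall>a. 0 < a \<and> a \<le> A m \<longrightarrow>
      P m a \<le> 2 * exp (?\<epsilon> j) * exp (- (1 - ?\<epsilon> j) * (a\<^sup>2 / q)))" for j n
  have good_ex: "\<exists>n. good j n" for j
    unfolding good_def using asym[of "?\<epsilon> j"] by simp
  have good_mono: "good j n \<Longrightarrow> n \<le> m \<Longrightarrow> good j m" for j n m
    unfolding good_def by (meson order_trans)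
  \<comment> \<open>The cut-off j <= n makes the set finite and the inserted 0 makes it nonempty, so
    the maximum exists.\<close>
  define J where "J n = Max (insert 0 {j. j \<le> n \<and> good j n})" for n
  have fin: "finite (insert 0 {j. j \<le> n \<and> good j n})" for n by simp
  have J_mono: "mono J"
  proof (rule monoI)
    fix m n :: nat assume "m \<le> n"
    then have "insert 0 {j. j \<le> m \<and> good j m} \<subseteq> insert 0 {j. j \<le> n \<and> good j n}"
      by (auto intro: good_mono)
    then show "J m \<le> J n" unfolding J_def by (intro Max_mono) auto
  qed
  have J_ge: "j \<le> J n" if "j \<le> n" "good j n" for j n
    unfolding J_def using that by (intro Max_ge) auto
  have J_in: "J n = 0 \<or> good (J n) n" for n
    using Max_in[OF fin[of n]] unfolding J_def by auto
  have J_top: "filterlim J at_top sequentially"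
    unfolding filterlim_at_top
  proof
    fix j
    obtain n where "good j n" using good_ex by blast
    then have "j \<le> J m" if "max j n \<le> m" for m
      using that by (intro J_ge) (auto intro: good_mono)
    then show "eventually (\<lambda>m. j \<le> J m) sequentially" unfolding eventually_sequentially by blast
  qed
  obtain n0 where n0: "good 0 n0" using good_ex by blast
  \<comment> \<open>For n < n0 the exponent is at most \<open>(A n)\<^sup>2 / q\<close>, so this K
    lifts the right-hand side to at least 2. Being used for small n only, it affects neither
    monotonicity nor the limit.\<close>
  define K where "K = 1 + (\<Sum>n<n0. exp ((A n)\<^sup>2 / q))"
  have K1: "1 \<le> K" by (simp add: K_def sum_nonneg)
  define c where "c n = 1 - ?\<epsilon> (J n)" for n
  define C where "C n = exp (?\<epsilon> (J n)) * (if n < n0 then K else 1)" for n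
  have eps_lim: "(\<lambda>n. ?\<epsilon> (J n)) \<longlonglongrightarrow> 0"
  proof -
    have "(\<lambda>j. ?\<epsilon> j) \<longlonglongrightarrow> 0" 
      using LIMSEQ_ignore_initial_segment[OF lim_1_over_n[where 'a = real], of 2] by (simp add: add.commute)
    then show ?thesis by (rule filterlim_compose[OF _ J_top])
  qed
  have eps_mono: "?\<epsilon> (J m) \<le> ?\<epsilon> (J n)" if "n \<le> m" for n m
    using monoD[OF J_mono that] by (intro divide_left_mono) auto
  have eps: "0 < ?\<epsilon> j" "?\<epsilon> j < 1" for j by auto
  have "incseq c" using eps_mono by (auto simp: incseq_def c_def)
  moreover have "decseq C"
    unfolding decseq_def C_def
  proof (intro allI impI mult_mono)
    fix m n :: nat assume mn: "m \<le> n"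
    show "exp (?\<epsilon> (J n)) \<le> exp (?\<epsilon> (J m))" using eps_mono[OF mn] by simp
    show "(if n < n0 then K else 1) \<le> (if m < n0 then K else 1)" using K1 mn by simp
  qed (use K1 in auto)
  moreover have "\<forall>n. 0 < c n \<and> c n \<le> 1 \<and> 1 \<le> C n"
  proof
    fix n
    have "1 * 1 \<le> exp (?\<epsilon> (J n)) * (if n < n0 then K else 1)" using K1 eps by (intro mult_mono) auto
    then show "0 < c n \<and> c n \<le> 1 \<and> 1 \<le> C n" using eps[of "J n"] by (simp add: c_def C_def)
  qed
  moreover have "c \<longlonglongrightarrow> 1"
    unfolding c_def using tendsto_diff[OF tendsto_const[of 1] eps_lim] by simp
  moreover have "C \<longlonglongrightarrow> 1"
  proof -
    have "(\<lambda>n. exp (?\<epsilon> (J n))) \<longlonglongrightarrow> 1" using tendsto_exp[OF eps_lim] by simp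
    moreover have "eventually (\<lambda>n. exp (?\<epsilon> (J n)) = C n) sequentially"
      unfolding eventually_sequentially C_def by (intro exI[of _ n0]) auto
    ultimately show ?thesis by (rule Lim_transform_eventually)
  qed
  moreover have "P n a \<le> 2 * C n * exp (- c n * (a\<^sup>2 / q))" if a: "0 < a" "a \<le> A n" for n a
  proof (cases "n < n0")
    case False
    then have "good 0 n" using good_mono[OF n0] by simp
    then have "good (J n) n" using J_in[of n] by auto
    then show ?thesis using a False unfolding good_def c_def C_def by auto
  next
    case True
    have "c n * (a\<^sup>2 / q) \<le> 1 * ((A n)\<^sup>2 / q)"
      using a q eps[of "J n"] by (intro mult_mono divide_right_mono power_mono) (auto simp: c_def)
    then have e: "exp (c n * (a\<^sup>2 / q)) \<le> exp ((A n)\<^sup>2 / q)" by simp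
    also have "\<dots> \<le> K"
      unfolding K_def using True
      by (intro add_increasing member_le_sum[of n "{..<n0}" "\<lambda>n. exp ((A n)\<^sup>2 / q)"]) auto
    also have "\<dots> \<le> C n"
      using True K1 eps[of "J n"] mult_right_mono[of 1 "exp (?\<epsilon> (J n))" K] by (simp add: C_def)
    finally have "1 \<le> C n * exp (- c n * (a\<^sup>2 / q))"
      by (simp add: exp_minus field_simps)
    then show ?thesis using P1[of n a] by linarith
  qed
  ultimately show ?thesis by blast
qed

section \<open>Choice of the parameters and the deviation bound\<close>

context lyapunov_scheme
begin

lemma empirical_eq: "sqrt (Gam \<gamma> n) * empirical \<gamma> X n g \<omega> = weighted_sum g n \<omega> / sqrt (Gam \<gamma> n)"
proof -
  have "(\<Sum>k=1..n. \<gamma> k * g (X (k - 1) \<omega>)) = weighted_sum g n \<omega>"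
    unfolding weighted_sum_def by (rule sum.reindex_bij_witness[of _ Suc "\<lambda>k. k - 1"]) auto
  then have "sqrt (Gam \<gamma> n) * empirical \<gamma> X n g \<omega> = sqrt (Gam \<gamma> n) / Gam \<gamma> n * weighted_sum g n \<omega>"
    by (simp add: empirical_def)
  also have "\<dots> = 1 / sqrt (Gam \<gamma> n) * weighted_sum g n \<omega>"
    by (simp add: sqrt_divide_self_eq inverse_eq_divide sum_nonneg step_sum_eq \<gamma>_pos less_imp_le)
  finally show ?thesis by simp
qed

text \<open>With y = a^2 / (2 q) the exponent is y (1 + \<epsilon> / 2) - 2 y plus errors of at most
  \<epsilon> + \<epsilon> y / 2. Whatever has to be small for this depends on n alone, so one n0
  serves the whole range of a.\<close>

lemma deviation_eventually:
  assumes f: "test_function \<beta> V f" and h: "test_function \<beta> V h"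
    and poisson: "\<And>x. generator b \<sigma> h x = S x - v" and S: "\<And>x. (op_norm (\<sigma> x))\<^sup>2 \<le> S x"
    and v: "0 < v" and L: "0 < grad_sup f"
    and div: "filterlim (Gam \<gamma>) at_top sequentially"
    and err: "(\<lambda>n. error_sum n / sqrt (Gam \<gamma> n)) \<longlonglongrightarrow> 0"
    and \<rho>: "\<And>n. 0 < \<rho> n" "\<rho> \<longlonglongrightarrow> 0" and \<epsilon>: "0 < \<epsilon>" "\<epsilon> < 1"
  shows "\<exists>n0. \<forall>n\<ge>n0. \<forall>a. 0 < a \<and> a \<le> \<rho> n * (sqrt (Gam \<gamma> n) / step_sum \<gamma> 2 n) \<longrightarrow>
    prob {\<omega> \<in> space M. a \<le> \<bar>sqrt (Gam \<gamma> n) * empirical \<gamma> X n (generator b \<sigma> f) \<omega>\<bar>}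
      \<le> 2 * exp \<epsilon> * exp (- (1 - \<epsilon>) * (a\<^sup>2 / (2 * v * (grad_sup f)\<^sup>2)))"
proof -
  let ?L = "grad_sup f" and ?\<Gamma> = "Gam \<gamma>" and ?\<Gamma>2 = "step_sum \<gamma> 2"
  obtain Cf where Cf: "0 \<le> Cf" "\<And>n \<omega>. \<bar>boundary f n \<omega>\<bar> \<le> Cf * boundary_size n \<omega>"
    using boundary_bound[OF f] by metis
  obtain Ch where Ch: "0 \<le> Ch" "\<And>n \<omega>. \<bar>boundary h n \<omega>\<bar> \<le> Ch * boundary_size n \<omega>"
    using boundary_bound[OF h] by metis
  define q where "q = v * ?L\<^sup>2"
  have q: "0 < q" using v L by (simp add: q_def)
  \<comment> \<open>Spends half of the tolerance: the leading term grows by the factor 1 / w. As w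
    depends on \<epsilon> only, powers of 1 / (1 - w) are constants.\<close>
  define w where "w = 1 / (1 + \<epsilon> / 2)"
  have w: "0 < w" "w < 1" "1 / w = 1 + \<epsilon> / 2" using \<epsilon> by (auto simp: w_def)
  \<comment> \<open>The first entry permits scaling by 3 \<eta> / l <= 1, the second bounds the
    moment constant by \<epsilon> / 2; the + 1 covers B = 0.\<close>
  define \<eta> where "\<eta> = min (l / 3) (\<epsilon> * l / (6 * B + 1))"
  have B1: "0 < 6 * B + 1" using B_nonneg by simp
  have \<eta>: "0 < \<eta>" "3 * \<eta> \<le> l" "3 * \<eta> * B / l \<le> \<epsilon> / 2"
  proof -
    show "0 < \<eta>" "3 * \<eta> \<le> l" using l_pos \<epsilon> B1 by (auto simp: \<eta>_def)
    have "\<eta> * (6 * B + 1) \<le> \<epsilon> * l"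
      using B1 by (simp add: pos_le_divide_eq[symmetric] \<eta>_def)
    moreover have "\<eta> * (6 * B) \<le> \<eta> * (6 * B + 1)" using \<open>0 < \<eta>\<close> by (intro mult_left_mono) auto
    ultimately show "3 * \<eta> * B / l \<le> \<epsilon> / 2" using l_pos by (simp add: pos_divide_le_eq mult_ac)
  qed
  define K1 where "K1 = 2 * (Cf + Ch) / (1 - w)"
  have K1: "0 \<le> K1" using Cf Ch w by (simp add: K1_def)
  define K3 where "K3 = (?L\<^sup>2 / (w * (1 - w)))\<^sup>2 * (grad_sup h)\<^sup>2 * \<kappa>\<^sup>2 / 2"
  have K3: "0 \<le> K3" by (simp add: K3_def)
  \<comment> \<open>An upper bound for the tilt t: t times the sum of squared steps is at most
    \<rho> / q, and that sum is at least the square of the first step.\<close>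
  define T where "T n = \<rho> n / ((\<gamma> 1)\<^sup>2 * q)" for n
  \<comment> \<open>Normalised errors: \<open>a * d1\<close> for the deterministic boundary part,
    \<open>a\<^sup>2 * d2\<close> for the square roots of V, \<open>a\<^sup>2 * d3\<close> for the
    second martingale.\<close>
  define d1 where "d1 n = K1 / q * (2 / sqrt (?\<Gamma> n) + error_sum n / sqrt (?\<Gamma> n))" for n
  define d2 where "d2 n = K1\<^sup>2 / (4 * \<eta> * q\<^sup>2) * (1 / ?\<Gamma> n)" for n
  define d3 where "d3 n = K3 / q\<^sup>2 * (T n)\<^sup>2" for n
  have sq: "filterlim (\<lambda>n. sqrt (?\<Gamma> n)) at_top sequentially"
    by (rule filterlim_compose[OF sqrt_at_top div])
  have T_lim: "T \<longlonglongrightarrow> 0"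
    unfolding T_def[abs_def] using tendsto_divide[OF \<rho>(2) tendsto_const[of "(\<gamma> 1)\<^sup>2 * q"]] q \<gamma>_pos[of 1] by simp
  have d1_lim: "d1 \<longlonglongrightarrow> 0"
  proof -
    have "(\<lambda>n. 2 / sqrt (?\<Gamma> n)) \<longlonglongrightarrow> 0"
      by (rule tendsto_divide_0[OF tendsto_const filterlim_at_top_imp_at_infinity[OF sq]])
    from tendsto_mult[OF tendsto_const[of "K1 / q"] tendsto_add[OF this err]] show ?thesis
      unfolding d1_def[abs_def] by simp
  qed
  have d2_lim: "d2 \<longlonglongrightarrow> 0"
  proof -
    have "(\<lambda>n. 1 / ?\<Gamma> n) \<longlonglongrightarrow> 0"
      by (rule tendsto_divide_0[OF tendsto_const filterlim_at_top_imp_at_infinity[OF div]])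
    from tendsto_mult[OF tendsto_const[of "K1\<^sup>2 / (4 * \<eta> * q\<^sup>2)"] this] show ?thesis
      unfolding d2_def[abs_def] by simp
  qed
  have d3_lim: "d3 \<longlonglongrightarrow> 0"
    using tendsto_mult[OF tendsto_const[of "K3 / q\<^sup>2"] tendsto_power[OF T_lim, of 2]]
    unfolding d3_def[abs_def] by simp
  have d_lim: "(\<lambda>n. (d1 n + d2 n + d3 n) * (2 * q)) \<longlonglongrightarrow> 0"
    using tendsto_mult[OF tendsto_add[OF tendsto_add[OF d1_lim d2_lim] d3_lim] tendsto_const[of "2 * q"]] by simp
  have TL_lim: "(\<lambda>n. T n * (?L\<^sup>2 / (2 * w))) \<longlonglongrightarrow> 0"
    using tendsto_mult[OF T_lim tendsto_const[of "?L\<^sup>2 / (2 * w)"]] by simp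
  have rho_lim: "(\<lambda>n. K1 / q * \<rho> n) \<longlonglongrightarrow> 0"
    using tendsto_mult[OF tendsto_const[of "K1 / q"] \<rho>(2)] by simp
  have small: "eventually (\<lambda>n. g n < e) sequentially" if "g \<longlonglongrightarrow> 0" "0 < e" for g and e :: real
    using order_tendstoD(2)[OF that] .
  have "eventually (\<lambda>n. 1 \<le> n \<and> d1 n < \<epsilon> / 2 \<and> (d1 n + d2 n + d3 n) * (2 * q) < \<epsilon> / 2
      \<and> T n * (?L\<^sup>2 / (2 * w)) < 1 \<and> K1 / q * \<rho> n < \<eta>) sequentially"
    using \<epsilon> \<eta> by (intro eventually_conj eventually_ge_at_top small d1_lim d_lim TL_lim rho_lim) auto
  then obtain n0 where n0: "\<And>n. n0 \<le> n \<Longrightarrow> 1 \<le> n \<and> d1 n < \<epsilon> / 2 \<and> (d1 n + d2 n + d3 n) * (2 * q) < \<epsilon> / 2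
      \<and> T n * (?L\<^sup>2 / (2 * w)) < 1 \<and> K1 / q * \<rho> n < \<eta>"
    unfolding eventually_sequentially by blast
  have "prob {\<omega> \<in> space M. a \<le> \<bar>sqrt (?\<Gamma> n) * empirical \<gamma> X n (generator b \<sigma> f) \<omega>\<bar>}
      \<le> 2 * exp \<epsilon> * exp (- (1 - \<epsilon>) * (a\<^sup>2 / (2 * v * ?L\<^sup>2)))"
    if n: "n0 \<le> n" and a: "0 < a" "a \<le> \<rho> n * (sqrt (?\<Gamma> n) / ?\<Gamma>2 n)" for n a
  proof -
    note N = n0[OF n]
    then have n1: "1 \<le> n" by blast
    have G: "0 < ?\<Gamma> n" "0 < ?\<Gamma>2 n" using step_sum_pos[OF n1] by auto
    define r where "r = sqrt (?\<Gamma> n)"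
    have r: "0 < r" "r\<^sup>2 = ?\<Gamma> n" using G by (auto simp: r_def)
    \<comment> \<open>Minimises t^2 q r^2 / 2 - t r a, the exponent without its error terms.\<close>
    define t where "t = a / (r * q)"
    have t: "0 < t" using a r q by (simp add: t_def)
    have tr: "t * r = a / q" using r q by (simp add: t_def)
    have tG: "t * ?\<Gamma>2 n \<le> \<rho> n / q"
    proof -
      have "a * ?\<Gamma>2 n \<le> \<rho> n * r" using a(2) G by (simp add: r_def pos_le_divide_eq)
      then show ?thesis using r q unfolding t_def by (simp add: field_simps)
    qed
    have tT: "t \<le> T n"
    proof -
      have "(\<gamma> 1)\<^sup>2 \<le> ?\<Gamma>2 n"
        unfolding step_sum_def using n1 by (intro member_le_sum[of 1 _ "\<lambda>k. (\<gamma> k)\<^sup>2"]) auto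
      then have "t * (\<gamma> 1)\<^sup>2 \<le> \<rho> n / q" using tG t by (meson less_imp_le mult_left_mono order_trans)
      then show ?thesis using \<gamma>_pos[of 1] q by (simp add: T_def field_simps)
    qed
    define \<mu> where "\<mu> = t\<^sup>2 * ?L\<^sup>2 / (2 * w)"
    have \<mu>_le: "\<mu> \<le> t"
    proof -
      have "t * (?L\<^sup>2 / (2 * w)) \<le> T n * (?L\<^sup>2 / (2 * w))" using tT w by (intro mult_right_mono) auto
      then have "t * (t * (?L\<^sup>2 / (2 * w))) \<le> t * 1" using N t by (intro mult_left_mono) auto
      then show ?thesis by (simp add: \<mu>_def power2_eq_square)
    qed
    define A where "A = K1 * t"
    have A_le: "A * ?\<Gamma>2 n \<le> \<eta>"
    proof -
      have "A * ?\<Gamma>2 n \<le> K1 * (\<rho> n / q)" unfolding A_def mult.assoc using tG K1 by (intro mult_left_mono)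
      then show ?thesis using N by simp
    qed
    let ?D = "(2 * \<mu> / (1 - w))\<^sup>2 * (grad_sup h)\<^sup>2 / 2 * (\<kappa>\<^sup>2 * ?\<Gamma> n)"
    let ?X = "1/2 * (A * (2 + error_sum n) + A\<^sup>2 / (2 * \<eta>) + 3 * \<eta> * B / l) + (1 - 1/2) * ?D"
    let ?E = "\<mu> * v * ?\<Gamma> n + (1 - w) * ?X"
    let ?y = "a\<^sup>2 / (2 * v * ?L\<^sup>2)"
    have y0: "0 \<le> ?y" using v by simp
    have ay: "a\<^sup>2 = 2 * q * ?y" using v L by (simp add: q_def)
    have exponent: "?E - t * (r * a) \<le> \<epsilon> - (1 - \<epsilon>) * ?y"
    proof -
      have e0: "0 \<le> error_sum n" unfolding error_sum_def by (intro sum_nonneg) simp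
      have A0: "0 \<le> A" using K1 t by (simp add: A_def)
      have X1: "A * (2 + error_sum n) = a * d1 n"
        using r q unfolding A_def d1_def t_def r_def[symmetric] by (simp add: field_simps)
      have d10: "0 \<le> d1 n" unfolding d1_def using K1 q e0 G by simp
      have X2: "A\<^sup>2 / (2 * \<eta>) = 2 * (a\<^sup>2 * d2 n)"
        using r q \<eta> unfolding A_def d2_def t_def r(2)[symmetric] by (simp add: field_simps power2_eq_square)
      have X3: "?D \<le> 2 * (a\<^sup>2 * d3 n)"
      proof -
        have "?D = K3 * t\<^sup>2 * (t * r)\<^sup>2"
          using w unfolding \<mu>_def K3_def r(2)[symmetric] by (simp add: field_simps power2_eq_square)
        also have "\<dots> = K3 * t\<^sup>2 * (a\<^sup>2 / q\<^sup>2)" unfolding tr by (simp add: power_divide)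
        also have "\<dots> \<le> K3 * (T n)\<^sup>2 * (a\<^sup>2 / q\<^sup>2)"
          using K3 tT t by (intro mult_right_mono mult_left_mono power_mono) auto
        also have "\<dots> = a\<^sup>2 * d3 n" by (simp add: d3_def)
        finally have "?D \<le> a\<^sup>2 * d3 n" .
        moreover have "0 \<le> a\<^sup>2 * d3 n" using K3 by (simp add: d3_def)
        ultimately show ?thesis by linarith
      qed
      have "0 \<le> ?X" using A0 e0 \<eta> B_nonneg l_pos less_imp_le[OF G(1)] by (intro add_nonneg_nonneg mult_nonneg_nonneg) auto
      then have "(1 - w) * ?X \<le> 1 * ?X" using w by (intro mult_right_mono) auto
      also have "\<dots> \<le> a * d1 n + a\<^sup>2 * d2 n + \<epsilon> / 2 + a\<^sup>2 * d3 n"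
      proof -
        have "1 * (1/2 * (x + y + z) + (1 - 1/2) * d) \<le> x' + y' + e / 2 + d'"
          if "x = x'" "y = 2 * y'" "d \<le> 2 * d'" "z \<le> e / 2" "0 < e" "0 \<le> x'" for x y z d x' y' d' e :: real
          using that by (simp add: field_simps)
        from this[OF X1 X2 X3 \<eta>(3) \<epsilon>(1) mult_nonneg_nonneg[OF less_imp_le[OF a(1)] d10]] show ?thesis .
      qed
      \<comment> \<open>For small a a term linear in a is not dominated by a^2; a <= 1 + a^2 sends
        its constant part to the prefactor \<open>exp \<epsilon>\<close>.\<close>
      also have "\<dots> \<le> d1 n + (d1 n + d2 n + d3 n) * a\<^sup>2 + \<epsilon> / 2"
      proof -
        have "2 * a \<le> 1 + a\<^sup>2" using sum_squares_bound[of 1 a] by simp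
        then have "a \<le> 1 + a\<^sup>2" using a by linarith
        then have "a * d1 n \<le> (1 + a\<^sup>2) * d1 n" using d10 by (rule mult_right_mono)
        then show ?thesis by (simp add: algebra_simps)
      qed
      also have "\<dots> \<le> \<epsilon> + \<epsilon> / 2 * ?y"
      proof -
        have "(d1 n + d2 n + d3 n) * a\<^sup>2 = (d1 n + d2 n + d3 n) * (2 * q) * ?y" by (subst ay) (simp only: mult.assoc)
        also have "\<dots> \<le> \<epsilon> / 2 * ?y" using N y0 by (intro mult_right_mono) auto
        finally show ?thesis using N by linarith
      qed
      finally have X: "(1 - w) * ?X \<le> \<epsilon> + \<epsilon> / 2 * ?y" .
      have "\<mu> * v * ?\<Gamma> n = (t * r)\<^sup>2 * q / 2 * (1 / w)"
        using w unfolding \<mu>_def q_def r(2)[symmetric] by (simp add: field_simps)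
      also have "\<dots> = ?y * (1 + \<epsilon> / 2)"
        unfolding tr w(3) using v L by (simp add: q_def power_divide field_simps power2_eq_square)
      finally have main: "\<mu> * v * ?\<Gamma> n = ?y * (1 + \<epsilon> / 2)" .
      have "t * (r * a) = a\<^sup>2 / q"
        using tr by (simp add: mult.assoc[symmetric] power2_eq_square)
      also have "\<dots> = 2 * ?y" by (simp add: q_def mult.assoc)
      finally have tra: "t * (r * a) = 2 * ?y" .
      have "m + x - z \<le> \<epsilon> - (1 - \<epsilon>) * y"
        if "m = y * (1 + \<epsilon> / 2)" "x \<le> \<epsilon> + \<epsilon> / 2 * y" "z = 2 * y" for m x y z :: real
        using that by (simp add: algebra_simps)
      from this[OF main X tra] show ?thesis .
    qed
    \<comment> \<open>The moment bound sees its parameter only through absolute value and square, so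
      both tails get the same estimate; their union gives the factor 2.\<close>
    have one_sided: "prob {\<omega> \<in> space M. a \<le> s * (weighted_sum (generator b \<sigma> f) n \<omega> / r)}
        \<le> exp \<epsilon> * exp (- (1 - \<epsilon>) * ?y)" if s: "s = 1 \<or> s = - 1" for s
    proof -
      let ?Z = "\<lambda>\<omega>. s * t * weighted_sum (generator b \<sigma> f) n \<omega>"
      have st: "\<bar>s * t\<bar> = t" "(s * t)\<^sup>2 = t\<^sup>2" using s t by auto
      have Zm: "?Z \<in> borel_measurable M"
        using weighted_sum_measurable[OF test_functionD(5)[OF f]] by simp
      have "(\<integral>\<^sup>+\<omega>. ennreal (exp (?Z \<omega>)) \<partial>M) \<le> ennreal (exp ?E)"
        by (rule nn_integral_exp_weighted_sum[OF f Cf(2,1) h Ch(2,1) poisson S n1 \<eta>(1,2) w(1,2)])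
          (use \<mu>_le A_le in \<open>auto simp: st \<mu>_def A_def K1_def\<close>)
      from chernoff_bound[OF Zm this, of "t * (r * a)"]
      have "prob {\<omega> \<in> space M. t * (r * a) \<le> ?Z \<omega>} \<le> exp (?E - t * (r * a))" .
      also have "\<dots> \<le> exp (\<epsilon> - (1 - \<epsilon>) * ?y)" using exponent by simp
      also have "\<dots> = exp \<epsilon> * exp (- (1 - \<epsilon>) * ?y)"
        by (simp only: exp_add[symmetric] mult_minus_left diff_conv_add_uminus)
      also have "{\<omega> \<in> space M. t * (r * a) \<le> ?Z \<omega>}
          = {\<omega> \<in> space M. a \<le> s * (weighted_sum (generator b \<sigma> f) n \<omega> / r)}"
        using t r by (simp add: pos_le_divide_eq mult_ac)
      finally show ?thesis .
    qed
    let ?S = "\<lambda>s. {\<omega> \<in> space M. a \<le> s * (weighted_sum (generator b \<sigma> f) n \<omega> / r)}"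
    have Sm: "?S s \<in> events" for s
      using weighted_sum_measurable[OF test_functionD(5)[OF f], of n] by measurable
    have "{\<omega> \<in> space M. a \<le> \<bar>sqrt (?\<Gamma> n) * empirical \<gamma> X n (generator b \<sigma> f) \<omega>\<bar>} = ?S 1 \<union> ?S (- 1)"
      unfolding r_def empirical_eq by (auto simp: abs_real_def split: if_splits)
    then have "prob {\<omega> \<in> space M. a \<le> \<bar>sqrt (?\<Gamma> n) * empirical \<gamma> X n (generator b \<sigma> f) \<omega>\<bar>}
        \<le> prob (?S 1) + prob (?S (- 1))"
      using measure_Un_le[OF Sm[of 1] Sm[of "- 1"]] by (simp only:)
    also have "\<dots> \<le> exp \<epsilon> * exp (- (1 - \<epsilon>) * ?y) + exp \<epsilon> * exp (- (1 - \<epsilon>) * ?y)"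
      by (intro add_mono one_sided) auto
    finally show ?thesis by simp
  qed
  then show ?thesis by blast
qed

lemma deviation_bound_scheme:
  assumes f: "test_function \<beta> V f" and h: "test_function \<beta> V h"
    and poisson: "\<And>x. generator b \<sigma> h x = S x - v" and S: "\<And>x. (op_norm (\<sigma> x))\<^sup>2 \<le> S x"
    and v: "0 \<le> v"
    and \<gamma>_le: "\<And>k. 1 \<le> k \<Longrightarrow> \<gamma> k \<le> \<gamma> 1"
    and div: "filterlim (Gam \<gamma>) at_top sequentially"
    and sm: "summable (\<lambda>k. \<gamma> (Suc k) powr (2 + \<beta>))"
  shows "deviation_bound M \<gamma> (\<lambda>n. empirical \<gamma> X n (generator b \<sigma> f)) v (grad_sup f)"
  unfolding deviation_bound_def
proof (intro allI impI)
  fix \<delta> :: "nat \<Rightarrow> real" assume \<delta>: "\<delta> \<longlonglongrightarrow> 0"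
  let ?\<Gamma> = "Gam \<gamma>" and ?\<Gamma>2 = "step_sum \<gamma> 2"
  have g: "0 < \<gamma> (Suc k)" for k by (rule \<gamma>_pos) simp
  have Gam_eq: "?\<Gamma> n = (\<Sum>k<n. \<gamma> (Suc k))" for n by (simp add: step_sum_eq)
  have err: "(\<lambda>n. error_sum n / sqrt (?\<Gamma> n)) \<longlonglongrightarrow> 0"
  proof -
    have p: "(1 + (2 + \<beta>)) / 2 = (3 + \<beta>) / 2" by simp
    show ?thesis
      using sum_powr_little_o_sqrt_sum[OF g div[unfolded Gam_eq] sm]
      unfolding error_sum_def Gam_eq p .
  qed
  have err2: "(\<lambda>n. ?\<Gamma>2 n / sqrt (?\<Gamma> n)) \<longlonglongrightarrow> 0"
  proof (rule Lim_null_comparison)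
    \<comment> \<open>The square of a step is its power (1 - \<beta>) / 2 times its power (3 +
      \<beta>) / 2, and the first factor is largest at the first step because \<beta> <= 1. So the
      sum of squares is also negligible against the root of the total step.\<close>
    let ?c = "\<gamma> 1 powr ((1 - \<beta>) / 2)"
    have "?\<Gamma>2 n \<le> ?c * error_sum n" for n
      unfolding step_sum_eq error_sum_def sum_distrib_left
    proof (rule sum_mono)
      fix k
      have "(\<gamma> (Suc k))\<^sup>2 = \<gamma> (Suc k) powr ((1 - \<beta>) / 2) * \<gamma> (Suc k) powr ((3 + \<beta>) / 2)"
        using g[of k] by (simp add: powr_add[symmetric] add_divide_distrib[symmetric])
      also have "\<dots> \<le> ?c * \<gamma> (Suc k) powr ((3 + \<beta>) / 2)"
        using g[of k] \<gamma>_le[of "Suc k"] \<beta> by (intro mult_right_mono powr_mono2) auto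
      finally show "(\<gamma> (Suc k))\<^sup>2 \<le> ?c * \<gamma> (Suc k) powr ((3 + \<beta>) / 2)" .
    qed
    then have "norm (?\<Gamma>2 n / sqrt (?\<Gamma> n)) \<le> ?c * (error_sum n / sqrt (?\<Gamma> n))" for n
      using g by (simp add: divide_right_mono step_sum_eq sum_nonneg less_imp_le)
    then show "eventually (\<lambda>n. norm (?\<Gamma>2 n / sqrt (?\<Gamma> n)) \<le> ?c * (error_sum n / sqrt (?\<Gamma> n))) sequentially"
      by simp
    show "(\<lambda>n. ?c * (error_sum n / sqrt (?\<Gamma> n))) \<longlonglongrightarrow> 0"
      using tendsto_mult[OF tendsto_const[of ?c] err] by simp
  qed
  define x where "x n = ?\<Gamma>2 n / sqrt (?\<Gamma> n)" for n
  have x_pos: "0 < x n" if "1 \<le> n" for n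
    using step_sum_pos[OF that] by (simp add: x_def)
  have x0: "0 \<le> x n" for n using g by (simp add: x_def step_sum_eq sum_nonneg less_imp_le)
  have x_lim: "x \<longlonglongrightarrow> 0" using err2 by (simp add: x_def[abs_def])
  \<comment> \<open>The first summand dominates \<delta>, the second makes the range of a at least 1
    / sqrt (x n) and hence unbounded, the third keeps \<rho> positive at n = 0, where x
    vanishes.\<close>
  define \<rho> where "\<rho> n = \<bar>\<delta> n\<bar> + sqrt (x n) + 1 / real (Suc n)" for n
  have \<rho>_pos: "0 < \<rho> n" for n using x0[of n] by (simp add: \<rho>_def add_nonneg_pos)
  have \<rho>_ge: "\<delta> n \<le> \<rho> n" "sqrt (x n) \<le> \<rho> n" for n
  proof -
    have "0 \<le> sqrt (x n)" "0 \<le> 1 / real (Suc n)" using x0[of n] by auto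
    then show "\<delta> n \<le> \<rho> n" "sqrt (x n) \<le> \<rho> n" unfolding \<rho>_def by linarith+
  qed
  have \<rho>_lim: "\<rho> \<longlonglongrightarrow> 0"
  proof -
    have "(\<lambda>n. \<bar>\<delta> n\<bar> + sqrt (x n) + 1 / real (Suc n)) \<longlonglongrightarrow> 0 + sqrt 0 + 0"
      by (intro tendsto_add tendsto_real_sqrt x_lim tendsto_rabs_zero \<delta> LIMSEQ_Suc[OF lim_1_over_n])
    then show ?thesis by (simp add: \<rho>_def[abs_def])
  qed
  have \<rho>_top: "filterlim (\<lambda>n. \<rho> n * (sqrt (?\<Gamma> n) / ?\<Gamma>2 n)) at_top sequentially"
  proof (rule filterlim_at_top_mono)
    have "filterlim (\<lambda>n. sqrt (x n)) (at_right 0) sequentially"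
      unfolding filterlim_at
    proof
      show "eventually (\<lambda>n. sqrt (x n) \<in> {0<..} \<and> sqrt (x n) \<noteq> 0) sequentially"
        using eventually_ge_at_top[of 1]
      proof eventually_elim
        case (elim n)
        then show ?case using x_pos[of n] by simp
      qed
      show "(\<lambda>n. sqrt (x n)) \<longlonglongrightarrow> 0"
        using tendsto_real_sqrt[OF x_lim] by simp
    qed
    then show "filterlim (\<lambda>n. inverse (sqrt (x n))) at_top sequentially"
      by (rule filterlim_compose[OF filterlim_inverse_at_top_right])
    show "eventually (\<lambda>n. inverse (sqrt (x n)) \<le> \<rho> n * (sqrt (?\<Gamma> n) / ?\<Gamma>2 n)) sequentially"
      using eventually_ge_at_top[of 1]
    proof eventually_elim
      case (elim n)
      have "inverse (sqrt (x n)) = sqrt (x n) * (1 / x n)"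
        using x_pos[OF elim] by (simp add: field_simps)
      also have "\<dots> \<le> \<rho> n * (1 / x n)"
        using x0[of n] by (intro mult_right_mono \<rho>_ge) auto
      finally show ?case by (simp add: x_def)
    qed
  qed
  let ?A = "\<lambda>n. \<rho> n * (sqrt (?\<Gamma> n) / ?\<Gamma>2 n)"
  let ?P = "\<lambda>n a. prob {\<omega> \<in> space M. a \<le> \<bar>sqrt (?\<Gamma> n) * empirical \<gamma> X n (generator b \<sigma> f) \<omega>\<bar>}"
  have "\<exists>c C. incseq c \<and> decseq C \<and> (\<forall>n. 0 < c n \<and> c n \<le> 1 \<and> 1 \<le> C n) \<and> c \<longlonglongrightarrow> 1 \<and> C \<longlonglongrightarrow> 1 \<and>
    (\<forall>n\<ge>1. \<forall>a. 0 < a \<and> a \<le> ?A n \<longrightarrow> ?P n a \<le> 2 * C n * exp (- c n * (a\<^sup>2 / (2 * v * (grad_sup f)\<^sup>2))))"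
  proof (cases "v = 0 \<or> grad_sup f = 0")
    case True
    \<comment> \<open>Division by zero turns the exponent into 0 here, so the claim is that a
      probability is at most 2.\<close>
    have "?P n a \<le> 2" for n a using prob_le_1 by (rule order_trans) simp
    then show ?thesis
      using True by (intro exI[of _ "\<lambda>_. 1"]) (auto simp: incseq_def decseq_def)
  next
    case False
    have vL: "0 < v" "0 < grad_sup f"
      using False v grad_sup_nonneg[OF test_functionD(1)[OF f]] by auto
    have "\<exists>c C. incseq c \<and> decseq C \<and> (\<forall>n. 0 < c n \<and> c n \<le> 1 \<and> 1 \<le> C n) \<and> c \<longlonglongrightarrow> 1 \<and> C \<longlonglongrightarrow> 1 \<and>
      (\<forall>n. \<forall>a. 0 < a \<and> a \<le> ?A n \<longrightarrow> ?P n a \<le> 2 * C n * exp (- c n * (a\<^sup>2 / (2 * v * (grad_sup f)\<^sup>2))))"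
    proof (rule monotone_constants_from_asymptotic_bound)
      show "0 < 2 * v * (grad_sup f)\<^sup>2" using vL by simp
    qed (use deviation_eventually[OF f h poisson S vL div err \<rho>_pos \<rho>_lim] in simp_all)
    then show ?thesis by blast
  qed
  then show "\<exists>\<rho>. (\<forall>n. 0 < \<rho> n) \<and> (\<forall>n. \<delta> n \<le> \<rho> n) \<and> \<rho> \<longlonglongrightarrow> 0 \<and>
      filterlim (\<lambda>n. \<rho> n * (sqrt (?\<Gamma> n) / ?\<Gamma>2 n)) at_top sequentially \<and>
      (\<exists>c C. incseq c \<and> decseq C \<and> (\<forall>n. 0 < c n \<and> c n \<le> 1 \<and> 1 \<le> C n) \<and> c \<longlonglongrightarrow> 1 \<and> C \<longlonglongrightarrow> 1 \<and>
        (\<forall>n\<ge>1. \<forall>a. 0 < a \<and> a \<le> \<rho> n * (sqrt (?\<Gamma> n) / ?\<Gamma>2 n) \<longrightarrow>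
          ?P n a \<le> 2 * C n * exp (- c n * (a\<^sup>2 / (2 * v * (grad_sup f)\<^sup>2)))))"
    using \<rho>_pos \<rho>_ge \<rho>_lim \<rho>_top by (intro exI[of _ \<rho>]) auto
qed

end

theorem theorem3:
  fixes b :: "real^'d \<Rightarrow> real^'d" and \<sigma> :: "real^'d \<Rightarrow> real^'r^'d"
    and N :: "'w measure" and F :: "real \<Rightarrow> 'w measure" and W :: "real \<Rightarrow> 'w \<Rightarrow> real^'r"
    and Y :: "real^'d \<Rightarrow> real \<Rightarrow> 'w \<Rightarrow> real^'d" and \<nu> :: "(real^'d) measure"
    and M :: "'s measure" and X0 :: "'s \<Rightarrow> real^'d" and U :: "nat \<Rightarrow> 's \<Rightarrow> real^'r"
    and \<gamma> :: "nat \<Rightarrow> real" and V \<phi> :: "real^'d \<Rightarrow> real"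
    and vs CV \<alpha>V \<beta>V cbar K \<beta> \<theta> :: real
  assumes "\<exists>L. L-lipschitz_on UNIV b" and "\<exists>L. L-lipschitz_on UNIV \<sigma>"
    and "diffusion N F W b \<sigma> Y"
    and "prob_space M"
    and "X0 \<in> borel_measurable M" and "integrable M (\<lambda>\<omega>. (norm (X0 \<omega>))\<^sup>2)"
    and "step_sequence \<gamma>"
    and "assm_C1 M X0"
    and "assm_GC M X0 U"
    and "assm_C2 \<sigma>"
    and "assm_LV b \<sigma> V vs CV \<alpha>V \<beta>V"
    and "\<forall>x. K \<le> norm x \<longrightarrow> \<bar>V x\<bar> \<le> cbar * (norm x)\<^sup>2"
    and "unique_invariant_distribution N Y \<nu>"
    and "assm_S \<gamma> V CV \<alpha>V cbar"
    and "0 < \<beta>" and "\<beta> \<le> 1"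
    and "test_function \<beta> V \<phi>"
    and "1 / (2 + \<beta>) < \<theta>" and "\<theta> \<le> 1"
    and "\<gamma> \<in> \<Theta>(\<lambda>k. real k powr (- \<theta>))"
  shows
    "((\<exists>\<psi>. test_function \<beta> V \<psi> \<and>
         (\<forall>x. generator b \<sigma> \<psi> x = (op_norm (\<sigma> x))\<^sup>2 - (\<integral>y. (op_norm (\<sigma> y))\<^sup>2 \<partial>\<nu>))) \<longrightarrow>
       deviation_bound M \<gamma>
         (\<lambda>n. empirical \<gamma> (scheme b \<sigma> \<gamma> X0 U) n (generator b \<sigma> \<phi>))
         (\<integral>y. (op_norm (\<sigma> y))\<^sup>2 \<partial>\<nu>) (grad_sup \<phi>)) \<and>
     (\<forall>nrm. matrix_norm nrm \<and> (\<forall>A. op_norm A \<le> nrm A) \<and>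
         (\<exists>\<psi>. test_function \<beta> V \<psi> \<and>
           (\<forall>x. generator b \<sigma> \<psi> x = (nrm (\<sigma> x))\<^sup>2 - (\<integral>y. (nrm (\<sigma> y))\<^sup>2 \<partial>\<nu>))) \<longrightarrow>
       deviation_bound M \<gamma>
         (\<lambda>n. empirical \<gamma> (scheme b \<sigma> \<gamma> X0 U) n (generator b \<sigma> \<phi>))
         (\<integral>y. (nrm (\<sigma> y))\<^sup>2 \<partial>\<nu>) (grad_sup \<phi>))"
proof -
  interpret prob_space M by fact
  have \<gamma>_pos: "0 < \<gamma> k" if "1 \<le> k" for k
    using assms(7) that by (simp add: step_sequence_def)
  have \<gamma>_le: "\<gamma> k \<le> \<gamma> 1" if "1 \<le> k" for k
    using that
  proof (induction k rule: dec_induct)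
    case (step k)
    then have "\<gamma> (Suc k) \<le> \<gamma> k" using assms(7) by (simp add: step_sequence_def)
    with step show ?case by linarith
  qed simp
  have div: "filterlim (Gam \<gamma>) at_top sequentially"
    using assms(7) by (simp add: step_sequence_def)
  interpret euler_scheme M X0 U b \<sigma> \<gamma>
  proof
    show "X0 \<in> borel_measurable M" "assm_GC M X0 U" by fact+
    show "continuous_on UNIV b" using assms(1) lipschitz_on_continuous_on by blast
    show "continuous_on UNIV \<sigma>" using assms(2) lipschitz_on_continuous_on by blast
  qed
  have CV: "0 < CV" "0 < \<alpha>V" "0 < vs" and V2: "C_k 2 V"
    and Hb: "bdd_above (range (\<lambda>x. op_norm (hess V x)))" and Vge: "\<And>x. vs \<le> V x"
    and growth: "\<And>x. (norm (grad V x))\<^sup>2 + (norm (b x))\<^sup>2 \<le> CV * V x"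
    using assms(11) by (auto simp: assm_LV_def)
  obtain \<kappa>' where \<kappa>': "\<And>x. (op_norm (\<sigma> x))\<^sup>2 \<le> \<kappa>'" using assms(10) by (auto simp: assm_C2_def)
  have \<kappa>: "op_norm (\<sigma> x) \<le> sqrt \<kappa>'" for x
    by (rule real_le_rsqrt[OF \<kappa>'])
  have gm: "\<gamma> 1 * (CV * hess_sup V) \<le> \<alpha>V / 2"
  \<comment> \<open>For a vanishing Hessian bound the quotient in (S) is a division by zero, while
    the inequality to be shown has left-hand side 0.\<close>
  proof (cases "hess_sup V = 0")
    case True
    then show ?thesis using CV by simp
  next
    case False
    then have H: "0 < hess_sup V"
      using op_norm_hess_le[OF Hb, of 0] op_norm_nonneg[of "hess V 0"] by linarith
    have "\<gamma> 1 \<le> 1/2 * (\<alpha>V / (CV * hess_sup V))"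
      using assms(14) by (auto simp: assm_S_def)
    then show ?thesis using CV H by (simp add: field_simps)
  qed
  obtain l B where lB: "0 < l" "0 \<le> B" "\<And>n. (\<integral>\<^sup>+\<omega>. ennreal (exp (l * V (X n \<omega>))) \<partial>M) \<le> ennreal (exp B)"
    using lyapunov_moments[OF assms(11) \<kappa> \<gamma>_pos \<gamma>_le gm assms(8)] by metis
  interpret lyapunov_scheme M X0 U b \<sigma> \<gamma> V vs CV "sqrt \<kappa>'" \<beta> l B
  proof
    show "V \<in> borel_measurable borel"
      by (intro borel_measurable_continuous_onI C_k_continuous[OF V2])
    show "(norm (b x))\<^sup>2 \<le> CV * V x" for x
      using growth[of x] zero_le_power2[of "norm (grad V x)"] by linarith
  qed (use CV Vge \<kappa> \<gamma>_pos assms(15,16) lB in auto)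
  \<comment> \<open>The lower bound on \<theta> in the form that makes the series of steps to the
    power 2 + \<beta> converge.\<close>
  have "1 < \<theta> * (2 + \<beta>)"
    using assms(15,18) by (simp add: pos_divide_less_eq)
  then have sm: "summable (\<lambda>k. \<gamma> (Suc k) powr (2 + \<beta>))"
    using assms(15) by (intro summable_powr_if_bigtheta[OF \<gamma>_pos assms(20)]) auto
  \<comment> \<open>Parts (a) and (b) differ only in the function that dominates the operator norm;
    (a) is the case where it is the operator norm itself.\<close>
  have bound: "deviation_bound M \<gamma> (\<lambda>n. empirical \<gamma> X n (generator b \<sigma> \<phi>)) (\<integral>y. (nrm (\<sigma> y))\<^sup>2 \<partial>\<nu>) (grad_sup \<phi>)"
    if nrm: "\<And>A. op_norm A \<le> nrm A" and \<psi>: "test_function \<beta> V \<psi>"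
      "\<And>x. generator b \<sigma> \<psi> x = (nrm (\<sigma> x))\<^sup>2 - (\<integral>y. (nrm (\<sigma> y))\<^sup>2 \<partial>\<nu>)" for nrm :: "real^'r^'d \<Rightarrow> real" and \<psi>
    by (rule deviation_bound_scheme[OF assms(17) \<psi> _ _ \<gamma>_le div sm])
      (auto intro!: power_mono nrm op_norm_nonneg)
  show ?thesis
  proof (intro conjI impI allI; elim exE conjE)
    fix \<psi> assume \<psi>: "test_function \<beta> V \<psi>"
      "\<forall>x. generator b \<sigma> \<psi> x = (op_norm (\<sigma> x))\<^sup>2 - (\<integral>y. (op_norm (\<sigma> y))\<^sup>2 \<partial>\<nu>)"
    show "deviation_bound M \<gamma> (\<lambda>n. empirical \<gamma> X n (generator b \<sigma> \<phi>)) (\<integral>y. (op_norm (\<sigma> y))\<^sup>2 \<partial>\<nu>) (grad_sup \<phi>)"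
      by (rule bound[of op_norm, OF order_refl \<psi>(1) spec[OF \<psi>(2)]])
  next
    fix nrm :: "real^'r^'d \<Rightarrow> real" and \<psi>
    assume nrm: "\<forall>A. op_norm A \<le> nrm A" and \<psi>: "test_function \<beta> V \<psi>"
      "\<forall>x. generator b \<sigma> \<psi> x = (nrm (\<sigma> x))\<^sup>2 - (\<integral>y. (nrm (\<sigma> y))\<^sup>2 \<partial>\<nu>)"
    show "deviation_bound M \<gamma> (\<lambda>n. empirical \<gamma> X n (generator b \<sigma> \<phi>)) (\<integral>y. (nrm (\<sigma> y))\<^sup>2 \<partial>\<nu>) (grad_sup \<phi>)"
      by (rule bound[OF spec[OF nrm] \<psi>(1) spec[OF \<psi>(2)]])
  qed
qed

end
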